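(* Let $H\in(0,1)$ and let $X$ be an $H$-self-similar Gaussian field with stationary increments on $\mathbb{R}^2$ admitting a spectral density $f_X$ whose anisotropy function $C_X$ is bounded. Let $\psi:\mathbb{R}^2\to\mathbb{R}$ be a real isotropic wavelet with $2$ zero moments and fast decay, defined by its 2-D Fourier transform $\widehat\psi(\xi)=\varphi(\|\xi\|)$. For $\ell\in\{1,2\}$ consider the Gaussian variables $\langle X,\mathcal{R}_\ell\psi\rangle=\int_{\mathbb{R}^2}X(x)\,\mathcal{R}_\ell\psi(x)\,dx$, and define the matrix $$\mathbf{J}_X^{\psi}=\begin{pmatrix}|\langle X,\mathcal{R}_1\psi\rangle|^2 & \langle X,\mathcal{R}_1\psi\rangle\overline{\langle X,\mathcal{R}_2\psi\rangle}\\ \overline{\langle X,\mathcal{R}_1\psi\rangle}\langle X,\mathcal{R}_2\psi\rangle & |\langle X,\mathcal{R}_2\psi\rangle|^2\end{pmatrix}.$$ Then the covariance matrix of the Gaussian vector $(\langle X,\mathcal{R}_1\psi\rangle,\langle X,\mathcal{R}_2\psi\rangle)^{T}$ is $$\mathbb{E}\big[\mathbf{J}_X^{\psi}\big]=\left(\int_0^{+\infty}\frac{|\varphi(r)|^2}{r^{2H+1}}\,dr\right)\mathbf{J}_X,$$ where for all $\ell_1,\ell_2\in\{1,2\}$ $$[\mathbf{J}_X]_{\ell_1,\ell_2}=\int_{\Theta\in\mathbb{S}^1}\Theta_{\ell_1}\Theta_{\ell_2}\,C_X(\Theta)\,d\Theta,\qquad \Theta=(\Theta_1,\Theta_2).$$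 Moreover $\mathbf{J}_X$ is a nonnegative definite $2\times2$ matrix depending only on the anisotropy function $C_X$.
   Context: All Gaussian fields are real-valued, centered, indexed by $\mathbb{R}^2$ and stochastically continuous (the covariance $(x,y)\mapsto\mathbb{E}[X(x)X(y)]$ is continuous). $X$ has stationary increments if for every $x$, $\{X(x+h)-X(x)\}_{h\in\mathbb{R}^2}$ and $\{X(h)\}_{h\in\mathbb{R}^2}$ have the same finite-dimensional distributions; $X$ is $H$-self-similar ($H\in(0,1)$) if for every $c>0$, $\{X(cx)\}_x$ and $\{c^HX(x)\}_x$ have the same finite-dimensional distributions. $X$ admits the spectral density $f_X\ge0$ (necessarily even) if $\int\min(1,\|\xi\|^2)f_X(\xi)\,d\xi<\infty$ and $\mathbb{E}[X(x)X(y)]=\int_{\mathbb{R}^2}(e^{\mathrm{j}\langle x,\xi\rangle}-1)(e^{-\mathrm{j}\langle y,\xi\rangle}-1)f_X(\xi)\,d\xi$ for all $x,y$ ($\mathrm{j}$ is the imaginary unit). For an $H$-self-similar field with stationary increments and spectral density, $f_X(\xi)=\|\xi\|^{-2H-2}C_X(\xi/\|\xi\|)$ for a nonnegative function $C_X$ on the unit circle $\mathbb{S}^1\subset\mathbb{R}^2$, called the anisotropy function of $X$; $d\Theta$ denotes arc length measure on $\mathbb{S}^1$. Fourier transform: $\widehat f(\xi)=\int_{\mathbb{R}^2}f(x)e^{-\mathrm{j}\langle x,\xi\rangle}\,dx$. The Riesz transforms of $f\in L^2(\mathbb{R}^2)$ are defined by $\widehat{\mathcal{R}_\ell f}(\xi)=-\mathrm{j}\,\frac{\xi_\ell}{\|\xi\|}\widehat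 f(\xi)$, $\ell=1,2$. "Two zero moments" means $\int x^{\kappa}\psi(x)\,dx=0$ for all multi-indices $\kappa$ with $|\kappa|\le1$; "fast decay" means that for every $N$ there is $C_N$ with $|\psi(x)|\le C_N(1+\|x\|)^{-N}$ for all $x$. The matrix $\mathbf{J}_X$ is called the structure tensor of $X$. *)

theory Defs
  imports "HOL-Probability.Probability"
begin

section \<open>Gaussian random fields on the plane\<close>

text \<open>Degenerate variables are admitted, as they have to be here: a self-similar field
  vanishes almost surely at the origin.\<close>
definition centered_gaussian :: "'w measure \<Rightarrow> ('w \<Rightarrow> real) \<Rightarrow> bool" where
  "centered_gaussian M Y \<longleftrightarrow> Y \<in> borel_measurable M \<and>
     ((\<exists>\<sigma>>0. distributed M lborel Y (normal_density 0 \<sigma>)) \<or> (AE \<omega> in M. Y \<omega> = 0))"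

definition centered_gaussian_vector :: "'w measure \<Rightarrow> ('w \<Rightarrow> real^'n) \<Rightarrow> bool" where
  "centered_gaussian_vector M Y \<longleftrightarrow> (\<forall>a. centered_gaussian M (\<lambda>\<omega>. a \<bullet> Y \<omega>))"

definition centered_gaussian_field :: "'w measure \<Rightarrow> (real^2 \<Rightarrow> 'w \<Rightarrow> real) \<Rightarrow> bool" where
  "centered_gaussian_field M X \<longleftrightarrow>
     (\<forall>S a. finite S \<longrightarrow> centered_gaussian M (\<lambda>\<omega>. \<Sum>x\<in>S. a x * X x \<omega>))"

definition stochastically_continuous :: "'w measure \<Rightarrow> (real^2 \<Rightarrow> 'w \<Rightarrow> real) \<Rightarrow> bool" where
  "stochastically_continuous M X \<longleftrightarrow>
     continuous_on UNIV (\<lambda>(x, y). LINT \<omega>|M. X x \<omega> * X y \<omega>)"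

definition same_fdd ::
    "'w measure \<Rightarrow> (real^2 \<Rightarrow> 'w \<Rightarrow> real) \<Rightarrow> (real^2 \<Rightarrow> 'w \<Rightarrow> real) \<Rightarrow> bool" where
  "same_fdd M X Y \<longleftrightarrow> (\<forall>S. finite S \<longrightarrow>
     distr M (PiM S (\<lambda>_. borel)) (\<lambda>\<omega>. \<lambda>x\<in>S. X x \<omega>) =
     distr M (PiM S (\<lambda>_. borel)) (\<lambda>\<omega>. \<lambda>x\<in>S. Y x \<omega>))"

definition stationary_increments :: "'w measure \<Rightarrow> (real^2 \<Rightarrow> 'w \<Rightarrow> real) \<Rightarrow> bool" where
  "stationary_increments M X \<longleftrightarrow> (\<forall>x. same_fdd M (\<lambda>h \<omega>. X (x + h) \<omega> - X x \<omega>) X)"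

definition self_similar :: "'w measure \<Rightarrow> real \<Rightarrow> (real^2 \<Rightarrow> 'w \<Rightarrow> real) \<Rightarrow> bool" where
  "self_similar M H X \<longleftrightarrow>
     (\<forall>c>0. same_fdd M (\<lambda>x. X (c *\<^sub>R x)) (\<lambda>x \<omega>. c powr H * X x \<omega>))"

definition spectral_density ::
    "'w measure \<Rightarrow> (real^2 \<Rightarrow> 'w \<Rightarrow> real) \<Rightarrow> (real^2 \<Rightarrow> real) \<Rightarrow> bool" where
  "spectral_density M X f \<longleftrightarrow> f \<in> borel_measurable borel \<and> (\<forall>\<xi>. 0 \<le> f \<xi>) \<and>
     integrable lborel (\<lambda>\<xi>. min 1 ((norm \<xi>)\<^sup>2) * f \<xi>) \<and>
     (\<forall>x y. complex_of_real (LINT \<omega>|M. X x \<omega> * X y \<omega>) =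
       (LINT \<xi>|lborel. (exp (\<i> * complex_of_real (x \<bullet> \<xi>)) - 1) *
          (exp (- (\<i> * complex_of_real (y \<bullet> \<xi>))) - 1) * complex_of_real (f \<xi>)))"

text \<open>A spectral density is only determined up to null sets, hence the almost-everywhere
  equality. Values of \<open>C\<close> off the unit circle are irrelevant.\<close>
definition anisotropy_function ::
    "real \<Rightarrow> (real^2 \<Rightarrow> real) \<Rightarrow> (real^2 \<Rightarrow> real) \<Rightarrow> bool" where
  "anisotropy_function H f C \<longleftrightarrow>
     C \<in> borel_measurable (restrict_space borel (sphere 0 1)) \<and>
     (\<forall>\<Theta>\<in>sphere 0 1. 0 \<le> C \<Theta>) \<and>
     (AE \<xi> in lborel. f \<xi> = norm \<xi> powr (- 2 * H - 2) * C (\<xi> /\<^sub>R norm \<xi>))"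

section \<open>The structure tensor\<close>

definition arc_length :: "(real^2) measure" where
  "arc_length = distr (restrict_space lborel {0..<2 * pi})
     (restrict_space borel (sphere 0 1)) (\<lambda>t. vector [cos t, sin t])"

definition structure_tensor :: "(real^2 \<Rightarrow> real) \<Rightarrow> real^2^2" where
  "structure_tensor C = (\<chi> l1 l2. LINT \<Theta>|arc_length. \<Theta> $ l1 * \<Theta> $ l2 * C \<Theta>)"

definition nonneg_definite :: "real^'n^'n \<Rightarrow> bool" where
  "nonneg_definite A \<longleftrightarrow> transpose A = A \<and> (\<forall>v. 0 \<le> v \<bullet> (A *v v))"

section \<open>Fourier and Riesz transforms\<close>

definition fourier :: "(real^2 \<Rightarrow> complex) \<Rightarrow> real^2 \<Rightarrow> complex" where
  "fourier f \<xi> = (LINT x|lborel. f x * exp (- (\<i> * complex_of_real (x \<bullet> \<xi>))))"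

definition square_integrable :: "(real^2 \<Rightarrow> complex) \<Rightarrow> bool" where
  "square_integrable f \<longleftrightarrow>
     f \<in> borel_measurable borel \<and> integrable lborel (\<lambda>x. (cmod (f x))\<^sup>2)"

text \<open>The Fourier transform on \<open>L\<^sup>2\<close> is the \<open>L\<^sup>2\<close> limit of the transforms of the truncations
  to balls. It is a relation because the limit is only determined almost everywhere. The
  nonnegative integral is used because, unlike the Bochner integral, it does not assign the
  value 0 to a divergent integral.\<close>
definition has_fourier_L2 :: "(real^2 \<Rightarrow> complex) \<Rightarrow> (real^2 \<Rightarrow> complex) \<Rightarrow> bool" where
  "has_fourier_L2 f F \<longleftrightarrow> square_integrable f \<and> square_integrable F \<and>
     ((\<lambda>R. \<integral>\<^sup>+\<xi>. ennreal ((cmod (fourier (\<lambda>x. indicator (cball 0 R) x * f x) \<xi> - F \<xi>))\<^sup>2)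
        \<partial>lborel) \<longlongrightarrow> 0) at_top"

text \<open>A representative of the Riesz transform of \<open>f\<close>, for \<open>f\<close> in \<open>L\<^sup>2\<close>.\<close>
definition riesz :: "2 \<Rightarrow> (real^2 \<Rightarrow> complex) \<Rightarrow> real^2 \<Rightarrow> complex" where
  "riesz l f = (SOME g. \<exists>F. has_fourier_L2 f F \<and>
     has_fourier_L2 g (\<lambda>\<xi>. - \<i> * complex_of_real (\<xi> $ l / norm \<xi>) * F \<xi>))"

section \<open>Wavelets\<close>

definition zero_moments :: "nat \<Rightarrow> (real^2 \<Rightarrow> real) \<Rightarrow> bool" where
  "zero_moments n \<psi> \<longleftrightarrow> (\<forall>\<kappa> :: 2 \<Rightarrow> nat. (\<Sum>i\<in>UNIV. \<kappa> i) < n \<longrightarrow>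
     (LINT x|lborel. (\<Prod>i\<in>UNIV. (x $ i) ^ \<kappa> i) * \<psi> x) = 0)"

definition fast_decay :: "(real^2 \<Rightarrow> real) \<Rightarrow> bool" where
  "fast_decay \<psi> \<longleftrightarrow> (\<forall>N::nat. \<exists>C. \<forall>x. \<bar>\<psi> x\<bar> \<le> C / (1 + norm x) ^ N)"

section \<open>Integrating a field against a function\<close>

definition jointly_measurable :: "'w measure \<Rightarrow> (real^2 \<Rightarrow> 'w \<Rightarrow> real) \<Rightarrow> bool" where
  "jointly_measurable M X \<longleftrightarrow> (\<lambda>(x, \<omega>). X x \<omega>) \<in> borel_measurable (lborel \<Otimes>\<^sub>M M)"

text \<open>Sample paths can be integrated once the field is jointly measurable in space and
  chance. A stochastically continuous field need not be, but it always has a modification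
  which is. By Fubini's theorem the choice of the modification only affects the integral on
  a null set.\<close>
definition measurable_version ::
    "'w measure \<Rightarrow> (real^2 \<Rightarrow> 'w \<Rightarrow> real) \<Rightarrow> real^2 \<Rightarrow> 'w \<Rightarrow> real" where
  "measurable_version M X = (if jointly_measurable M X then X
     else (SOME Y. jointly_measurable M Y \<and> (\<forall>x. AE \<omega> in M. Y x \<omega> = X x \<omega>)))"

definition pairing ::
    "'w measure \<Rightarrow> (real^2 \<Rightarrow> 'w \<Rightarrow> real) \<Rightarrow> (real^2 \<Rightarrow> complex) \<Rightarrow> 'w \<Rightarrow> complex" where
  "pairing M X g \<omega> =
     (LINT x|lborel. complex_of_real (measurable_version M X x \<omega>) * g x)"

definition pairing_converges ::
    "'w measure \<Rightarrow> (real^2 \<Rightarrow> 'w \<Rightarrow> real) \<Rightarrow> (real^2 \<Rightarrow> complex) \<Rightarrow> bool" where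
  "pairing_converges M X g \<longleftrightarrow> jointly_measurable M (measurable_version M X) \<and>
     (\<forall>x. AE \<omega> in M. measurable_version M X x \<omega> = X x \<omega>) \<and>
     (AE \<omega> in M. integrable lborel
        (\<lambda>x. complex_of_real (measurable_version M X x \<omega>) * g x))"

definition riesz_vector ::
    "'w measure \<Rightarrow> (real^2 \<Rightarrow> 'w \<Rightarrow> real) \<Rightarrow> (real^2 \<Rightarrow> real) \<Rightarrow> 'w \<Rightarrow> complex^2" where
  "riesz_vector M X \<psi> \<omega> =
     (\<chi> l. pairing M X (riesz l (\<lambda>x. complex_of_real (\<psi> x))) \<omega>)"

definition covariance_matrix :: "'w measure \<Rightarrow> ('w \<Rightarrow> complex^'n) \<Rightarrow> complex^'n^'n" where
  "covariance_matrix M Y = (\<chi> i j. LINT \<omega>|M.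
     (Y \<omega> $ i - (LINT \<omega>'|M. Y \<omega>' $ i)) * cnj (Y \<omega> $ j - (LINT \<omega>'|M. Y \<omega>' $ j)))"

definition wavelet_structure_tensor ::
    "'w measure \<Rightarrow> (real^2 \<Rightarrow> 'w \<Rightarrow> real) \<Rightarrow> (real^2 \<Rightarrow> real) \<Rightarrow> 'w \<Rightarrow> complex^2^2" where
  "wavelet_structure_tensor M X \<psi> \<omega> =
     (let Y1 = riesz_vector M X \<psi> \<omega> $ 1; Y2 = riesz_vector M X \<psi> \<omega> $ 2 in
      vector [vector [complex_of_real ((cmod Y1)\<^sup>2), Y1 * cnj Y2],
              vector [cnj Y1 * Y2, complex_of_real ((cmod Y2)\<^sup>2)]])"

end

(* Plancherel's theorem is obtained by integrating the squared transform against wide Gaussians;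
   it makes the L2 transform injective and onto, which pins down the Riesz transforms up to null
   sets. Their symbol is (xi_l / |xi|) times a transform of order |xi|^2 at the origin, so its
   second differences with step h are O(|h|^2) in L2. Hence |x|^2 R_l psi is square integrable,
   R_l psi is integrable against (1 + |x|)^H, and the pairing with X converges almost surely. It
   is an L2 limit of Riemann sums, hence Gaussian. By Fubini the covariance of two pairings is
   the f-weighted scalar product of the transforms, which factors in polar coordinates. *)

theory Submission
  imports Defs
begin

section \<open>Continuity of translations\<close>

text \<open>The pairing is a pathwise integral, so the Riesz transforms must be integrable against
  |x|^H, the growth of the standard deviation of X. They need not inherit the fast decay of the
  wavelet, since the symbol xi_l / |xi| jumps at the origin. The transform of the wavelet is of
  order |xi|^2 there because two moments vanish, and this is just enough to tame the second
  differences of the product. Differences and Fatou's lemma replace derivatives, which may fail to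
  exist at the origin. Two powers of |x| in L2 are enough because (1 + |x|)^(H - 2) is square
  integrable on the plane for H < 1. The spectral kernel is exp - 1, not exp; the constant drops out
  because the Riesz transforms have integral zero, which is read off from their continuous
  transforms at the origin. No random spectral measure is built: one Fubini statement is applied to
  X over the probability space and to the deterministic kernel over frequency space, and the two
  covariance kernels coincide.\<close>

lemma nn_integral_lborel_shift:
  fixes f :: "'a::euclidean_space \<Rightarrow> ennreal"
  assumes [measurable]: "f \<in> borel_measurable borel"
  shows "(\<integral>\<^sup>+x. f (z + x) \<partial>lborel) = (\<integral>\<^sup>+x. f x \<partial>lborel)"
  by (subst (2) lborel_distr_plus[of z, symmetric]) (simp add: nn_integral_distr)

lemma integral_lborel_shift:
  fixes f :: "'a::euclidean_space \<Rightarrow> 'b::{banach, second_countable_topology}"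
  assumes [measurable]: "f \<in> borel_measurable borel"
  shows "(LINT x|lborel. f (z + x)) = (LINT x|lborel. f x)"
  by (subst (2) lborel_distr_plus[of z, symmetric]) (simp add: integral_distr)

lemma integrable_lborel_shift:
  fixes f :: "'a::euclidean_space \<Rightarrow> 'b::{banach, second_countable_topology}"
  assumes "integrable lborel f"
  shows "integrable lborel (\<lambda>x. f (z + x))"
proof -
  have [measurable]: "f \<in> borel_measurable borel" using assms by auto
  have "integrable (distr lborel borel ((+) z)) f" using assms by (simp only: lborel_distr_plus)
  then show ?thesis by (subst (asm) integrable_distr_eq) auto
qed

lemma lborel_distr_uminus': "distr lborel borel uminus = (lborel :: 'a::euclidean_space measure)"
  by (subst lborel_affine[of "-1" 0]) (auto simp: density_1 one_ennreal_def[symmetric])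

lemma nn_integral_lborel_reflect:
  fixes f :: "'a::euclidean_space \<Rightarrow> ennreal"
  assumes [measurable]: "f \<in> borel_measurable borel"
  shows "(\<integral>\<^sup>+x. f (- x) \<partial>lborel) = (\<integral>\<^sup>+x. f x \<partial>lborel)"
  by (subst (2) lborel_distr_uminus'[symmetric]) (simp add: nn_integral_distr)

text \<open>The pattern of all density arguments below, with \<open>k\<close> numbering the
  approximants: for fixed \<open>k\<close> the term \<open>b k\<close> dies out, so the limes
  superior is at most every \<open>c k\<close>, and then \<open>k\<close> goes to infinity.\<close>

lemma tendsto_0_ennreal_approx:
  fixes a :: "nat \<Rightarrow> ennreal" and c :: "nat \<Rightarrow> ennreal"
  assumes "\<And>n k. a n \<le> c k + b k n" "c \<longlonglongrightarrow> 0" "\<And>k. b k \<longlonglongrightarrow> 0"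
  shows "a \<longlonglongrightarrow> 0"
proof -
  have "limsup a \<le> c k" for k
  proof -
    have "limsup a \<le> limsup (\<lambda>n. c k + b k n)"
      by (rule Limsup_mono) (use assms(1) in auto)
    also have "(\<lambda>n. c k + b k n) \<longlonglongrightarrow> c k + 0"
      by (intro tendsto_add tendsto_const assms)
    then have "limsup (\<lambda>n. c k + b k n) = c k"
      by (intro lim_imp_Limsup) auto
    finally show ?thesis .
  qed
  then have "limsup a \<le> 0"
    by (intro LIMSEQ_le_const[OF assms(2)]) auto
  then have "limsup a = 0" by simp
  moreover have "liminf a \<le> limsup a" by (rule Liminf_le_Limsup) simp
  ultimately show ?thesis
    by (intro Liminf_eq_Limsup) auto
qed

lemma tendsto_0_ennreal_le:
  fixes a b :: "'i \<Rightarrow> ennreal"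
  assumes "(b \<longlongrightarrow> 0) F" "\<And>n. a n \<le> b n"
  shows "(a \<longlongrightarrow> 0) F"
  by (rule tendsto_sandwich[OF _ _ tendsto_const assms(1)]) (use assms(2) in auto)

lemma tendsto_0_ennreal_cmult:
  fixes a :: "'i \<Rightarrow> ennreal"
  assumes "(a \<longlongrightarrow> 0) F" "c < \<infinity>"
  shows "((\<lambda>n. c * a n) \<longlongrightarrow> 0) F"
  using tendsto_mult_ennreal[OF tendsto_const[of c] assms(1)] assms(2)
  by (cases "c = 0") auto

text \<open>Functions with L1-continuous translates are closed under L1 limits. By translation
  invariance the approximation error enters twice with the same value, hence the factor 2.\<close>

lemma translation_tendsto_L1_approx:
  fixes u :: "'a::euclidean_space \<Rightarrow> 'b::{banach, second_countable_topology}"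
  assumes [measurable]: "u \<in> borel_measurable borel" "\<And>k. v k \<in> borel_measurable borel"
    and c: "(\<lambda>k::nat. \<integral>\<^sup>+x. norm (u x - v k x) \<partial>lborel) \<longlonglongrightarrow> 0"
    and b: "\<And>k. (\<lambda>n. \<integral>\<^sup>+x. norm (v k (z n + x) - v k x) \<partial>lborel) \<longlonglongrightarrow> 0"
  shows "(\<lambda>n. \<integral>\<^sup>+x. norm (u (z n + x) - u x) \<partial>lborel) \<longlonglongrightarrow> 0"
proof (rule tendsto_0_ennreal_approx[OF _ _ b])
  show "(\<lambda>k. 2 * (\<integral>\<^sup>+x. norm (u x - v k x) \<partial>lborel)) \<longlonglongrightarrow> 0"
    by (rule tendsto_0_ennreal_cmult[OF c]) simp
  fix n k
  have "(\<integral>\<^sup>+x. norm (u (z n + x) - u x) \<partial>lborel)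
    \<le> (\<integral>\<^sup>+x. ennreal (norm (u (z n + x) - v k (z n + x))) + ennreal (norm (v k (z n + x) - v k x))
         + ennreal (norm (u x - v k x)) \<partial>lborel)"
  proof (intro nn_integral_mono)
    fix x
    have "norm (u (z n + x) - u x) \<le> norm (u (z n + x) - v k (z n + x)) + norm (v k (z n + x) - v k x)
      + norm (u x - v k x)"
      by (smt (verit) norm_diff_triangle_le norm_minus_commute order_refl)
    then show "ennreal (norm (u (z n + x) - u x)) \<le> ennreal (norm (u (z n + x) - v k (z n + x)))
       + ennreal (norm (v k (z n + x) - v k x)) + ennreal (norm (u x - v k x))"
      by (simp flip: ennreal_plus)
  qed
  also have "\<dots> = (\<integral>\<^sup>+x. norm (u (z n + x) - v k (z n + x)) \<partial>lborel)
     + (\<integral>\<^sup>+x. norm (v k (z n + x) - v k x) \<partial>lborel) + (\<integral>\<^sup>+x. norm (u x - v k x) \<partial>lborel)"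
    by (simp add: nn_integral_add)
  also have "(\<integral>\<^sup>+x. norm (u (z n + x) - v k (z n + x)) \<partial>lborel) = (\<integral>\<^sup>+x. norm (u x - v k x) \<partial>lborel)"
    by (rule nn_integral_lborel_shift) simp
  finally show "(\<integral>\<^sup>+x. norm (u (z n + x) - u x) \<partial>lborel) \<le> 2 * (\<integral>\<^sup>+x. norm (u x - v k x) \<partial>lborel)
      + (\<integral>\<^sup>+x. norm (v k (z n + x) - v k x) \<partial>lborel)"
    by (simp add: mult_2 ac_simps)
qed

text \<open>Openness controls \<open>indicator T (z n + x)\<close> in the limit only for points x of
  \<open>T\<close>; nothing is known at boundary points outside \<open>T\<close>. So dominated
  convergence treats only the part of \<open>T\<close> missed by the translate, and the opposite
  part has the same measure because \<open>T\<close> and its translate have equal finite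
  measure.\<close>

lemma translation_tendsto_open:
  fixes T :: "'a::euclidean_space set"
  assumes "open T" "emeasure lborel T < \<infinity>" "z \<longlonglongrightarrow> 0"
  shows "(\<lambda>n. \<integral>\<^sup>+x. norm (indicator T (z n + x) *\<^sub>R c - indicator T x *\<^sub>R (c::'b::{banach, second_countable_topology})) \<partial>lborel) \<longlonglongrightarrow> 0"
proof -
  note [measurable] = borel_open[OF assms(1)]
  have bound: "(\<integral>\<^sup>+x. ennreal (indicator T x) \<partial>lborel) < \<infinity>"
    using assms(2) by (simp add: ennreal_indicator nn_integral_indicator)
  have iT: "integrable lborel (indicator T :: _ \<Rightarrow> real)"
    using assms(2) by simp
  have lim: "(\<lambda>n. \<integral>\<^sup>+x. norm (indicator T x - indicator T x * indicator T (z n + x) :: real) \<partial>lborel) \<longlonglongrightarrow> 0"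
  proof (rule nn_integral_dominated_convergence_norm[OF _ _ _ _ bound])
    show "AE x in lborel. (\<lambda>n. indicator T x * indicator T (z n + x) :: real) \<longlonglongrightarrow> indicator T x"
    proof (intro AE_I2)
      fix x
      show "(\<lambda>n. indicator T x * indicator T (z n + x) :: real) \<longlonglongrightarrow> indicator T x"
      proof (cases "x \<in> T")
        case True
        have "(\<lambda>n. z n + x) \<longlonglongrightarrow> 0 + x" using assms(3) by (intro tendsto_intros)
        then have "\<forall>\<^sub>F n in sequentially. z n + x \<in> T"
          using assms(1) True by (auto elim!: topological_tendstoD)
        then have "\<forall>\<^sub>F n in sequentially. indicator T x * indicator T (z n + x) = (indicator T x :: real)"
          by eventually_elim (use True in auto)
        then show ?thesis by (rule tendsto_eventually)
      qed auto
    qed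
  qed (auto simp: indicator_def)
  show ?thesis
  proof (rule tendsto_0_ennreal_le)
    show "(\<lambda>n. ennreal (2 * norm c) * (\<integral>\<^sup>+x. norm (indicator T x - indicator T x * indicator T (z n + x) :: real) \<partial>lborel)) \<longlonglongrightarrow> 0"
      by (rule tendsto_0_ennreal_cmult[OF lim]) simp
    fix n
    let ?I = "\<integral>\<^sup>+x. norm (indicator T x - indicator T x * indicator T (z n + x) :: real) \<partial>lborel"
    have P: "(\<integral>\<^sup>+x. indicator T x * indicator T (z n + x) \<partial>lborel) \<le> (\<integral>\<^sup>+x. indicator T x \<partial>lborel)"
      by (intro nn_integral_mono) (auto simp: indicator_def)
    have fin: "(\<integral>\<^sup>+x. indicator T x * indicator T (z n + x) \<partial>lborel) \<noteq> \<infinity>"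
      by (rule less_imp_neq, rule le_less_trans[OF P]) (use assms(2) in simp)
    have e1: "?I = (\<integral>\<^sup>+x. indicator T x - indicator T x * indicator T (z n + x) \<partial>lborel)"
      by (intro nn_integral_cong) (auto simp: indicator_def)
    have e2: "\<dots> = (\<integral>\<^sup>+x. indicator T x \<partial>lborel) - (\<integral>\<^sup>+x. indicator T x * indicator T (z n + x) \<partial>lborel)"
      using fin by (intro nn_integral_diff) (auto simp: indicator_def)
    have e3: "(\<integral>\<^sup>+x. indicator T x \<partial>lborel) = (\<integral>\<^sup>+x. indicator T (z n + x) \<partial>lborel)"
      by (rule nn_integral_lborel_shift[symmetric]) simp
    have e4: "(\<integral>\<^sup>+x. indicator T (z n + x) \<partial>lborel) - (\<integral>\<^sup>+x. indicator T x * indicator T (z n + x) \<partial>lborel)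
        = (\<integral>\<^sup>+x. indicator T (z n + x) - indicator T x * indicator T (z n + x) \<partial>lborel)"
      using fin by (intro nn_integral_diff[symmetric]) (auto simp: indicator_def)
    have e5: "(\<integral>\<^sup>+x. indicator T (z n + x) - indicator T x * indicator T (z n + x) \<partial>lborel) = ?I"
      by (simp only: e1 e2 e3 e4)
    have scale: "ennreal (norm c) * (J + J) = ennreal (2 * norm c) * J" for J
      by (metis ennreal_mult' ennreal_numeral mult.assoc mult.commute mult_2 norm_ge_zero zero_le_numeral)
    have "(\<integral>\<^sup>+x. norm (indicator T (z n + x) *\<^sub>R c - indicator T x *\<^sub>R c) \<partial>lborel)
      = (\<integral>\<^sup>+x. ennreal (norm c) * ((indicator T x - indicator T x * indicator T (z n + x))
          + (indicator T (z n + x) - indicator T x * indicator T (z n + x))) \<partial>lborel)"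
      by (intro nn_integral_cong) (auto simp: indicator_def)
    also have "\<dots> = ennreal (norm c) * (?I + ?I)"
      by (subst nn_integral_cmult, simp, subst nn_integral_add) (simp_all only: e1[symmetric] e5, simp_all)
    also have "\<dots> = ennreal (2 * norm c) * ?I"
      by (rule scale)
    finally show "(\<integral>\<^sup>+x. norm (indicator T (z n + x) *\<^sub>R c - indicator T x *\<^sub>R c) \<partial>lborel) \<le> ennreal (2 * norm c) * ?I"
      by simp
  qed
qed

text \<open>Induction over integrable functions. Only indicators need an argument: outer regularity
  encloses the set in open sets \<open>T k\<close> with excess below 1 / (k + 1), for which the
  previous lemma applies.\<close>

lemma translation_tendsto_L1:
  fixes u :: "'a::euclidean_space \<Rightarrow> 'b::{banach, second_countable_topology}"
  assumes "integrable lborel u" "z \<longlonglongrightarrow> 0"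
  shows "(\<lambda>n. \<integral>\<^sup>+x. norm (u (z n + x) - u x) \<partial>lborel) \<longlonglongrightarrow> 0"
  using assms(1)
proof (induction rule: integrable_induct)
  case (base A c)
  then have [measurable]: "A \<in> sets borel" by simp
  have "\<exists>T. open T \<and> A \<subseteq> T \<and> emeasure lebesgue (T - A) < ennreal (1 / real (Suc k))" for k
    using sets_lebesgue_outer_open[of A "1 / real (Suc k)"] base(1)
    by (metis of_nat_0_less_iff sets_completionI_sets zero_less_Suc zero_less_divide_1_iff)
  then obtain T where T: "\<And>k. open (T k)" "\<And>k. A \<subseteq> T k"
    "\<And>k. emeasure lebesgue (T k - A) < ennreal (1 / real (Suc k))" by metis
  have [measurable]: "T k \<in> sets borel" for k using T(1) by simp
  have T3: "emeasure lborel (T k - A) < ennreal (1 / real (Suc k))" for k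
    using T(3)[of k] by simp
  have T4: "emeasure lborel (T k) < \<infinity>" for k
  proof -
    have "emeasure lborel (T k) = emeasure lborel (A \<union> (T k - A))"
      using T(2)[of k] by (intro arg_cong2[where f=emeasure]) auto
    also have "\<dots> \<le> emeasure lborel A + emeasure lborel (T k - A)"
      by (rule emeasure_subadditive) auto
    also have "\<dots> < \<infinity>" using base(2) less_trans[OF T3[of k], of \<infinity>] by simp
    finally show ?thesis .
  qed
  show ?case
  proof (rule translation_tendsto_L1_approx[where v="\<lambda>k x. indicator (T k) x *\<^sub>R c"])
    show "(\<lambda>k. \<integral>\<^sup>+x. norm (indicator A x *\<^sub>R c - indicator (T k) x *\<^sub>R c) \<partial>lborel) \<longlonglongrightarrow> 0"
    proof (rule tendsto_0_ennreal_le)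
      have "(\<lambda>k. ennreal (1 / real (Suc k))) \<longlonglongrightarrow> ennreal 0"
        by (intro tendsto_ennrealI) (use LIMSEQ_inverse_real_of_nat in \<open>simp add: inverse_eq_divide\<close>)
      then show "(\<lambda>k. ennreal (norm c) * ennreal (1 / real (Suc k))) \<longlonglongrightarrow> 0"
        by (intro tendsto_0_ennreal_cmult) auto
      fix k
      have "(\<integral>\<^sup>+x. norm (indicator A x *\<^sub>R c - indicator (T k) x *\<^sub>R c) \<partial>lborel)
          = (\<integral>\<^sup>+x. ennreal (norm c) * indicator (T k - A) x \<partial>lborel)"
        using T(2)[of k] by (intro nn_integral_cong) (auto simp: indicator_def)
      also have "\<dots> = ennreal (norm c) * emeasure lborel (T k - A)"
        by (simp add: nn_integral_cmult)
      also have "\<dots> \<le> ennreal (norm c) * ennreal (1 / real (Suc k))"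
        using T3[of k] by (intro mult_left_mono) auto
      finally show "(\<integral>\<^sup>+x. norm (indicator A x *\<^sub>R c - indicator (T k) x *\<^sub>R c) \<partial>lborel) \<le> \<dots>" .
    qed
  qed (use T4 T(1) assms(2) in \<open>auto intro!: translation_tendsto_open\<close>)
next
  case (add f g)
  then have [measurable]: "f \<in> borel_measurable borel" "g \<in> borel_measurable borel" by auto
  show ?case
  proof (rule tendsto_0_ennreal_le)
    show "(\<lambda>n. (\<integral>\<^sup>+x. norm (f (z n + x) - f x) \<partial>lborel) + (\<integral>\<^sup>+x. norm (g (z n + x) - g x) \<partial>lborel)) \<longlonglongrightarrow> 0"
      using tendsto_add[OF add(3) add(4)] by simp
    fix n
    have "(\<integral>\<^sup>+x. norm (f (z n + x) + g (z n + x) - (f x + g x)) \<partial>lborel) \<le>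
      (\<integral>\<^sup>+x. ennreal (norm (f (z n + x) - f x)) + ennreal (norm (g (z n + x) - g x)) \<partial>lborel)"
    proof (intro nn_integral_mono)
      fix x
      have "f (z n + x) + g (z n + x) - (f x + g x) = (f (z n + x) - f x) + (g (z n + x) - g x)" by simp
      then show "ennreal (norm (f (z n + x) + g (z n + x) - (f x + g x))) \<le> ennreal (norm (f (z n + x) - f x)) + ennreal (norm (g (z n + x) - g x))"
        by (simp only:) (simp add: norm_triangle_ineq flip: ennreal_plus)
    qed
    then show "(\<integral>\<^sup>+x. norm (f (z n + x) + g (z n + x) - (f x + g x)) \<partial>lborel) \<le>
      (\<integral>\<^sup>+x. norm (f (z n + x) - f x) \<partial>lborel) + (\<integral>\<^sup>+x. norm (g (z n + x) - g x) \<partial>lborel)"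
      by (simp add: nn_integral_add)
  qed
next
  case (lim f s)
  then have [measurable]: "f \<in> borel_measurable borel" "\<And>i. s i \<in> borel_measurable borel" by auto
  show ?case
  proof (rule translation_tendsto_L1_approx[OF _ _ _ lim.IH])
    show "(\<lambda>k. \<integral>\<^sup>+x. norm (f x - s k x) \<partial>lborel) \<longlonglongrightarrow> 0"
      using lim
      by (intro nn_integral_dominated_convergence_norm[where w="\<lambda>x. 2 * norm (f x)"])
         (auto simp: integrable_iff_bounded nn_integral_cmult ennreal_mult ennreal_mult_less_top)
  qed auto
qed

section \<open>Plancherel's theorem\<close>

text \<open>The square of the L2 norm, kept in \<open>ennreal\<close> so that divergence stays
  visible. Being a square, it satisfies the triangle inequality with factors 2 only, which is the
  source of most numerical constants in this section and the next.\<close>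

definition l2n :: "('a::euclidean_space \<Rightarrow> complex) \<Rightarrow> ennreal" where
  "l2n u = (\<integral>\<^sup>+x. ennreal ((cmod (u x))\<^sup>2) \<partial>lborel)"

lemma cmod_add_square_le: "(cmod (a + b))\<^sup>2 \<le> 2 * (cmod a)\<^sup>2 + 2 * (cmod b)\<^sup>2"
proof -
  have "(cmod (a + b))\<^sup>2 \<le> (cmod a + cmod b)\<^sup>2"
    by (intro power_mono norm_triangle_ineq) auto
  also have "\<dots> \<le> 2 * (cmod a)\<^sup>2 + 2 * (cmod b)\<^sup>2"
    using zero_le_power2[of "cmod a - cmod b"] by (simp add: power2_eq_square algebra_simps)
  finally show ?thesis .
qed

lemma l2n_add:
  assumes [measurable]: "u \<in> borel_measurable borel" "v \<in> borel_measurable borel"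
  shows "l2n (\<lambda>x. u x + v x) \<le> 2 * l2n u + 2 * l2n v"
proof -
  have "l2n (\<lambda>x. u x + v x) \<le> (\<integral>\<^sup>+x. 2 * ennreal ((cmod (u x))\<^sup>2) + 2 * ennreal ((cmod (v x))\<^sup>2) \<partial>lborel)"
    unfolding l2n_def
  proof (intro nn_integral_mono)
    fix x
    show "ennreal ((cmod (u x + v x))\<^sup>2) \<le> 2 * ennreal ((cmod (u x))\<^sup>2) + 2 * ennreal ((cmod (v x))\<^sup>2)"
      using ennreal_leI[OF cmod_add_square_le[of "u x" "v x"]] by (simp add: ennreal_mult)
  qed
  then show ?thesis unfolding l2n_def by (simp add: nn_integral_add nn_integral_cmult)
qed

lemma l2n_minus_commute: "l2n (\<lambda>x. u x - v x) = l2n (\<lambda>x. v x - u x)"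
  by (simp add: l2n_def norm_minus_commute)

lemma l2n_diff_triangle:
  assumes [measurable]: "u \<in> borel_measurable borel" "v \<in> borel_measurable borel" "w \<in> borel_measurable borel"
  shows "l2n (\<lambda>x. u x - w x) \<le> 2 * l2n (\<lambda>x. u x - v x) + 2 * l2n (\<lambda>x. v x - w x)"
  using l2n_add[of "\<lambda>x. u x - v x" "\<lambda>x. v x - w x"] by simp

lemma l2n_shift:
  assumes [measurable]: "u \<in> borel_measurable borel"
  shows "l2n (\<lambda>x. u (z + x)) = l2n u"
  unfolding l2n_def by (rule nn_integral_lborel_shift[of "\<lambda>x. ennreal ((cmod (u x))\<^sup>2)"]) simp

lemma l2n_cong_AE: "AE x in lborel. u x = v x \<Longrightarrow> l2n u = l2n v"
  unfolding l2n_def by (rule nn_integral_cong_AE) auto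

lemma l2n_mono: "(\<And>x. cmod (u x) \<le> cmod (v x)) \<Longrightarrow> l2n u \<le> l2n v"
  unfolding l2n_def by (intro nn_integral_mono ennreal_leI power_mono) auto

lemma l2n_eq_0_iff:
  assumes [measurable]: "u \<in> borel_measurable borel"
  shows "l2n u = 0 \<longleftrightarrow> (AE x in lborel. u x = 0)"
  unfolding l2n_def by (subst nn_integral_0_iff_AE) auto

lemma l2n_dominated:
  assumes [measurable]: "u \<in> borel_measurable borel" "\<And>k::nat. v k \<in> borel_measurable borel"
    and "l2n w < \<infinity>" "w \<in> borel_measurable borel"
    and "\<And>k x. cmod (v k x - u x) \<le> cmod (w x)" "\<And>x. (\<lambda>k. v k x) \<longlonglongrightarrow> u x"
  shows "(\<lambda>k. l2n (\<lambda>x. v k x - u x)) \<longlonglongrightarrow> 0"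
proof -
  have "(\<lambda>k. \<integral>\<^sup>+x. ennreal ((cmod (v k x - u x))\<^sup>2) \<partial>lborel) \<longlonglongrightarrow> (\<integral>\<^sup>+(x::'a). 0 \<partial>lborel)"
  proof (rule nn_integral_dominated_convergence[where w="\<lambda>x. ennreal ((cmod (w x))\<^sup>2)"])
    show "AE x in lborel. (\<lambda>k. ennreal ((cmod (v k x - u x))\<^sup>2)) \<longlonglongrightarrow> 0"
    proof (intro AE_I2)
      fix x
      have "(\<lambda>k. ennreal ((cmod (v k x - u x))\<^sup>2)) \<longlonglongrightarrow> ennreal ((cmod (u x - u x))\<^sup>2)"
        by (intro tendsto_intros assms)
      then show "(\<lambda>k. ennreal ((cmod (v k x - u x))\<^sup>2)) \<longlonglongrightarrow> 0" by simp
    qed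
  qed (use assms in \<open>auto simp: l2n_def intro!: power_mono\<close>)
  then show ?thesis by (simp add: l2n_def)
qed

text \<open>Cutting off both in space and in size gives approximants that are integrable and bounded
  at once; the bound is what converts L1 estimates into L2 estimates.\<close>

lemma l2_truncation:
  fixes u :: "'a::euclidean_space \<Rightarrow> complex"
  assumes [measurable]: "u \<in> borel_measurable borel" and "l2n u < \<infinity>"
  obtains v :: "nat \<Rightarrow> 'a \<Rightarrow> complex" where "(\<lambda>k. l2n (\<lambda>x. v k x - u x)) \<longlonglongrightarrow> 0"
    "\<And>k. integrable lborel (v k)" "\<And>k x. cmod (v k x) \<le> k" "\<And>k. v k \<in> borel_measurable borel"
proof
  define v where "v = (\<lambda>(k::nat) x. indicator {x. norm x \<le> k \<and> cmod (u x) \<le> k} x * u x)"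
  show [measurable]: "v k \<in> borel_measurable borel" for k
    unfolding v_def by measurable
  show b: "cmod (v k x) \<le> k" for k x
    unfolding v_def by (auto simp: indicator_def)
  show "integrable lborel (v k)" for k
  proof (rule Bochner_Integration.integrable_bound)
    show "integrable lborel (\<lambda>x::'a. indicator (cball 0 (real k)) x * real k)"
      by (intro integrable_mult_left integrable_real_indicator emeasure_lborel_cball_finite) auto
    show "AE x in lborel. norm (v k x) \<le> norm (indicator (cball 0 (real k)) x * real k)"
      using b by (auto simp: v_def indicator_def)
  qed simp
  show "(\<lambda>k. l2n (\<lambda>x. v k x - u x)) \<longlonglongrightarrow> 0"
  proof (rule l2n_dominated[OF _ _ assms(2)])
    fix x
    have "\<forall>\<^sub>F k in sequentially. v k x = u x"
      using eventually_ge_at_top[of "nat \<lceil>norm x\<rceil>"] eventually_ge_at_top[of "nat \<lceil>cmod (u x)\<rceil>"]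
      by eventually_elim (auto simp: v_def indicator_def; linarith)
    then show "(\<lambda>k. v k x) \<longlonglongrightarrow> u x" by (rule tendsto_eventually)
  qed (auto simp: v_def indicator_def)
qed

text \<open>For a function bounded by k the translation increment d satisfies |d|^2 \<le> 2 k |d|,
  so the L1 statement carries over to the truncations. The factors 6 and 4 come from using the
  factor-2 triangle inequality twice.\<close>

lemma translation_tendsto_L2:
  fixes u :: "'a::euclidean_space \<Rightarrow> complex"
  assumes [measurable]: "u \<in> borel_measurable borel" and "l2n u < \<infinity>" and z: "z \<longlonglongrightarrow> 0"
  shows "(\<lambda>n. l2n (\<lambda>x. u (z n + x) - u x)) \<longlonglongrightarrow> 0"
proof -
  obtain v :: "nat \<Rightarrow> 'a \<Rightarrow> complex" where v: "(\<lambda>k. l2n (\<lambda>x. v k x - u x)) \<longlonglongrightarrow> 0"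
    "\<And>k. integrable lborel (v k)" "\<And>k x. cmod (v k x) \<le> k" "\<And>k. v k \<in> borel_measurable borel"
    using l2_truncation[OF assms(1,2)] by blast
  note [measurable] = v(4)
  show ?thesis
  proof (rule tendsto_0_ennreal_approx)
    show "(\<lambda>k. 6 * l2n (\<lambda>x. v k x - u x)) \<longlonglongrightarrow> 0"
      by (rule tendsto_0_ennreal_cmult[OF v(1)]) simp
    show "(\<lambda>n. 4 * l2n (\<lambda>x. v k (z n + x) - v k x)) \<longlonglongrightarrow> 0" for k
    proof (rule tendsto_0_ennreal_cmult[OF tendsto_0_ennreal_le])
      show "(\<lambda>n. ennreal (2 * k) * (\<integral>\<^sup>+x. norm (v k (z n + x) - v k x) \<partial>lborel)) \<longlonglongrightarrow> 0"
        by (rule tendsto_0_ennreal_cmult[OF translation_tendsto_L1[OF v(2) z]]) simp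
      fix n
      have "l2n (\<lambda>x. v k (z n + x) - v k x) \<le> (\<integral>\<^sup>+x. ennreal (2 * k) * norm (v k (z n + x) - v k x) \<partial>lborel)"
        unfolding l2n_def
      proof (intro nn_integral_mono)
        fix x
        have "cmod (v k (z n + x) - v k x) \<le> 2 * k"
          using norm_triangle_ineq4[of "v k (z n + x)" "v k x"] v(3)[of k "z n + x"] v(3)[of k x] by simp
        then have "(cmod (v k (z n + x) - v k x))\<^sup>2 \<le> (2 * k) * cmod (v k (z n + x) - v k x)"
          unfolding power2_eq_square by (intro mult_right_mono) auto
        then show "ennreal ((cmod (v k (z n + x) - v k x))\<^sup>2) \<le> ennreal (2 * k) * ennreal (norm (v k (z n + x) - v k x))"
          by (simp flip: ennreal_mult)
      qed
      then show "l2n (\<lambda>x. v k (z n + x) - v k x) \<le> ennreal (2 * k) * (\<integral>\<^sup>+x. norm (v k (z n + x) - v k x) \<partial>lborel)"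
        by (simp add: nn_integral_cmult)
    qed simp
    fix n k
    have "l2n (\<lambda>x. u (z n + x) - u x) \<le> 2 * l2n (\<lambda>x. u (z n + x) - v k (z n + x)) + 2 * l2n (\<lambda>x. v k (z n + x) - u x)"
      by (rule l2n_diff_triangle) auto
    also have "l2n (\<lambda>x. u (z n + x) - v k (z n + x)) = l2n (\<lambda>x. u x - v k x)"
      using l2n_shift[of "\<lambda>x. u x - v k x" "z n"] by simp
    also have "\<dots> = l2n (\<lambda>x. v k x - u x)" by (rule l2n_minus_commute)
    also have "l2n (\<lambda>x. v k (z n + x) - u x) \<le> 2 * l2n (\<lambda>x. v k (z n + x) - v k x) + 2 * l2n (\<lambda>x. v k x - u x)"
      by (rule l2n_diff_triangle) auto
    finally have le: "l2n (\<lambda>x. u (z n + x) - u x) \<le> 2 * l2n (\<lambda>x. v k x - u x)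
        + 2 * (2 * l2n (\<lambda>x. v k (z n + x) - v k x) + 2 * l2n (\<lambda>x. v k x - u x))"
      by (simp add: add_left_mono mult_left_mono)
    have sum: "2 * D + 2 * (2 * F + 2 * D) = 6 * D + 4 * F" for D F :: ennreal
    proof -
      have "2 * D + 4 * D = 6 * D" by (simp flip: distrib_right)
      then show ?thesis by (simp add: distrib_left mult.assoc[symmetric] add.left_commute add.commute)
    qed
    show "l2n (\<lambda>x. u (z n + x) - u x) \<le> 6 * l2n (\<lambda>x. v k x - u x) + 4 * l2n (\<lambda>x. v k (z n + x) - v k x)"
      using le unfolding sum .
  qed
qed

text \<open>Lebesgue measure on a Euclidean space is the image of a product of real Lebesgue
  measures over \<open>Basis\<close>, so integrals of coordinatewise products factor.\<close>

lemma integral_lborel_prod: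
  fixes f :: "'a::euclidean_space \<Rightarrow> real \<Rightarrow> complex"
  assumes "\<And>b. b \<in> Basis \<Longrightarrow> integrable lborel (f b)"
  shows "(LINT x|lborel. (\<Prod>b\<in>Basis. f b (x \<bullet> b))) = (\<Prod>b\<in>Basis. (LINT x|lborel. f b x))"
    "integrable lborel (\<lambda>x. \<Prod>b\<in>Basis. f b (x \<bullet> b))"
proof -
  interpret product_sigma_finite "\<lambda>_::'a. lborel :: real measure" ..
  have [measurable]: "\<And>b. b \<in> Basis \<Longrightarrow> f b \<in> borel_measurable borel"
    using assms by (auto dest: borel_measurable_integrable)
  have eq: "(\<Prod>b\<in>Basis. f b ((\<Sum>b\<in>Basis. y b *\<^sub>R b) \<bullet> b)) = (\<Prod>b\<in>Basis. f b (y b))" for y :: "'a \<Rightarrow> real"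
    by (intro prod.cong) auto
  show "(LINT x|lborel. (\<Prod>b\<in>Basis. f b (x \<bullet> b))) = (\<Prod>b\<in>Basis. (LINT x|lborel. f b x))"
    by (subst lborel_def) (simp add: integral_distr eq product_integral_prod assms flip: lborel_eq_real)
  show "integrable lborel (\<lambda>x. \<Prod>b\<in>Basis. f b (x \<bullet> b))"
    by (subst lborel_def) (simp add: integrable_distr_eq eq product_integrable_prod assms flip: lborel_eq_real)
qed

section \<open>The Gaussian and its Fourier transform\<close>

definition gauss :: "'a::euclidean_space \<Rightarrow> real" where
  "gauss x = exp (- (norm x)\<^sup>2 / 2)"

lemma gauss_measurable [measurable]: "gauss \<in> borel_measurable borel"
  unfolding gauss_def by measurable

lemma gauss_pos: "0 < gauss x" and gauss_le_1: "gauss x \<le> 1" and gauss_0: "gauss 0 = 1"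
  by (auto simp: gauss_def)

lemma fourier_gauss_real:
  fixes t :: real
  shows "integrable lborel (\<lambda>x. complex_of_real (exp (- x\<^sup>2 / 2)) * exp (- (\<i> * complex_of_real (t * x))))"
    "(LINT x|lborel. complex_of_real (exp (- x\<^sup>2 / 2)) * exp (- (\<i> * complex_of_real (t * x))))
      = complex_of_real (sqrt (2 * pi) * exp (- t\<^sup>2 / 2))"
proof -
  have int: "integrable lborel std_normal_density"
    using integrable_normal_moment[of 1 0 0] by simp
  have eq: "complex_of_real (exp (- x\<^sup>2 / 2)) * exp (- (\<i> * complex_of_real (t * x)))
      = complex_of_real (sqrt (2 * pi)) * (std_normal_density x *\<^sub>R iexp ((- t) * x))" for x
    by (simp add: std_normal_density_def scaleR_conv_of_real)
  have "integrable lborel (\<lambda>x. std_normal_density x *\<^sub>R iexp ((- t) * x))"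
    by (rule Bochner_Integration.integrable_bound[OF int]) auto
  then show "integrable lborel (\<lambda>x. complex_of_real (exp (- x\<^sup>2 / 2)) * exp (- (\<i> * complex_of_real (t * x))))"
    unfolding eq by (rule integrable_mult_right)
  have "(LINT x|lborel. std_normal_density x *\<^sub>R iexp ((- t) * x)) = char std_normal_distribution (- t)"
    unfolding char_def by (subst integral_density) (auto simp: normal_density_nonneg)
  then show "(LINT x|lborel. complex_of_real (exp (- x\<^sup>2 / 2)) * exp (- (\<i> * complex_of_real (t * x))))
      = complex_of_real (sqrt (2 * pi) * exp (- t\<^sup>2 / 2))"
    unfolding eq integral_mult_right_zero by (simp only: char_std_normal_distribution of_real_mult power2_minus)
qed

text \<open>The Gaussian factors over the coordinates, and each factor is the characteristic
  function of the standard normal distribution up to its normalisation sqrt (2 pi).\<close>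

lemma fourier_gauss:
  fixes t :: "'a::euclidean_space"
  shows "integrable lborel (\<lambda>x. complex_of_real (gauss x) * exp (- (\<i> * complex_of_real (t \<bullet> x))))"
    "(LINT x|lborel. complex_of_real (gauss x) * exp (- (\<i> * complex_of_real (t \<bullet> x))))
      = complex_of_real (sqrt (2 * pi) ^ DIM('a) * gauss t)"
proof -
  have sq: "gauss y = (\<Prod>b\<in>Basis. exp (- (y \<bullet> b)\<^sup>2 / 2))" for y :: 'a
    unfolding gauss_def by (subst norm_eq_sqrt_inner, subst euclidean_inner)
      (simp add: sum_nonneg exp_sum[symmetric] sum_divide_distrib sum_negf power2_eq_square)
  have eq: "complex_of_real (gauss x) * exp (- (\<i> * complex_of_real (t \<bullet> x)))
     = (\<Prod>b\<in>Basis. (\<lambda>b x. complex_of_real (exp (- x\<^sup>2 / 2)) * exp (- (\<i> * complex_of_real ((t \<bullet> b) * x)))) b (x \<bullet> b))" for x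
    by (simp only: sq prod.distrib of_real_prod, subst euclidean_inner[of t x])
       (simp add: exp_sum[symmetric] sum_distrib_left sum_negf)
  show "integrable lborel (\<lambda>x. complex_of_real (gauss x) * exp (- (\<i> * complex_of_real (t \<bullet> x))))"
    unfolding eq by (rule integral_lborel_prod(2)) (rule fourier_gauss_real(1))
  show "(LINT x|lborel. complex_of_real (gauss x) * exp (- (\<i> * complex_of_real (t \<bullet> x))))
      = complex_of_real (sqrt (2 * pi) ^ DIM('a) * gauss t)"
    unfolding eq
    by (subst integral_lborel_prod(1)) (simp_all add: fourier_gauss_real[simplified] sq prod.distrib)
qed

lemma integrable_gauss: "integrable lborel (gauss :: 'a::euclidean_space \<Rightarrow> real)"
  and integral_gauss: "(LINT x|lborel. gauss (x::'a)) = sqrt (2 * pi) ^ DIM('a)"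
proof -
  have 1: "integrable lborel (\<lambda>x::'a. complex_of_real (gauss x))"
    "(LINT x|lborel. complex_of_real (gauss (x::'a))) = complex_of_real (sqrt (2 * pi) ^ DIM('a))"
    using fourier_gauss[of "0::'a"] by (simp_all add: gauss_0)
  show "integrable lborel (gauss :: 'a \<Rightarrow> real)" using integrable_Re[OF 1(1)] by simp
  show "(LINT x|lborel. gauss (x::'a)) = sqrt (2 * pi) ^ DIM('a)"
    using 1(2) unfolding integral_complex_of_real of_real_eq_iff .
qed

lemma integral_lborel_scale:
  fixes f :: "'a::euclidean_space \<Rightarrow> 'b::{banach, second_countable_topology}"
  assumes [measurable]: "f \<in> borel_measurable borel" and "c \<noteq> 0"
  shows "(LINT x|lborel. f x) = \<bar>c\<bar> ^ DIM('a) *\<^sub>R (LINT x|lborel. f (c *\<^sub>R x))"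
proof -
  have "(LINT x|lborel. f x) = (LINT x|density (distr lborel borel (\<lambda>x. 0 + c *\<^sub>R x)) (\<lambda>_. \<bar>c\<bar> ^ DIM('a)). f x)"
    using lborel_affine[OF assms(2), of "0::'a"] by simp
  then show ?thesis by (simp add: integral_density integral_distr)
qed

lemma tendsto_0_ennreal_square:
  fixes a :: "'i \<Rightarrow> ennreal"
  assumes "((\<lambda>n. (a n)\<^sup>2) \<longlongrightarrow> 0) F"
  shows "(a \<longlongrightarrow> 0) F"
proof (rule order_tendstoI)
  fix e :: ennreal assume "0 < e"
  then have "0 < e\<^sup>2" by (simp add: zero_less_iff_neq_zero)
  from order_tendstoD(2)[OF assms this] show "\<forall>\<^sub>F n in F. a n < e"
    by eventually_elim (meson linorder_not_le power_mono zero_le)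
qed simp

section \<open>Fourier integrals and Plancherel's identity\<close>

lemma cexp_measurable [measurable]: "(exp :: complex \<Rightarrow> complex) \<in> borel_measurable borel"
  by (intro borel_measurable_continuous_onI continuous_intros)

lemma fourier_measurable [measurable]:
  assumes [measurable]: "u \<in> borel_measurable borel"
  shows "fourier u \<in> borel_measurable borel"
  unfolding fourier_def by measurable

lemma fourier_integrand_integrable:
  fixes u :: "real^2 \<Rightarrow> complex"
  assumes "integrable lborel u"
  shows "integrable lborel (\<lambda>x. u x * exp (- (\<i> * complex_of_real (x \<bullet> \<xi>))))"
proof -
  have [measurable]: "u \<in> borel_measurable borel" using assms by auto
  show ?thesis
    by (rule Bochner_Integration.integrable_bound[OF assms]) (auto simp: norm_mult)
qed

lemma fourier_bound:
  assumes "integrable lborel u"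
  shows "cmod (fourier u \<xi>) \<le> (LINT x|lborel. cmod (u x))"
  unfolding fourier_def
  by (rule order_trans[OF integral_norm_bound]) (simp add: norm_mult)

lemma integrable_lborel_scale:
  fixes f :: "'a::euclidean_space \<Rightarrow> 'b::{banach, second_countable_topology}"
  assumes "integrable lborel f" and "c \<noteq> 0"
  shows "integrable lborel (\<lambda>x. f (c *\<^sub>R x))"
proof -
  have [measurable]: "f \<in> borel_measurable borel" using assms by auto
  have "integrable (density (distr lborel borel (\<lambda>x. 0 + c *\<^sub>R x)) (\<lambda>_. \<bar>c\<bar> ^ DIM('a))) f"
    using assms(1) lborel_affine[OF assms(2), of "0::'a"] by simp
  then have "integrable lborel (\<lambda>x. \<bar>c\<bar> ^ DIM('a) *\<^sub>R f (c *\<^sub>R x))"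
    by (simp add: integrable_density integrable_distr_eq)
  then have "integrable lborel (\<lambda>x. inverse (\<bar>c\<bar> ^ DIM('a)) *\<^sub>R (\<bar>c\<bar> ^ DIM('a) *\<^sub>R f (c *\<^sub>R x)))"
    by (rule integrable_scaleR_right)
  then show ?thesis using assms(2) by simp
qed

lemma cnj_measurable [measurable]: "cnj \<in> borel_measurable borel"
  by (intro borel_measurable_continuous_onI continuous_intros)

text \<open>Integrating the squared transform against a wide Gaussian gives the autocorrelation of
  \<open>u\<close> integrated against a narrow one.\<close>
lemma gauss_weighted_plancherel:
  fixes u :: "real^2 \<Rightarrow> complex"
  assumes int: "integrable lborel u" and "0 < \<delta>"
  shows "complex_of_real (LINT \<xi>|lborel. gauss (\<delta> *\<^sub>R \<xi>) * (cmod (fourier u \<xi>))\<^sup>2)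
    = 2 * pi * (LINT z|lborel. complex_of_real (gauss z) * (LINT x|lborel. u x * cnj (u (\<delta> *\<^sub>R z + x))))"
proof -
  have [measurable]: "u \<in> borel_measurable borel" using int by auto
  define A where "A w = (LINT x|lborel. u x * cnj (u (w + x)))" for w
  define K where "K = (LINT x|lborel. cmod (u x))"
  \<comment> \<open>Joint integrability of the correlation kernel gives both the integrability of
    \<open>A\<close> and the exchange of integrals in \<open>sq\<close>.\<close>
  have h: "integrable (lborel \<Otimes>\<^sub>M lborel) (\<lambda>(x, z). u x * cnj (u (z + x)))"
  proof (rule lborel_pair.Fubini_integrable)
    have "(LINT y|lborel. norm (case (x, y) of (x, z) \<Rightarrow> u x * cnj (u (z + x)))) = cmod (u x) * K" for x
      using integral_lborel_shift[of "\<lambda>y. cmod (u y)" x] by (simp add: norm_mult K_def add.commute)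
    then show "integrable lborel (\<lambda>x. LINT y|lborel. norm (case (x, y) of (x, z) \<Rightarrow> u x * cnj (u (z + x))))"
      using int by simp
    show "AE x in lborel. integrable lborel (\<lambda>y. case (x, y) of (x, z) \<Rightarrow> u x * cnj (u (z + x)))"
      using integrable_lborel_shift[OF int] by (auto simp: add.commute)
  qed measurable
  have A: "integrable lborel A"
    using lborel_pair.integrable_snd[of "\<lambda>x z. u x * cnj (u (z + x))", OF h] unfolding A_def by simp
  have [measurable]: "A \<in> borel_measurable borel" using A by auto
  \<comment> \<open>The squared modulus is the transform of the autocorrelation, with a plus sign in
    the exponent: writing the second variable as z + x makes the two phases combine into one that
    depends on z alone.\<close>
  have sq: "fourier u \<xi> * cnj (fourier u \<xi>) = (LINT z|lborel. exp (\<i> * complex_of_real (z \<bullet> \<xi>)) * A z)" for \<xi>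
  proof -
    let ?e = "\<lambda>x. exp (\<i> * complex_of_real (x \<bullet> \<xi>))"
    have cnj: "cnj (fourier u \<xi>) = (LINT z|lborel. cnj (u (z + x)) * ?e (z + x))" for x
    proof -
      have "cnj (fourier u \<xi>) = (LINT y|lborel. cnj (u y) * ?e y)"
        unfolding fourier_def Bochner_Integration.integral_cnj[symmetric] by (simp add: exp_cnj)
      then show ?thesis
        using integral_lborel_shift[of "\<lambda>y. cnj (u y) * ?e y" x] by (simp add: add.commute)
    qed
    have e: "exp (- (\<i> * complex_of_real (x \<bullet> \<xi>))) * ?e (z + x) = ?e z" for x z
      by (simp add: inner_add_left distrib_left flip: exp_add)
    have "fourier u \<xi> * cnj (fourier u \<xi>)
       = (LINT x|lborel. u x * exp (- (\<i> * complex_of_real (x \<bullet> \<xi>))) * cnj (fourier u \<xi>))"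
      by (simp add: fourier_def)
    also have "\<dots> = (LINT x|lborel. LINT z|lborel. ?e z * (u x * cnj (u (z + x))))"
    proof (intro Bochner_Integration.integral_cong refl)
      fix x
      have "u x * exp (- (\<i> * complex_of_real (x \<bullet> \<xi>))) * cnj (fourier u \<xi>)
        = (LINT z|lborel. u x * exp (- (\<i> * complex_of_real (x \<bullet> \<xi>))) * (cnj (u (z + x)) * ?e (z + x)))"
        by (subst cnj[of x]) simp
      also have "\<dots> = (LINT z|lborel. ?e z * (u x * cnj (u (z + x))))"
        by (intro Bochner_Integration.integral_cong refl, subst e[symmetric]) (simp only: ac_simps)
      finally show "u x * exp (- (\<i> * complex_of_real (x \<bullet> \<xi>))) * cnj (fourier u \<xi>) = \<dots>" .
    qed
    also have "\<dots> = (LINT z|lborel. LINT x|lborel. ?e z * (u x * cnj (u (z + x))))"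
    proof (rule lborel_pair.Fubini_integral[symmetric])
      show "integrable (lborel \<Otimes>\<^sub>M lborel) (\<lambda>(x, z). ?e z * (u x * cnj (u (z + x))))"
        by (rule Bochner_Integration.integrable_bound[OF h]) (auto simp: norm_mult)
    qed
    finally show ?thesis by (simp add: A_def)
  qed
  have g: "integrable lborel (\<lambda>\<xi>::real^2. gauss (\<delta> *\<^sub>R \<xi>))"
    by (rule integrable_lborel_scale[OF integrable_gauss]) (use assms(2) in auto)
  \<comment> \<open>The Gaussian reproduces itself under the transform. In dimension 2 the constant
    is sqrt (2 pi)^2, and the rescaling contributes the divisor
    \<open>\<delta>\<^sup>2\<close>.\<close>
  have inner: "(LINT \<xi>|lborel. complex_of_real (gauss (\<delta> *\<^sub>R \<xi>)) * exp (\<i> * complex_of_real (z \<bullet> \<xi>)))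
     = complex_of_real (2 * pi / \<delta>\<^sup>2 * gauss ((1 / \<delta>) *\<^sub>R z))" for z :: "real^2"
  proof -
    have e: "exp (- (\<i> * complex_of_real ((- (1 / \<delta>) *\<^sub>R z) \<bullet> (\<delta> *\<^sub>R \<xi>)))) = exp (\<i> * complex_of_real (z \<bullet> \<xi>))" for \<xi>
      using assms(2) by auto
    have "(LINT \<xi>|lborel. complex_of_real (gauss \<xi>) * exp (- (\<i> * complex_of_real ((- (1 / \<delta>) *\<^sub>R z) \<bullet> \<xi>))))
      = \<bar>\<delta>\<bar> ^ 2 *\<^sub>R (LINT \<xi>|lborel. complex_of_real (gauss (\<delta> *\<^sub>R \<xi>)) * exp (- (\<i> * complex_of_real ((- (1 / \<delta>) *\<^sub>R z) \<bullet> (\<delta> *\<^sub>R \<xi>)))))"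
      using assms(2) by (subst integral_lborel_scale[of _ \<delta>]) auto
    also have "(LINT \<xi>|lborel. complex_of_real (gauss \<xi>) * exp (- (\<i> * complex_of_real ((- (1 / \<delta>) *\<^sub>R z) \<bullet> \<xi>))))
       = complex_of_real (2 * pi * gauss ((1 / \<delta>) *\<^sub>R z))"
      by (subst fourier_gauss(2)) (simp add: gauss_def)
    finally have "complex_of_real (2 * pi * gauss ((1 / \<delta>) *\<^sub>R z))
      = complex_of_real (\<delta>\<^sup>2) * (LINT \<xi>|lborel. complex_of_real (gauss (\<delta> *\<^sub>R \<xi>)) * exp (\<i> * complex_of_real (z \<bullet> \<xi>)))"
      using assms(2) unfolding e by (simp only: scaleR_conv_of_real[where 'a=complex] abs_of_pos of_real_power)
    then show ?thesis using assms(2) by (simp add: divide_simps mult.commute)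
  qed
  have "complex_of_real (LINT \<xi>|lborel. gauss (\<delta> *\<^sub>R \<xi>) * (cmod (fourier u \<xi>))\<^sup>2)
      = (LINT \<xi>|lborel. LINT z|lborel. complex_of_real (gauss (\<delta> *\<^sub>R \<xi>)) * (exp (\<i> * complex_of_real (z \<bullet> \<xi>)) * A z))"
    unfolding integral_complex_of_real[symmetric] integral_mult_right_zero sq[symmetric]
    by (simp only: of_real_mult complex_norm_square)
  also have "\<dots> = (LINT z|lborel. LINT \<xi>|lborel. complex_of_real (gauss (\<delta> *\<^sub>R \<xi>)) * (exp (\<i> * complex_of_real (z \<bullet> \<xi>)) * A z))"
  proof (rule lborel_pair.Fubini_integral[symmetric], rule lborel_pair.Fubini_integrable)
    show "integrable lborel (\<lambda>\<xi>. LINT z|lborel. norm (case (\<xi>, z) of (\<xi>, z) \<Rightarrow> complex_of_real (gauss (\<delta> *\<^sub>R \<xi>)) * (exp (\<i> * complex_of_real (z \<bullet> \<xi>)) * A z)))"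
      using g by (simp add: norm_mult)
    show "AE \<xi> in lborel. integrable lborel (\<lambda>z. case (\<xi>, z) of (\<xi>, z) \<Rightarrow> complex_of_real (gauss (\<delta> *\<^sub>R \<xi>)) * (exp (\<i> * complex_of_real (z \<bullet> \<xi>)) * A z))"
    proof (intro AE_I2)
      fix \<xi>
      have "integrable lborel (\<lambda>z. exp (\<i> * complex_of_real (z \<bullet> \<xi>)) * A z)"
        by (rule Bochner_Integration.integrable_bound[OF A]) (auto simp: norm_mult)
      then show "integrable lborel (\<lambda>z. case (\<xi>, z) of (\<xi>, z) \<Rightarrow> complex_of_real (gauss (\<delta> *\<^sub>R \<xi>)) * (exp (\<i> * complex_of_real (z \<bullet> \<xi>)) * A z))"
        by simp
    qed
  qed measurable
  also have "\<dots> = (LINT z|lborel. complex_of_real (2 * pi / \<delta>\<^sup>2 * gauss ((1 / \<delta>) *\<^sub>R z)) * A z)"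
    by (simp add: mult.assoc[symmetric] inner)
  also have "\<dots> = \<bar>\<delta>\<bar>\<^sup>2 *\<^sub>R (LINT z|lborel. complex_of_real (2 * pi / \<delta>\<^sup>2 * gauss ((1 / \<delta>) *\<^sub>R (\<delta> *\<^sub>R z))) * A (\<delta> *\<^sub>R z))"
    using assms(2) by (subst integral_lborel_scale[of _ \<delta>]) auto
  also have "\<dots> = 2 * pi * (LINT z|lborel. complex_of_real (gauss z) * A (\<delta> *\<^sub>R z))"
  proof -
    have "(1 / \<delta>) *\<^sub>R (\<delta> *\<^sub>R z) = z" for z :: "real^2" using assms(2) by simp
    then have "(LINT z|lborel. complex_of_real (2 * pi / \<delta>\<^sup>2 * gauss ((1 / \<delta>) *\<^sub>R (\<delta> *\<^sub>R z))) * A (\<delta> *\<^sub>R z))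
      = complex_of_real (2 * pi / \<delta>\<^sup>2) * (LINT z|lborel. complex_of_real (gauss z) * A (\<delta> *\<^sub>R z))"
      by (simp only: of_real_mult mult.assoc integral_mult_right_zero)
    then show ?thesis
      using assms(2) by (simp add: scaleR_conv_of_real[where 'a=complex])
  qed
  finally show ?thesis unfolding A_def .
qed

text \<open>Let \<open>\<delta>\<close> tend to 0 in \<open>gauss_weighted_plancherel\<close>. The
  left side increases to \<open>l2n (fourier u)\<close>; on the right the autocorrelation tends to
  its value at 0, the squared norm of \<open>u\<close>. The constant is the 2 pi of that identity
  times 2 pi, the integral of \<open>gauss\<close> over the plane.\<close>

lemma plancherel:
  fixes u :: "real^2 \<Rightarrow> complex"
  assumes int: "integrable lborel u" and fin: "l2n u < \<infinity>"
  shows "l2n (fourier u) = ennreal (4 * pi\<^sup>2) * l2n u"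
proof -
  have [measurable]: "u \<in> borel_measurable borel" using int by auto
  define A where "A w = (LINT x|lborel. u x * cnj (u (w + x)))" for w
  have [measurable]: "A \<in> borel_measurable borel" unfolding A_def by measurable
  have sqi: "integrable lborel (\<lambda>x. (cmod (u x))\<^sup>2)"
    using fin unfolding l2n_def by (subst integrable_iff_bounded) auto
  define N where "N = (LINT x|lborel. (cmod (u x))\<^sup>2)"
  have N: "l2n u = ennreal N" "0 \<le> N"
    unfolding l2n_def N_def using sqi by (auto simp: nn_integral_eq_integral)
  have sqs: "integrable lborel (\<lambda>x. (cmod (u (w + x)))\<^sup>2)" for w
    by (rule integrable_lborel_shift[OF sqi])
  have prod: "cmod (u x) * cmod (u (w + x)) \<le> ((cmod (u x))\<^sup>2 + (cmod (u (w + x)))\<^sup>2) / 2" for x w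
    using sum_squares_bound[of "cmod (u x)" "cmod (u (w + x))"] by simp
  have iA: "integrable lborel (\<lambda>x. u x * cnj (u (w + x)))" for w
    by (rule Bochner_Integration.integrable_bound[of _ "\<lambda>x. ((cmod (u x))\<^sup>2 + (cmod (u (w + x)))\<^sup>2) / 2"])
       (use sqi sqs[of w] prod in \<open>auto simp: norm_mult\<close>)
  have bA: "cmod (A w) \<le> N" for w
  proof -
    have "cmod (A w) \<le> (LINT x|lborel. ((cmod (u x))\<^sup>2 + (cmod (u (w + x)))\<^sup>2) / 2)"
      unfolding A_def
      by (rule order_trans[OF integral_norm_bound], rule integral_mono)
         (use integrable_norm[OF iA[of w]] sqi sqs[of w] prod in \<open>auto simp: norm_mult\<close>)
    also have "\<dots> = N"
      using integral_lborel_shift[of "\<lambda>x. (cmod (u x))\<^sup>2" w] sqi sqs[of w] by (simp add: N_def)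
    finally show ?thesis .
  qed
  \<comment> \<open>The increment of the autocorrelation is at most the norm of \<open>u\<close>
    times the norm of its translation increment, by Cauchy-Schwarz. The inequality is kept squared
    because \<open>l2n\<close> is a squared norm.\<close>
  have limA: "(\<lambda>n. A (w n)) \<longlonglongrightarrow> A 0" if w: "w \<longlonglongrightarrow> 0" for w
  proof -
    have "(\<lambda>n. (\<integral>\<^sup>+x. ennreal (cmod (u x)) * ennreal (cmod (u (w n + x) - u x)) \<partial>lborel)\<^sup>2) \<longlonglongrightarrow> 0"
    proof (rule tendsto_0_ennreal_le)
      show "(\<lambda>n. l2n u * l2n (\<lambda>x. u (w n + x) - u x)) \<longlonglongrightarrow> 0"
        by (rule tendsto_0_ennreal_cmult[OF translation_tendsto_L2[OF _ fin w] fin]) simp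
      fix n
      show "(\<integral>\<^sup>+x. ennreal (cmod (u x)) * ennreal (cmod (u (w n + x) - u x)) \<partial>lborel)\<^sup>2
          \<le> l2n u * l2n (\<lambda>x. u (w n + x) - u x)"
        unfolding l2n_def ennreal_power[OF norm_ge_zero, symmetric]
        by (rule Cauchy_Schwarz_nn_integral) auto
    qed
    from tendsto_0_ennreal_square[OF this]
    have "(\<lambda>n. ennreal (cmod (A (w n) - A 0))) \<longlonglongrightarrow> 0"
    proof (rule tendsto_0_ennreal_le)
      fix n
      have "A (w n) - A 0 = (LINT x|lborel. u x * cnj (u (w n + x)) - u x * cnj (u (0 + x)))"
        unfolding A_def by (rule Bochner_Integration.integral_diff[symmetric]) (rule iA)+
      also have "\<dots> = (LINT x|lborel. u x * cnj (u (w n + x) - u x))"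
        by (simp add: algebra_simps)
      finally have "ennreal (cmod (A (w n) - A 0)) = ennreal (cmod (LINT x|lborel. u x * cnj (u (w n + x) - u x)))"
        by simp
      also have "\<dots> \<le> (\<integral>\<^sup>+x. norm (u x * cnj (u (w n + x) - u x)) \<partial>lborel)"
        by (rule integral_norm_bound_ennreal)
           (use Bochner_Integration.integrable_diff[OF iA[of "w n"] iA[of 0]] in \<open>simp add: algebra_simps\<close>)
      finally show "ennreal (cmod (A (w n) - A 0)) \<le> (\<integral>\<^sup>+x. ennreal (cmod (u x)) * ennreal (cmod (u (w n + x) - u x)) \<partial>lborel)"
        by (simp only: norm_mult complex_mod_cnj ennreal_mult[OF norm_ge_zero norm_ge_zero])
    qed
    then have "(\<lambda>n. cmod (A (w n) - A 0)) \<longlonglongrightarrow> 0"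
      by (subst (asm) ennreal_0[symmetric], subst (asm) ennreal_tendsto_0_iff) auto
    then show ?thesis by (simp add: LIM_zero_iff tendsto_norm_zero_iff)
  qed
  have A0: "A 0 = complex_of_real N"
    unfolding A_def N_def integral_complex_of_real[symmetric] by (simp add: complex_norm_square[symmetric])
  define \<delta> where "\<delta> = (\<lambda>n. 1 / real (Suc n))"
  have \<delta>1: "0 < \<delta> n" for n by (simp add: \<delta>_def)
  have "\<delta> \<longlonglongrightarrow> 0"
    unfolding \<delta>_def by (rule LIMSEQ_Suc[OF lim_1_over_n])
  note \<delta> = \<delta>1 this
  define I where "I n = (LINT \<xi>|lborel. gauss (\<delta> n *\<^sub>R \<xi>) * (cmod (fourier u \<xi>))\<^sup>2)" for n
  have "(\<lambda>n. LINT z|lborel. complex_of_real (gauss z) * A (\<delta> n *\<^sub>R z)) \<longlonglongrightarrow> (LINT z|lborel. complex_of_real (gauss (z::real^2)) * A 0)"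
  proof (rule integral_dominated_convergence[where w="\<lambda>z. gauss z * N"])
    show "AE x in lborel. (\<lambda>i. complex_of_real (gauss x) * A (\<delta> i *\<^sub>R x)) \<longlonglongrightarrow> complex_of_real (gauss x) * A 0"
      by (intro AE_I2 tendsto_mult tendsto_const limA)
        (use tendsto_scaleR[OF \<delta>(2) tendsto_const] in auto)
    show "AE x in lborel. norm (complex_of_real (gauss x) * A (\<delta> i *\<^sub>R x)) \<le> gauss x * N" for i
      using bA by (auto simp: norm_mult gauss_pos less_imp_le intro!: mult_left_mono)
  qed (use integrable_gauss in auto)
  moreover have "(LINT z|lborel. complex_of_real (gauss (z::real^2)) * A 0) = complex_of_real (2 * pi * N)"
    using integral_gauss[where 'a="real^2"] by (simp add: A0)
  ultimately have "(\<lambda>n. 2 * pi * (LINT z|lborel. complex_of_real (gauss z) * A (\<delta> n *\<^sub>R z))) \<longlonglongrightarrow> 2 * pi * complex_of_real (2 * pi * N)"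
    by (intro tendsto_mult tendsto_const) simp
  then have "(\<lambda>n. complex_of_real (I n)) \<longlonglongrightarrow> complex_of_real (4 * pi\<^sup>2 * N)"
    unfolding I_def gauss_weighted_plancherel[OF int \<delta>(1)] A_def by (simp add: power2_eq_square algebra_simps)
  then have I: "I \<longlonglongrightarrow> 4 * pi\<^sup>2 * N"
    using tendsto_of_real_iff by blast
  \<comment> \<open>Monotone convergence: \<open>\<delta>\<close> decreases, so the Gaussians
    increase to 1. Finiteness of \<open>l2n (fourier u)\<close> is not presupposed but comes out of
    the comparison of limits.\<close>
  have "(\<lambda>n. \<integral>\<^sup>+\<xi>. ennreal (gauss (\<delta> n *\<^sub>R \<xi>) * (cmod (fourier u \<xi>))\<^sup>2) \<partial>lborel) \<longlonglongrightarrow> l2n (fourier u)"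
    unfolding l2n_def
  proof (rule nn_integral_LIMSEQ)
    show "incseq (\<lambda>i x. ennreal (gauss (\<delta> i *\<^sub>R x) * (cmod (fourier u x))\<^sup>2))"
    proof (intro incseq_SucI le_funI ennreal_leI mult_right_mono)
      fix i and x :: "real^2"
      show "gauss (\<delta> i *\<^sub>R x) \<le> gauss (\<delta> (Suc i) *\<^sub>R x)"
        unfolding gauss_def \<delta>_def
        by (auto simp: power_mult_distrib intro!: mult_mono power_mono divide_left_mono divide_right_mono)
    qed simp
    fix x :: "real^2"
    have "(\<lambda>i. gauss (\<delta> i *\<^sub>R x) * (cmod (fourier u x))\<^sup>2) \<longlonglongrightarrow> gauss (0 *\<^sub>R x) * (cmod (fourier u x))\<^sup>2"
      unfolding gauss_def by (intro tendsto_intros \<delta>) auto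
    then show "(\<lambda>i. ennreal (gauss (\<delta> i *\<^sub>R x) * (cmod (fourier u x))\<^sup>2)) \<longlonglongrightarrow> ennreal ((cmod (fourier u x))\<^sup>2)"
      by (intro tendsto_ennrealI) (simp add: gauss_0)
  qed measurable
  moreover have "(\<integral>\<^sup>+\<xi>. ennreal (gauss (\<delta> n *\<^sub>R \<xi>) * (cmod (fourier u \<xi>))\<^sup>2) \<partial>lborel) = ennreal (I n)" for n
    unfolding I_def
  proof (rule nn_integral_eq_integral)
    define K where "K = (LINT x|lborel. cmod (u x))"
    have K: "(cmod (fourier u \<xi>))\<^sup>2 \<le> K\<^sup>2" for \<xi>
      unfolding K_def by (intro power_mono fourier_bound[OF int]) auto
    show "integrable lborel (\<lambda>\<xi>. gauss (\<delta> n *\<^sub>R \<xi>) * (cmod (fourier u \<xi>))\<^sup>2)"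
    proof (rule Bochner_Integration.integrable_bound[of _ "\<lambda>\<xi>. gauss (\<delta> n *\<^sub>R \<xi>) * K\<^sup>2"])
      show "integrable lborel (\<lambda>\<xi>::real^2. gauss (\<delta> n *\<^sub>R \<xi>) * K\<^sup>2)"
        using integrable_lborel_scale[OF integrable_gauss[where 'a="real^2"], of "\<delta> n"] \<delta>(1)[of n] by simp
    qed (use K in \<open>auto simp: abs_mult gauss_pos less_imp_le intro!: mult_left_mono\<close>)
  qed (auto simp: gauss_pos less_imp_le)
  ultimately have "(\<lambda>n. ennreal (I n)) \<longlonglongrightarrow> l2n (fourier u)" by simp
  moreover have "(\<lambda>n. ennreal (I n)) \<longlonglongrightarrow> ennreal (4 * pi\<^sup>2 * N)"
    by (intro tendsto_ennrealI I)
  ultimately have "l2n (fourier u) = ennreal (4 * pi\<^sup>2 * N)" by (rule LIMSEQ_unique)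
  then show ?thesis by (simp add: N ennreal_mult)
qed

section \<open>The Fourier transform on square integrable functions\<close>

lemma square_integrable_iff_l2n:
  "square_integrable f \<longleftrightarrow> f \<in> borel_measurable borel \<and> l2n f < \<infinity>"
  unfolding square_integrable_def l2n_def by (auto simp: integrable_iff_bounded)

lemma square_integrable_diff:
  assumes "square_integrable f" "square_integrable g"
  shows "square_integrable (\<lambda>x. f x - g x)"
  using assms l2n_add[of f "\<lambda>x. - g x"]
  unfolding square_integrable_iff_l2n by (auto simp: l2n_def ennreal_mult_less_top le_less_trans)

lemma l2n_cmult:
  assumes [measurable]: "f \<in> borel_measurable borel"
  shows "l2n (\<lambda>x. c * f x) = ennreal ((cmod c)\<^sup>2) * l2n f"
  unfolding l2n_def by (simp add: norm_mult power_mult_distrib ennreal_mult nn_integral_cmult)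

lemma square_integrable_cmult:
  assumes "square_integrable f"
  shows "square_integrable (\<lambda>x. c * f x)"
  using assms l2n_cmult[of f c] unfolding square_integrable_iff_l2n
  by (auto simp: ennreal_mult_less_top)

lemma square_integrable_bound:
  assumes "square_integrable f" "g \<in> borel_measurable borel" "\<And>x. cmod (g x) \<le> cmod (f x)"
  shows "square_integrable g"
  using assms l2n_mono[of g f] unfolding square_integrable_iff_l2n by (auto intro: le_less_trans)

definition trunc :: "real \<Rightarrow> (real^2 \<Rightarrow> complex) \<Rightarrow> real^2 \<Rightarrow> complex" where
  "trunc R f = (\<lambda>x. indicator (cball 0 R) x * f x)"

lemma cball_measurable [measurable]: "cball a r \<in> sets borel"
  by (rule borel_closed) simp

lemma trunc_measurable [measurable]:
  "f \<in> borel_measurable borel \<Longrightarrow> trunc R f \<in> borel_measurable borel"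
  unfolding trunc_def by measurable

lemma trunc_le: "cmod (trunc R f x) \<le> cmod (f x)"
  by (auto simp: trunc_def indicator_def)

lemma square_integrable_trunc: "square_integrable f \<Longrightarrow> square_integrable (trunc R f)"
  by (rule square_integrable_bound) (auto simp: square_integrable_def trunc_le intro!: trunc_measurable)

lemma integrable_trunc:
  assumes "square_integrable f"
  shows "integrable lborel (trunc R f)"
proof (rule Bochner_Integration.integrable_bound)
  have [measurable]: "f \<in> borel_measurable borel" and sq: "integrable lborel (\<lambda>x. (cmod (f x))\<^sup>2)"
    using assms by (auto simp: square_integrable_def)
  show "integrable lborel (\<lambda>x. indicator (cball (0::real^2) R) x + (cmod (f x))\<^sup>2)"
    by (intro Bochner_Integration.integrable_add sq integrable_real_indicator emeasure_lborel_cball_finite) auto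
  have "cmod (f x) \<le> 1 + (cmod (f x))\<^sup>2" for x
    using sum_squares_bound[of "cmod (f x)" 1] zero_le_power2[of "cmod (f x)"] by (simp, linarith)
  then show "AE x in lborel. norm (trunc R f x) \<le> norm (indicator (cball 0 R) x + (cmod (f x))\<^sup>2)"
    by (auto simp: trunc_def indicator_def)
  show "trunc R f \<in> borel_measurable lborel" by measurable
qed

lemma trunc_tendsto:
  assumes "square_integrable f"
  shows "((\<lambda>R. l2n (\<lambda>x. trunc R f x - f x)) \<longlongrightarrow> 0) at_top"
proof (rule tendsto_at_topI_sequentially)
  fix X :: "nat \<Rightarrow> real" assume X: "filterlim X at_top sequentially"
  have [measurable]: "f \<in> borel_measurable borel" and sq: "l2n f < \<infinity>"
    using assms by (auto simp: square_integrable_iff_l2n)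
  show "(\<lambda>n. l2n (\<lambda>x. trunc (X n) f x - f x)) \<longlonglongrightarrow> 0"
  proof (rule l2n_dominated[OF _ _ sq])
    fix x :: "real^2"
    have "\<forall>\<^sub>F n in sequentially. norm x \<le> X n"
      using X by (simp add: filterlim_at_top)
    then have "\<forall>\<^sub>F n in sequentially. trunc (X n) f x = f x"
      by eventually_elim (auto simp: trunc_def)
    then show "(\<lambda>n. trunc (X n) f x) \<longlonglongrightarrow> f x" by (rule tendsto_eventually)
  qed (auto simp: trunc_def indicator_def)
qed

section \<open>The L2 transform as a relation: linearity, shifts, conjugation, uniqueness\<close>

lemma has_fourier_L2_iff:
  "has_fourier_L2 f F \<longleftrightarrow> square_integrable f \<and> square_integrable F \<and>
     ((\<lambda>R. l2n (\<lambda>\<xi>. fourier (trunc R f) \<xi> - F \<xi>)) \<longlongrightarrow> 0) at_top"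
  unfolding has_fourier_L2_def trunc_def l2n_def by simp

lemma fourier_diff:
  assumes "integrable lborel u" "integrable lborel v"
  shows "fourier (\<lambda>x. u x - v x) \<xi> = fourier u \<xi> - fourier v \<xi>"
  unfolding fourier_def left_diff_distrib
  by (intro Bochner_Integration.integral_diff fourier_integrand_integrable assms)

lemma fourier_cmult: "fourier (\<lambda>x. c * u x) \<xi> = c * fourier u \<xi>"
  unfolding fourier_def mult.assoc by simp

lemma has_fourier_L2_diff:
  assumes "has_fourier_L2 f F" "has_fourier_L2 g G"
  shows "has_fourier_L2 (\<lambda>x. f x - g x) (\<lambda>x. F x - G x)"
proof -
  have [measurable]: "f \<in> borel_measurable borel" "g \<in> borel_measurable borel"
    "F \<in> borel_measurable borel" "G \<in> borel_measurable borel"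
    using assms by (auto simp: has_fourier_L2_iff square_integrable_def)
  have sq: "square_integrable f" "square_integrable g" using assms by (auto simp: has_fourier_L2_iff)
  have "((\<lambda>R. l2n (\<lambda>\<xi>. fourier (trunc R (\<lambda>x. f x - g x)) \<xi> - (F \<xi> - G \<xi>))) \<longlongrightarrow> 0) at_top"
  proof (rule tendsto_0_ennreal_le)
    show "((\<lambda>R. 2 * l2n (\<lambda>\<xi>. fourier (trunc R f) \<xi> - F \<xi>) + 2 * l2n (\<lambda>\<xi>. G \<xi> - fourier (trunc R g) \<xi>)) \<longlongrightarrow> 0) at_top"
      using assms unfolding l2n_minus_commute[of G]
      by (intro tendsto_add[where a=0 and b=0, simplified] tendsto_0_ennreal_cmult)
         (auto simp: has_fourier_L2_iff)
    fix R
    have "trunc R (\<lambda>x. f x - g x) = (\<lambda>x. trunc R f x - trunc R g x)"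
      by (auto simp: trunc_def algebra_simps)
    then have "(\<lambda>\<xi>. fourier (trunc R (\<lambda>x. f x - g x)) \<xi> - (F \<xi> - G \<xi>))
       = (\<lambda>\<xi>. (fourier (trunc R f) \<xi> - F \<xi>) + (G \<xi> - fourier (trunc R g) \<xi>))"
      by (simp add: fourier_diff integrable_trunc sq algebra_simps)
    then show "l2n (\<lambda>\<xi>. fourier (trunc R (\<lambda>x. f x - g x)) \<xi> - (F \<xi> - G \<xi>))
       \<le> 2 * l2n (\<lambda>\<xi>. fourier (trunc R f) \<xi> - F \<xi>) + 2 * l2n (\<lambda>\<xi>. G \<xi> - fourier (trunc R g) \<xi>)"
      by (simp only:) (rule l2n_add; measurable)
  qed
  then show ?thesis
    using assms unfolding has_fourier_L2_iff by (auto intro: square_integrable_diff)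
qed

lemma has_fourier_L2_cmult:
  assumes "has_fourier_L2 f F"
  shows "has_fourier_L2 (\<lambda>x. c * f x) (\<lambda>x. c * F x)"
proof -
  have [measurable]: "f \<in> borel_measurable borel" "F \<in> borel_measurable borel"
    using assms by (auto simp: has_fourier_L2_iff square_integrable_def)
  have "fourier (trunc R (\<lambda>x. c * f x)) \<xi> - c * F \<xi> = c * (fourier (trunc R f) \<xi> - F \<xi>)" for R \<xi>
    using fourier_cmult[of c "trunc R f" \<xi>] by (simp add: trunc_def algebra_simps)
  then have "((\<lambda>R. l2n (\<lambda>\<xi>. fourier (trunc R (\<lambda>x. c * f x)) \<xi> - c * F \<xi>)) \<longlongrightarrow> 0) at_top"
    using assms by (simp add: l2n_cmult has_fourier_L2_iff tendsto_0_ennreal_cmult)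
  then show ?thesis
    using assms unfolding has_fourier_L2_iff by (auto intro: square_integrable_cmult)
qed

lemma has_fourier_L2_add:
  assumes "has_fourier_L2 f F" "has_fourier_L2 g G"
  shows "has_fourier_L2 (\<lambda>x. f x + g x) (\<lambda>x. F x + G x)"
  using has_fourier_L2_diff[OF assms(1) has_fourier_L2_cmult[OF assms(2), of "-1"]] by simp

lemma has_fourier_L2_modulation:
  assumes "has_fourier_L2 f F"
  shows "has_fourier_L2 (\<lambda>x. exp (\<i> * complex_of_real (x \<bullet> h)) * f x) (\<lambda>\<xi>. F (\<xi> - h))"
proof -
  have [measurable]: "f \<in> borel_measurable borel" "F \<in> borel_measurable borel"
    and sq: "square_integrable F" "square_integrable f"
    using assms by (auto simp: has_fourier_L2_iff square_integrable_def)
  have eq: "fourier (trunc R (\<lambda>x. exp (\<i> * complex_of_real (x \<bullet> h)) * f x)) \<xi> = fourier (trunc R f) (\<xi> - h)" for R \<xi>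
    unfolding fourier_def trunc_def
    by (intro Bochner_Integration.integral_cong refl)
       (simp add: inner_diff_right algebra_simps exp_add[symmetric] exp_diff exp_minus divide_inverse)
  have sh: "l2n (\<lambda>\<xi>. u (\<xi> - h)) = l2n u" if "u \<in> borel_measurable borel" for u :: "real^2 \<Rightarrow> complex"
    using l2n_shift[OF that, of "- h"] by simp
  have "((\<lambda>R. l2n (\<lambda>\<xi>. fourier (trunc R (\<lambda>x. exp (\<i> * complex_of_real (x \<bullet> h)) * f x)) \<xi> - F (\<xi> - h))) \<longlongrightarrow> 0) at_top"
    unfolding eq by (subst sh[of "\<lambda>\<xi>. fourier (trunc _ f) \<xi> - F \<xi>"])
      (use assms in \<open>auto simp: has_fourier_L2_iff\<close>)
  moreover have "square_integrable (\<lambda>\<xi>. F (\<xi> - h))"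
    using sq by (auto simp: square_integrable_iff_l2n sh)
  moreover have "square_integrable (\<lambda>x. exp (\<i> * complex_of_real (x \<bullet> h)) * f x)"
    by (rule square_integrable_bound[OF sq(2)]) (auto simp: norm_mult)
  ultimately show ?thesis by (simp add: has_fourier_L2_iff)
qed

lemma fourier_cnj: "fourier (\<lambda>x. cnj (u x)) \<xi> = cnj (fourier u (- \<xi>))"
  unfolding fourier_def Bochner_Integration.integral_cnj[symmetric] by (simp add: exp_cnj)

lemma has_fourier_L2_cnj:
  assumes "has_fourier_L2 f F"
  shows "has_fourier_L2 (\<lambda>x. cnj (f x)) (\<lambda>\<xi>. cnj (F (- \<xi>)))"
proof -
  have [measurable]: "f \<in> borel_measurable borel" "F \<in> borel_measurable borel"
    and sq: "square_integrable F" "square_integrable f"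
    using assms by (auto simp: has_fourier_L2_iff square_integrable_def)
  have r: "l2n (\<lambda>\<xi>. cnj (u (- \<xi>))) = l2n u" if "u \<in> borel_measurable borel" for u :: "real^2 \<Rightarrow> complex"
    unfolding l2n_def complex_mod_cnj
    by (rule nn_integral_lborel_reflect[of "\<lambda>x. ennreal ((cmod (u x))\<^sup>2)"]) (use that in simp)
  have "trunc R (\<lambda>x. cnj (f x)) = (\<lambda>x. cnj (trunc R f x))" for R
    by (auto simp: trunc_def indicator_def)
  then have eq: "fourier (trunc R (\<lambda>x. cnj (f x))) \<xi> - cnj (F (- \<xi>)) = cnj (fourier (trunc R f) (- \<xi>) - F (- \<xi>))" for R \<xi>
    by (simp add: fourier_cnj)
  have "((\<lambda>R. l2n (\<lambda>\<xi>. fourier (trunc R (\<lambda>x. cnj (f x))) \<xi> - cnj (F (- \<xi>)))) \<longlongrightarrow> 0) at_top"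
    unfolding eq by (subst r[of "\<lambda>\<xi>. fourier (trunc _ f) \<xi> - F \<xi>"])
      (use assms in \<open>auto simp: has_fourier_L2_iff\<close>)
  moreover have "square_integrable (\<lambda>\<xi>. cnj (F (- \<xi>)))"
    using sq by (auto simp: square_integrable_iff_l2n r)
  moreover have "square_integrable (\<lambda>x. cnj (f x))"
    by (rule square_integrable_bound[OF sq(2)]) auto
  ultimately show ?thesis by (simp add: has_fourier_L2_iff)
qed

lemma has_fourier_L2_cong_AE:
  assumes "has_fourier_L2 f F" "AE \<xi> in lborel. F \<xi> = F' \<xi>" "F' \<in> borel_measurable borel"
  shows "has_fourier_L2 f F'"
proof -
  have "l2n F = l2n F'" by (rule l2n_cong_AE[OF assms(2)])
  moreover have "l2n (\<lambda>\<xi>. u \<xi> - F \<xi>) = l2n (\<lambda>\<xi>. u \<xi> - F' \<xi>)" for u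
    by (rule l2n_cong_AE) (use assms(2) in auto)
  ultimately show ?thesis
    using assms(1,3) unfolding has_fourier_L2_iff by (simp add: square_integrable_iff_l2n)
qed

text \<open>By linearity the zero function has the transform F - G. Truncations of zero transform to
  zero, so a quantity constant in R, \<open>l2n\<close> of F - G, tends to 0.\<close>

lemma has_fourier_L2_transform_unique:
  assumes "has_fourier_L2 f F" "has_fourier_L2 f G"
  shows "AE \<xi> in lborel. F \<xi> = G \<xi>"
proof -
  have [measurable]: "f \<in> borel_measurable borel" "F \<in> borel_measurable borel" "G \<in> borel_measurable borel"
    using assms by (auto simp: has_fourier_L2_iff square_integrable_def)
  have "has_fourier_L2 (\<lambda>_. 0) (\<lambda>\<xi>. F \<xi> - G \<xi>)"
    using has_fourier_L2_diff[OF assms] by simp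
  then have "((\<lambda>R::real. l2n (\<lambda>\<xi>. F \<xi> - G \<xi>)) \<longlongrightarrow> 0) at_top"
    unfolding has_fourier_L2_iff by (simp add: trunc_def fourier_def l2n_minus_commute[of G] l2n_def norm_minus_commute)
  then have "l2n (\<lambda>\<xi>. F \<xi> - G \<xi>) = 0" by (simp add: tendsto_const_iff)
  then show ?thesis by (subst (asm) l2n_eq_0_iff) auto
qed

text \<open>Plancherel on truncations, passed to the limit. The sharp constant 4 pi^2 is traded for
  8 because two triangle inequalities lose a factor 4, leaving 8 \<open>l2n f\<close> \<le> 4
  \<open>l2n F\<close>. This much already gives injectivity and the transfer of bounds from
  frequency to space.\<close>

lemma has_fourier_L2_norm_le:
  assumes "has_fourier_L2 f F"
  shows "l2n f \<le> l2n F"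
proof -
  have [measurable]: "f \<in> borel_measurable borel" "F \<in> borel_measurable borel"
    and sq: "square_integrable F" "square_integrable f"
    using assms by (auto simp: has_fourier_L2_iff square_integrable_def)
  have 1: "8 * l2n (trunc R f) \<le> 2 * l2n (\<lambda>\<xi>. fourier (trunc R f) \<xi> - F \<xi>) + 2 * l2n F" for R
  proof -
    have "8 \<le> 4 * pi\<^sup>2" using pi_ge_two power_mono[of 2 pi 2] by simp
    then have "8 * l2n (trunc R f) \<le> ennreal (4 * pi\<^sup>2) * l2n (trunc R f)"
      by (intro mult_right_mono) (metis ennreal_leI ennreal_numeral, simp)
    also have "\<dots> = l2n (fourier (trunc R f))"
      using square_integrable_trunc[OF sq(2)]
      by (intro plancherel[symmetric] integrable_trunc sq) (simp add: square_integrable_iff_l2n)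
    also have "\<dots> \<le> 2 * l2n (\<lambda>\<xi>. fourier (trunc R f) \<xi> - F \<xi>) + 2 * l2n F"
      using l2n_diff_triangle[of "fourier (trunc R f)" F "\<lambda>_. 0"] by simp
    finally show ?thesis .
  qed
  have 2: "8 * l2n f \<le> 16 * l2n (\<lambda>x. trunc R f x - f x) + 4 * l2n (\<lambda>\<xi>. fourier (trunc R f) \<xi> - F \<xi>) + 4 * l2n F" for R
  proof -
    have "8 * l2n f \<le> 8 * (2 * l2n (\<lambda>x. trunc R f x - f x) + 2 * l2n (trunc R f))"
      using l2n_diff_triangle[of f "trunc R f" "\<lambda>_. 0"]
      by (intro mult_left_mono) (simp_all add: l2n_minus_commute[of f])
    also have "\<dots> = 16 * l2n (\<lambda>x. trunc R f x - f x) + 2 * (8 * l2n (trunc R f))"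
      by (simp add: distrib_left flip: mult.assoc)
    also have "\<dots> \<le> 16 * l2n (\<lambda>x. trunc R f x - f x) + 2 * (2 * l2n (\<lambda>\<xi>. fourier (trunc R f) \<xi> - F \<xi>) + 2 * l2n F)"
      by (intro add_left_mono mult_left_mono 1) simp
    finally show ?thesis by (simp add: distrib_left add.assoc flip: mult.assoc)
  qed
  have "((\<lambda>R. 16 * l2n (\<lambda>x. trunc R f x - f x) + 4 * l2n (\<lambda>\<xi>. fourier (trunc R f) \<xi> - F \<xi>) + 4 * l2n F) \<longlongrightarrow> 0 + 0 + 4 * l2n F) at_top"
    using assms by (intro tendsto_add tendsto_0_ennreal_cmult trunc_tendsto tendsto_const sq) (auto simp: has_fourier_L2_iff)
  from tendsto_le[OF _ this tendsto_const[of "8 * l2n f"]] 2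
  have "8 * l2n f \<le> 4 * l2n F" by simp
  also have "\<dots> \<le> 8 * l2n F" by (intro mult_right_mono) auto
  finally show ?thesis by (subst (asm) ennreal_mult_le_mult_iff) auto
qed

lemma has_fourier_L2_unique:
  assumes "has_fourier_L2 f F" "has_fourier_L2 g F"
  shows "AE x in lborel. f x = g x"
proof -
  have [measurable]: "f \<in> borel_measurable borel" "g \<in> borel_measurable borel"
    using assms by (auto simp: has_fourier_L2_iff square_integrable_def)
  have "l2n (\<lambda>x. f x - g x) \<le> l2n (\<lambda>x::real^2. F x - F x)"
    by (rule has_fourier_L2_norm_le[OF has_fourier_L2_diff[OF assms]])
  then have "l2n (\<lambda>x. f x - g x) = 0" by (simp add: l2n_def)
  then show ?thesis by (subst (asm) l2n_eq_0_iff) auto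
qed

text \<open>On integrable, square integrable functions the limit is the pointwise transform, because
  Plancherel turns the error of the truncated transform into the error of the truncation.\<close>

lemma has_fourier_L2_fourier:
  assumes "square_integrable f" "integrable lborel f"
  shows "has_fourier_L2 f (fourier f)"
proof -
  have [measurable]: "f \<in> borel_measurable borel" and fin: "l2n f < \<infinity>"
    using assms by (auto simp: square_integrable_iff_l2n)
  have "square_integrable (fourier f)"
    using fin by (simp add: square_integrable_iff_l2n plancherel[OF assms(2) fin] ennreal_mult_less_top)
  moreover have "l2n (\<lambda>\<xi>. fourier (trunc R f) \<xi> - fourier f \<xi>) = ennreal (4 * pi\<^sup>2) * l2n (\<lambda>x. trunc R f x - f x)" for R
  proof -
    have "l2n (\<lambda>\<xi>. fourier (trunc R f) \<xi> - fourier f \<xi>) = l2n (fourier (\<lambda>x. trunc R f x - f x))"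
      by (simp add: l2n_def fourier_diff[OF integrable_trunc[OF assms(1)] assms(2)])
    also have "\<dots> = ennreal (4 * pi\<^sup>2) * l2n (\<lambda>x. trunc R f x - f x)"
      using square_integrable_diff[OF square_integrable_trunc[OF assms(1)] assms(1)]
      by (intro plancherel Bochner_Integration.integrable_diff integrable_trunc assms)
         (simp add: square_integrable_iff_l2n)
    finally show ?thesis .
  qed
  ultimately show ?thesis
    using assms(1) trunc_tendsto[OF assms(1)]
    by (simp add: has_fourier_L2_iff tendsto_0_ennreal_cmult)
qed

section \<open>Completeness of L2 and surjectivity of the transform\<close>

text \<open>Riesz-Fischer for a rapidly converging sequence. The increments are summable almost
  everywhere, which produces a pointwise limit, and Fatou's lemma turns the bounds on finite tails
  into convergence in \<open>l2n\<close>.\<close>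

lemma l2_complete:
  fixes v :: "nat \<Rightarrow> 'a::euclidean_space \<Rightarrow> complex"
  assumes [measurable]: "\<And>n. v n \<in> borel_measurable borel"
    and d: "\<And>n. l2n (\<lambda>x. v (Suc n) x - v n x) \<le> ennreal ((1 / 8) ^ n)"
  obtains g where "g \<in> borel_measurable borel" "(\<lambda>n. l2n (\<lambda>x. v n x - g x)) \<longlonglongrightarrow> 0"
proof
  define D where "D n x = cmod (v (Suc n) x - v n x)" for n x
  have [measurable]: "D n \<in> borel_measurable borel" for n unfolding D_def by measurable
  define g where "g x = lim (\<lambda>n. v n x)" for x
  show g[measurable]: "g \<in> borel_measurable borel"
    unfolding g_def by (rule borel_measurable_lim_metric) simp
  \<comment> \<open>The weight 2^n prepares 2 D \<le> 2^n D^2 + 2^-n, which turns summability of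
    weighted squares into summability of the increments; against the rate 8^-n it leaves the
    summable 4^-n.\<close>
  have "(\<integral>\<^sup>+x. (\<Sum>n. ennreal (2 ^ n * (D n x)\<^sup>2)) \<partial>lborel) = (\<Sum>n. \<integral>\<^sup>+x. ennreal (2 ^ n * (D n x)\<^sup>2) \<partial>lborel)"
    by (rule nn_integral_suminf) simp
  also have "\<dots> \<le> (\<Sum>n. ennreal ((1 / 4) ^ n))"
  proof (rule suminf_le)
    fix n
    have "(\<integral>\<^sup>+x. ennreal (2 ^ n * (D n x)\<^sup>2) \<partial>lborel) = ennreal (2 ^ n) * l2n (\<lambda>x. v (Suc n) x - v n x)"
      unfolding l2n_def D_def by (simp add: ennreal_mult nn_integral_cmult)
    also have "\<dots> \<le> ennreal (2 ^ n) * ennreal ((1 / 8) ^ n)"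
      by (intro mult_left_mono d) simp
    also have "\<dots> = ennreal (2 ^ n * (1 / 8) ^ n)"
      by (rule ennreal_mult[symmetric]) auto
    also have "2 ^ n * (1 / 8) ^ n = (1 / 4 :: real) ^ n"
      by (simp flip: power_mult_distrib)
    finally show "(\<integral>\<^sup>+x. ennreal (2 ^ n * (D n x)\<^sup>2) \<partial>lborel) \<le> \<dots>" .
  qed auto
  also have "\<dots> < \<infinity>"
    by (subst suminf_ennreal2) (auto intro: summable_geometric)
  finally have "AE x in lborel. (\<Sum>n. ennreal (2 ^ n * (D n x)\<^sup>2)) \<noteq> \<infinity>"
    by (intro nn_integral_PInf_AE) auto
  then have lim: "AE x in lborel. (\<lambda>n. v n x) \<longlonglongrightarrow> g x"
  proof eventually_elim
    case (elim x)
    then have "summable (\<lambda>n. 2 ^ n * (D n x)\<^sup>2)"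
      by (intro summable_suminf_not_top) auto
    then have "summable (\<lambda>n. (2 ^ n * (D n x)\<^sup>2 + (1 / 2) ^ n) / 2)"
      by (intro summable_divide summable_add summable_geometric) auto
    then have "summable (\<lambda>n. norm (v (Suc n) x - v n x))"
    proof (rule summable_comparison_test'[where N=0])
      fix n
      have "0 \<le> (2 ^ n * D n x - 1)\<^sup>2 / 2 ^ n" by simp
      also have "\<dots> = 2 ^ n * (D n x)\<^sup>2 + (1 / 2) ^ n - 2 * D n x"
        by (simp add: power2_eq_square field_simps)
      finally show "norm (norm (v (Suc n) x - v n x)) \<le> (2 ^ n * (D n x)\<^sup>2 + (1 / 2) ^ n) / 2"
        by (simp add: D_def)
    qed
    then have "summable (\<lambda>n. v (Suc n) x - v n x)" by (rule summable_norm_cancel)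
    then have "(\<lambda>n. \<Sum>k<n. v (Suc k) x - v k x) \<longlonglongrightarrow> (\<Sum>n. v (Suc n) x - v n x)"
      by (rule summable_LIMSEQ)
    then have "(\<lambda>n. v n x - v 0 x) \<longlonglongrightarrow> (\<Sum>n. v (Suc n) x - v n x)"
      by (simp only: sum_lessThan_telescope[of "\<lambda>n. v n x"])
    from tendsto_add[OF this tendsto_const[of "v 0 x"]] have "convergent (\<lambda>n. v n x)"
      by (auto simp: convergent_def)
    then show ?case by (simp add: g_def convergent_LIMSEQ_iff)
  qed
  \<comment> \<open>The constant 4 reproduces itself under the factor-2 triangle inequality, since 2
    * 4 / 8 + 2 = 3 is at most 4.\<close>
  have tail: "l2n (\<lambda>x. v (n + j) x - v n x) \<le> ennreal (4 * (1 / 8) ^ n)" for n j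
  proof (induction j arbitrary: n)
    case 0
    then show ?case by (simp add: l2n_def)
  next
    case (Suc j)
    have "l2n (\<lambda>x. v (n + Suc j) x - v n x) \<le> 2 * l2n (\<lambda>x. v (Suc n + j) x - v (Suc n) x)
        + 2 * l2n (\<lambda>x. v (Suc n) x - v n x)"
      using l2n_diff_triangle[of "v (n + Suc j)" "v (Suc n)" "v n"] by simp
    also have "\<dots> \<le> ennreal 2 * ennreal (4 * (1 / 8) ^ Suc n) + ennreal 2 * ennreal ((1 / 8) ^ n)"
      by (intro add_mono mult_mono Suc d) auto
    also have "\<dots> = ennreal (2 * (4 * (1 / 8) ^ Suc n) + 2 * (1 / 8) ^ n)"
      by (subst ennreal_plus) (simp_all only: ennreal_mult' zero_le_numeral, simp_all)
    also have "\<dots> \<le> ennreal (4 * (1 / 8) ^ n)"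
      by (rule ennreal_leI) simp
    finally show ?case .
  qed
  have bd: "l2n (\<lambda>x. v n x - g x) \<le> ennreal (4 * (1 / 8) ^ n)" for n
  proof -
    have "l2n (\<lambda>x. v n x - g x) = (\<integral>\<^sup>+x. liminf (\<lambda>j. ennreal ((cmod (v (n + j) x - v n x))\<^sup>2)) \<partial>lborel)"
      unfolding l2n_def
    proof (rule nn_integral_cong_AE)
      show "AE x in lborel. ennreal ((cmod (v n x - g x))\<^sup>2) = liminf (\<lambda>j. ennreal ((cmod (v (n + j) x - v n x))\<^sup>2))"
        using lim
      proof eventually_elim
        case (elim x)
        then have "(\<lambda>j. v (n + j) x) \<longlonglongrightarrow> g x"
          using LIMSEQ_ignore_initial_segment[of "\<lambda>j. v j x" "g x" n] by (simp add: add.commute)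
        then have "(\<lambda>j. ennreal ((cmod (v (n + j) x - v n x))\<^sup>2)) \<longlonglongrightarrow> ennreal ((cmod (g x - v n x))\<^sup>2)"
          by (intro tendsto_intros)
        then show ?case
          by (subst norm_minus_commute) (rule lim_imp_Liminf[symmetric], simp)
      qed
    qed
    also have "\<dots> \<le> liminf (\<lambda>j. l2n (\<lambda>x. v (n + j) x - v n x))"
      unfolding l2n_def by (rule nn_integral_liminf) simp
    also have "\<dots> \<le> liminf (\<lambda>j::nat. ennreal (4 * (1 / 8) ^ n))"
      by (rule Liminf_mono) (use tail in auto)
    finally show ?thesis by (simp add: Liminf_const)
  qed
  have "(\<lambda>n. 4 * (1 / 8::real) ^ n) \<longlonglongrightarrow> 4 * 0"
    by (intro tendsto_mult tendsto_const LIMSEQ_realpow_zero) auto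
  then have "(\<lambda>n. ennreal (4 * (1 / 8) ^ n)) \<longlonglongrightarrow> 0"
    using tendsto_ennrealI by fastforce
  then show "(\<lambda>n. l2n (\<lambda>x. v n x - g x)) \<longlonglongrightarrow> 0"
    by (rule tendsto_0_ennreal_le) (rule bd)
qed

text \<open>The candidate of the inversion formula in the normalisation of \<open>fourier\<close>.
  Inversion itself is never proved; only the distance identity below is used.\<close>

definition inverse_fourier :: "(real^2 \<Rightarrow> complex) \<Rightarrow> real^2 \<Rightarrow> complex" where
  "inverse_fourier w x = complex_of_real (1 / (4 * pi\<^sup>2)) * fourier w (- x)"

lemma uminus_measurable [measurable]:
  "(uminus :: 'a::euclidean_space \<Rightarrow> 'a) \<in> borel_measurable borel"
  by (intro borel_measurable_continuous_onI continuous_intros)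

lemma inverse_fourier_measurable [measurable]:
  assumes [measurable]: "w \<in> borel_measurable borel"
  shows "inverse_fourier w \<in> borel_measurable borel"
  unfolding inverse_fourier_def by measurable

lemma l2n_inverse_fourier:
  assumes "integrable lborel w" "square_integrable w"
  shows "l2n (inverse_fourier w) = ennreal (1 / (4 * pi\<^sup>2)) * l2n w"
proof -
  have [measurable]: "w \<in> borel_measurable borel" using assms by auto
  have "l2n (inverse_fourier w) = ennreal ((1 / (4 * pi\<^sup>2))\<^sup>2) * l2n (\<lambda>x. fourier w (- x))"
    unfolding inverse_fourier_def by (subst l2n_cmult) (measurable, simp only: norm_of_real power2_abs)
  also have "l2n (\<lambda>x. fourier w (- x)) = l2n (fourier w)"
    unfolding l2n_def
    by (rule nn_integral_lborel_reflect[of "\<lambda>x. ennreal ((cmod (fourier w x))\<^sup>2)"]) simp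
  also have "\<dots> = ennreal (4 * pi\<^sup>2) * l2n w"
    using assms by (intro plancherel) (auto simp: square_integrable_iff_l2n)
  also have "ennreal ((1 / (4 * pi\<^sup>2))\<^sup>2) * (ennreal (4 * pi\<^sup>2) * l2n w) = ennreal (1 / (4 * pi\<^sup>2)) * l2n w"
    unfolding mult.assoc[symmetric] by (subst ennreal_mult[symmetric]) (auto simp: power2_eq_square)
  finally show ?thesis .
qed

lemma square_integrable_inverse_fourier:
  assumes "integrable lborel w" "square_integrable w"
  shows "square_integrable (inverse_fourier w)"
  using assms by (auto simp: square_integrable_iff_l2n l2n_inverse_fourier ennreal_mult_less_top)

lemma square_integrable_mult_integrable:
  assumes "square_integrable u" "square_integrable v"
  shows "integrable lborel (\<lambda>x. u x * cnj (v x))"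
proof (rule Bochner_Integration.integrable_bound)
  show "integrable lborel (\<lambda>x. ((cmod (u x))\<^sup>2 + (cmod (v x))\<^sup>2) / 2)"
    using assms by (simp add: square_integrable_def)
  have [measurable]: "u \<in> borel_measurable borel" "v \<in> borel_measurable borel"
    using assms by (auto simp: square_integrable_def)
  show "(\<lambda>x. u x * cnj (v x)) \<in> borel_measurable lborel" by measurable
  show "AE x in lborel. norm (u x * cnj (v x)) \<le> norm (((cmod (u x))\<^sup>2 + (cmod (v x))\<^sup>2) / 2)"
  proof (intro AE_I2)
    fix x
    show "norm (u x * cnj (v x)) \<le> norm (((cmod (u x))\<^sup>2 + (cmod (v x))\<^sup>2) / 2)"
      using sum_squares_bound[of "cmod (u x)" "cmod (v x)"] by (simp add: norm_mult)
  qed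
qed

lemma l2n_diff_expand:
  assumes "square_integrable u" "square_integrable v"
  shows "l2n (\<lambda>x. u x - v x) = ennreal ((LINT x|lborel. (cmod (u x))\<^sup>2)
    - 2 * Re (LINT x|lborel. u x * cnj (v x)) + (LINT x|lborel. (cmod (v x))\<^sup>2))"
proof -
  have e: "(cmod (a - b))\<^sup>2 = (cmod a)\<^sup>2 - 2 * Re (a * cnj b) + (cmod b)\<^sup>2" for a b :: complex
    unfolding cmod_power2 by (simp add: power2_eq_square algebra_simps)
  have "l2n (\<lambda>x. u x - v x) = ennreal (LINT x|lborel. (cmod (u x - v x))\<^sup>2)"
    unfolding l2n_def using square_integrable_diff[OF assms]
    by (intro nn_integral_eq_integral) (auto simp: square_integrable_def)
  also have "(LINT x|lborel. (cmod (u x - v x))\<^sup>2) = (LINT x|lborel. (cmod (u x))\<^sup>2)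
    - 2 * (LINT x|lborel. Re (u x * cnj (v x))) + (LINT x|lborel. (cmod (v x))\<^sup>2)"
  proof -
    define p where "p x = u x * cnj (v x)" for x
    have "integrable lborel p" unfolding p_def by (rule square_integrable_mult_integrable[OF assms])
    then show ?thesis
      unfolding e p_def[symmetric] using assms by (simp add: square_integrable_def integrable_Re)
  qed
  also have "(LINT x|lborel. Re (u x * cnj (v x))) = Re (LINT x|lborel. u x * cnj (v x))"
    by (rule integral_Re[OF square_integrable_mult_integrable[OF assms]])
  finally show ?thesis .
qed

lemma l2n_eq_lebesgue_integral:
  assumes "square_integrable u"
  shows "l2n u = ennreal (LINT x|lborel. (cmod (u x))\<^sup>2)"
  unfolding l2n_def using assms
  by (intro nn_integral_eq_integral) (auto simp: square_integrable_def)

text \<open>Expand both squared distances. The norms of \<open>u\<close> and of \<open>w\<close>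
  correspond by Plancherel, each separately, and the scalar products correspond by Fubini. Thus the
  transform of \<open>u\<close> is close to \<open>w\<close> exactly when \<open>u\<close> is close
  to \<open>inverse_fourier w\<close>, which is what surjectivity needs in place of an inversion
  theorem.\<close>

lemma fourier_inverse_fourier_distance:
  assumes u: "integrable lborel u" "square_integrable u"
    and w: "integrable lborel w" "square_integrable w"
  shows "l2n (\<lambda>\<xi>. fourier u \<xi> - w \<xi>) = ennreal (4 * pi\<^sup>2) * l2n (\<lambda>x. u x - inverse_fourier w x)"
proof -
  have [measurable]: "u \<in> borel_measurable borel" "w \<in> borel_measurable borel" using u w by auto
  have Fu: "square_integrable (fourier u)"
    using has_fourier_L2_fourier[OF u(2,1)] by (simp add: has_fourier_L2_iff)
  note Iw = square_integrable_inverse_fourier[OF w]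
  have 1: "(LINT x|lborel. (cmod (fourier u x))\<^sup>2) = 4 * pi\<^sup>2 * (LINT x|lborel. (cmod (u x))\<^sup>2)"
  proof -
    have "l2n (fourier u) = ennreal (4 * pi\<^sup>2) * l2n u"
      using u by (intro plancherel) (auto simp: square_integrable_iff_l2n)
    then show ?thesis
      unfolding l2n_eq_lebesgue_integral[OF Fu] l2n_eq_lebesgue_integral[OF u(2)]
      by (subst (asm) ennreal_mult[symmetric]) auto
  qed
  have 2: "(LINT x|lborel. (cmod (w x))\<^sup>2) = 4 * pi\<^sup>2 * (LINT x|lborel. (cmod (inverse_fourier w x))\<^sup>2)"
  proof -
    have "l2n (inverse_fourier w) = ennreal (1 / (4 * pi\<^sup>2)) * l2n w"
      by (rule l2n_inverse_fourier[OF w])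
    then show ?thesis
      unfolding l2n_eq_lebesgue_integral[OF Iw] l2n_eq_lebesgue_integral[OF w(2)]
      by (subst (asm) ennreal_mult[symmetric]) auto
  qed
  have 3: "(LINT \<xi>|lborel. fourier u \<xi> * cnj (w \<xi>)) = 4 * pi\<^sup>2 * (LINT x|lborel. u x * cnj (inverse_fourier w x))"
  proof -
    let ?e = "\<lambda>x \<xi>. exp (- (\<i> * complex_of_real (x \<bullet> \<xi>)))"
    have "(LINT \<xi>|lborel. fourier u \<xi> * cnj (w \<xi>)) = (LINT \<xi>|lborel. LINT x|lborel. u x * ?e x \<xi> * cnj (w \<xi>))"
      unfolding fourier_def by simp
    also have "\<dots> = (LINT x|lborel. LINT \<xi>|lborel. u x * ?e x \<xi> * cnj (w \<xi>))"
    proof (rule lborel_pair.Fubini_integral[symmetric], rule lborel_pair.Fubini_integrable)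
      show "integrable lborel (\<lambda>\<xi>. LINT x|lborel. norm (case (\<xi>, x) of (\<xi>, x) \<Rightarrow> u x * ?e x \<xi> * cnj (w \<xi>)))"
        using w(1) by (simp add: norm_mult)
      show "AE \<xi> in lborel. integrable lborel (\<lambda>x. case (\<xi>, x) of (\<xi>, x) \<Rightarrow> u x * ?e x \<xi> * cnj (w \<xi>))"
        using fourier_integrand_integrable[OF u(1)] by auto
    qed measurable
    also have "\<dots> = (LINT x|lborel. u x * cnj (fourier w (- x)))"
    proof (intro Bochner_Integration.integral_cong refl)
      fix x
      have "cnj (fourier w (- x)) = (LINT \<xi>|lborel. ?e x \<xi> * cnj (w \<xi>))"
        unfolding fourier_def Bochner_Integration.integral_cnj[symmetric]
        by (simp add: exp_cnj mult.commute inner_commute)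
      then show "(LINT \<xi>|lborel. u x * ?e x \<xi> * cnj (w \<xi>)) = u x * cnj (fourier w (- x))"
        by (simp add: mult.assoc)
    qed
    also have "\<dots> = (LINT x|lborel. complex_of_real (4 * pi\<^sup>2) * (u x * cnj (inverse_fourier w x)))"
      by (intro Bochner_Integration.integral_cong refl) (simp add: inverse_fourier_def)
    finally show ?thesis by simp
  qed
  have "Re (complex_of_real c * z) = c * Re z" for c z by simp
  then have "l2n (\<lambda>\<xi>. fourier u \<xi> - w \<xi>) = ennreal (4 * pi\<^sup>2 * ((LINT x|lborel. (cmod (u x))\<^sup>2)
    - 2 * Re (LINT x|lborel. u x * cnj (inverse_fourier w x)) + (LINT x|lborel. (cmod (inverse_fourier w x))\<^sup>2)))"
    unfolding l2n_diff_expand[OF Fu w(2)] 1 2 3 by (simp only:) (simp add: algebra_simps)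
  then show ?thesis
    unfolding l2n_diff_expand[OF u(2) Iw] by (simp only: ennreal_mult'[where a="4 * pi\<^sup>2"] zero_le_power2 zero_le_mult_iff zero_le_numeral simp_thms)
qed

text \<open>The inverse transforms of truncations of \<open>G\<close> form a Cauchy sequence. Its
  limit \<open>g\<close> has the transform \<open>G\<close>: compare truncations of \<open>g\<close>
  with truncations of \<open>G\<close> through the distance identity.\<close>

lemma has_fourier_L2_surj:
  assumes G: "square_integrable G"
  shows "\<exists>g. has_fourier_L2 g G"
proof -
  have [measurable]: "G \<in> borel_measurable borel" using G by (simp add: square_integrable_def)
  note iG = integrable_trunc[OF G] square_integrable_trunc[OF G]
  \<comment> \<open>With these errors consecutive inverse transforms differ by at most 2 * 8^-(n+1)
    / 4 + 2 * 8^-n / 4 \<le> 8^-n, the rate that \<open>l2_complete\<close> asks for.\<close>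
  have "\<exists>S. l2n (\<lambda>x. trunc S G x - G x) < ennreal ((1 / 8) ^ n / 4)" for n
  proof -
    have "\<forall>\<^sub>F S in at_top. l2n (\<lambda>x. trunc S G x - G x) < ennreal ((1 / 8) ^ n / 4)"
      by (rule order_tendstoD(2)[OF trunc_tendsto[OF G]]) simp
    then show ?thesis using eventually_happens'[OF trivial_limit_at_top_linorder] by blast
  qed
  then obtain S where S: "\<And>n. l2n (\<lambda>x. trunc (S n) G x - G x) < ennreal ((1 / 8) ^ n / 4)" by metis
  define v where "v n = inverse_fourier (trunc (S n) G)" for n
  have [measurable]: "v n \<in> borel_measurable borel" for n unfolding v_def by measurable
  have sv: "square_integrable (v n)" for n
    unfolding v_def by (intro square_integrable_inverse_fourier iG)
  have "l2n (\<lambda>x. v (Suc n) x - v n x) \<le> ennreal ((1 / 8) ^ n)" for n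
  proof -
    have "(\<lambda>x. v (Suc n) x - v n x) = inverse_fourier (\<lambda>x. trunc (S (Suc n)) G x - trunc (S n) G x)"
      unfolding v_def inverse_fourier_def by (simp add: fourier_diff iG right_diff_distrib)
    then have "l2n (\<lambda>x. v (Suc n) x - v n x) = ennreal (1 / (4 * pi\<^sup>2)) * l2n (\<lambda>x. trunc (S (Suc n)) G x - trunc (S n) G x)"
      by (simp only:) (intro l2n_inverse_fourier Bochner_Integration.integrable_diff square_integrable_diff iG)
    also have "\<dots> \<le> 1 * l2n (\<lambda>x. trunc (S (Suc n)) G x - trunc (S n) G x)"
    proof (intro mult_right_mono)
      have "4 \<le> pi\<^sup>2" using pi_ge_two power_mono[of 2 pi 2] by simp
      then show "ennreal (1 / (4 * pi\<^sup>2)) \<le> 1" by (simp add: divide_le_eq)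
    qed simp
    also have "\<dots> \<le> 2 * l2n (\<lambda>x. trunc (S (Suc n)) G x - G x) + 2 * l2n (\<lambda>x. trunc (S n) G x - G x)"
      using l2n_diff_triangle[of "trunc (S (Suc n)) G" G "trunc (S n) G"] by (simp add: l2n_minus_commute[of G])
    also have "\<dots> \<le> ennreal 2 * ennreal ((1 / 8) ^ Suc n / 4) + ennreal 2 * ennreal ((1 / 8) ^ n / 4)"
      by (intro add_mono mult_mono less_imp_le[OF S]) auto
    also have "\<dots> = ennreal (2 * ((1 / 8) ^ Suc n / 4) + 2 * ((1 / 8) ^ n / 4))"
      by (subst ennreal_plus) (simp_all only: ennreal_mult' zero_le_numeral, simp_all)
    also have "\<dots> \<le> ennreal ((1 / 8) ^ n)" by (rule ennreal_leI) simp
    finally show ?thesis .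
  qed
  then obtain g where [measurable]: "g \<in> borel_measurable borel" and g: "(\<lambda>n. l2n (\<lambda>x. v n x - g x)) \<longlonglongrightarrow> 0"
    using l2_complete[of v] by auto
  have "square_integrable g"
  proof -
    have "\<forall>\<^sub>F n in sequentially. l2n (\<lambda>x. v n x - g x) < 1"
      by (rule order_tendstoD(2)[OF g]) simp
    then obtain n where n: "l2n (\<lambda>x. v n x - g x) < 1"
      using eventually_happens'[OF sequentially_bot] by blast
    then have "square_integrable (\<lambda>x. v n x - g x)"
      unfolding square_integrable_iff_l2n by (auto intro: less_trans)
    from square_integrable_diff[OF sv[of n] this] show ?thesis by simp
  qed
  note ig = integrable_trunc[OF this] square_integrable_trunc[OF this] and sg = this
  let ?c = "ennreal (4 * pi\<^sup>2)"
  \<comment> \<open>The auxiliary index n occurs only on the right-hand side, so it can be sent to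
    infinity, which removes the errors of \<open>v n\<close> and of the truncated
    \<open>G\<close>.\<close>
  have le: "l2n (\<lambda>\<xi>. fourier (trunc R g) \<xi> - G \<xi>) \<le> 4 * (?c * l2n (\<lambda>x. trunc R g x - g x))" for R
  proof -
    have "l2n (\<lambda>\<xi>. fourier (trunc R g) \<xi> - G \<xi>) \<le> 2 * (?c * (2 * l2n (\<lambda>x. trunc R g x - g x) + 2 * l2n (\<lambda>x. v n x - g x)))
      + 2 * l2n (\<lambda>x. trunc (S n) G x - G x)" for n
    proof -
      have "l2n (\<lambda>\<xi>. fourier (trunc R g) \<xi> - G \<xi>) \<le> 2 * l2n (\<lambda>\<xi>. fourier (trunc R g) \<xi> - trunc (S n) G \<xi>)
         + 2 * l2n (\<lambda>x. trunc (S n) G x - G x)"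
        by (rule l2n_diff_triangle) auto
      also have "l2n (\<lambda>\<xi>. fourier (trunc R g) \<xi> - trunc (S n) G \<xi>) = ?c * l2n (\<lambda>x. trunc R g x - v n x)"
        unfolding v_def by (rule fourier_inverse_fourier_distance[OF ig iG])
      also have "l2n (\<lambda>x. trunc R g x - v n x) \<le> 2 * l2n (\<lambda>x. trunc R g x - g x) + 2 * l2n (\<lambda>x. v n x - g x)"
        using l2n_diff_triangle[of "trunc R g" g "v n"] by (simp add: l2n_minus_commute[of g])
      finally show ?thesis by (simp add: mult_left_mono add_right_mono)
    qed
    moreover have "(\<lambda>n. 2 * (?c * (2 * l2n (\<lambda>x. trunc R g x - g x) + 2 * l2n (\<lambda>x. v n x - g x)))
      + 2 * l2n (\<lambda>x. trunc (S n) G x - G x)) \<longlonglongrightarrow> 2 * (?c * (2 * l2n (\<lambda>x. trunc R g x - g x) + 0)) + 0"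
    proof (intro tendsto_add tendsto_0_ennreal_cmult ennreal_tendsto_cmult tendsto_const g)
      have "(\<lambda>n. ennreal ((1 / 8) ^ n / 4)) \<longlonglongrightarrow> ennreal (0 / 4)"
        by (intro tendsto_ennrealI tendsto_divide tendsto_const LIMSEQ_realpow_zero) auto
      then show "(\<lambda>n. l2n (\<lambda>x. trunc (S n) G x - G x)) \<longlonglongrightarrow> 0"
        by (intro tendsto_0_ennreal_le[OF _ less_imp_le[OF S]]) simp
    qed auto
    ultimately have "l2n (\<lambda>\<xi>. fourier (trunc R g) \<xi> - G \<xi>) \<le> 2 * (?c * (2 * l2n (\<lambda>x. trunc R g x - g x) + 0)) + 0"
      by (intro LIMSEQ_le_const) auto
    then show ?thesis by (simp add: mult.left_commute flip: mult.assoc)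
  qed
  have "((\<lambda>R. l2n (\<lambda>\<xi>. fourier (trunc R g) \<xi> - G \<xi>)) \<longlongrightarrow> 0) at_top"
    by (rule tendsto_0_ennreal_le[OF _ le]) (intro tendsto_0_ennreal_cmult trunc_tendsto sg, auto)
  then show ?thesis using G sg by (auto simp: has_fourier_L2_iff)
qed

section \<open>Decay of the Riesz transforms\<close>

lemma integrable_inverse_power_real:
  fixes q :: real
  assumes "1 < q"
  shows "integrable lborel (\<lambda>t::real. (1 + \<bar>t\<bar>) powr (- q))"
proof -
  define f where "f t = indicator {0..} t * (1 + t) powr (- q)" for t :: real
  have [measurable]: "f \<in> borel_measurable borel" unfolding f_def by measurable
  have "((\<lambda>t. (1 + t) powr (1 - q)) \<longlongrightarrow> 0) at_top"
    using assms by (intro tendsto_neg_powr filterlim_tendsto_add_at_top[OF tendsto_const filterlim_ident]) simp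
  then have lim: "((\<lambda>t. (1 + t) powr (1 - q) / (1 - q)) \<longlongrightarrow> 0) at_top"
    using tendsto_divide[OF _ tendsto_const[of "1 - q"]] assms by force
  have "(\<integral>\<^sup>+t. ennreal ((1 + t) powr (- q)) * indicator {0..} t \<partial>lborel) = ennreal (0 - (1 + 0) powr (1 - q) / (1 - q))"
  proof (rule nn_integral_FTC_atLeast[OF _ _ _ lim])
    fix t :: real assume "0 \<le> t"
    then show "((\<lambda>t. (1 + t) powr (1 - q) / (1 - q)) has_real_derivative (1 + t) powr (- q)) (at t)"
      using assms by (auto intro!: derivative_eq_intros)
  qed auto
  then have "(\<integral>\<^sup>+t. ennreal (f t) \<partial>lborel) < \<infinity>"
    by (simp add: f_def ennreal_mult ennreal_indicator mult.commute ennreal_mult'')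
  then have f: "integrable lborel f"
    by (subst integrable_iff_bounded) (auto simp: f_def abs_mult)
  have "integrable lborel (\<lambda>t. f t + f (- t))"
    using f lborel_integrable_real_affine[OF f, of "-1" 0] by simp
  then show ?thesis
    by (rule Bochner_Integration.integrable_bound) (auto simp: f_def indicator_def)
qed

text \<open>Split the power evenly over the two coordinates: 1 + |x| dominates 1 + |x_i|, so the
  function is at most a product of one-dimensional powers with exponent p / 2 > 1.\<close>

lemma integrable_inverse_power:
  fixes p :: real
  assumes "2 < p"
  shows "integrable lborel (\<lambda>x::real^2. (1 + norm x) powr (- p))"
proof (rule Bochner_Integration.integrable_bound)
  have "integrable lborel (\<lambda>x::real^2. \<Prod>b\<in>Basis. (\<lambda>b t. complex_of_real ((1 + \<bar>t\<bar>) powr (- (p / 2)))) b (x \<bullet> b))"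
    by (rule integral_lborel_prod(2)) (use integrable_inverse_power_real[of "p / 2"] assms in auto)
  from integrable_norm[OF this]
  show "integrable lborel (\<lambda>x::real^2. \<Prod>b\<in>Basis. (1 + \<bar>x \<bullet> b\<bar>) powr (- (p / 2)))"
    by (simp add: prod_norm[symmetric])
  show "AE x in lborel. norm ((1 + norm (x::real^2)) powr (- p)) \<le> norm (\<Prod>b\<in>Basis. (1 + \<bar>x \<bullet> b\<bar>) powr (- (p / 2)))"
  proof (intro AE_I2)
    fix x :: "real^2"
    have "(1 + norm x) powr (- p) = (\<Prod>b\<in>(Basis::(real^2) set). (1 + norm x) powr (- (p / 2)))"
      by (simp add: power2_eq_square powr_add[symmetric])
    also have "\<dots> \<le> (\<Prod>b\<in>Basis. (1 + \<bar>x \<bullet> b\<bar>) powr (- (p / 2)))"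
      using assms by (intro prod_mono) (auto intro!: powr_mono2' Basis_le_norm)
    finally show "norm ((1 + norm x) powr (- p)) \<le> norm (\<Prod>b\<in>Basis. (1 + \<bar>x \<bullet> b\<bar>) powr (- (p / 2)))"
      by (simp add: prod_nonneg)
  qed
qed measurable

text \<open>Decay of order k + 3 leaves three powers after the weight, one more than the dimension.
  The squared version follows because decay of order 0 is boundedness.\<close>

lemma fast_decay_integrable:
  assumes [measurable]: "\<psi> \<in> borel_measurable borel" and "fast_decay \<psi>"
  shows "integrable lborel (\<lambda>x. (1 + norm x) ^ k * \<bar>\<psi> x\<bar>)" (is ?A)
    and "integrable lborel (\<lambda>x. (1 + norm x) ^ k * (\<psi> x)\<^sup>2)" (is ?B)
proof -
  obtain C where C: "\<And>x. \<bar>\<psi> x\<bar> \<le> C / (1 + norm x) ^ (k + 3)"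
    using assms(2) unfolding fast_decay_def by blast
  obtain C0 where C0: "\<And>x. \<bar>\<psi> x\<bar> \<le> C0"
    using assms(2) unfolding fast_decay_def by (metis div_by_1 power_0)
  show A: ?A
  proof (rule Bochner_Integration.integrable_bound)
    show "integrable lborel (\<lambda>x::real^2. C * (1 + norm x) powr (- 3))"
      by (intro integrable_mult_right integrable_inverse_power) simp
    show "AE x in lborel. norm ((1 + norm x) ^ k * \<bar>\<psi> x\<bar>) \<le> norm (C * (1 + norm x) powr (- 3))"
    proof (intro AE_I2)
      fix x
      have "(1 + norm x) ^ k * \<bar>\<psi> x\<bar> \<le> (1 + norm x) ^ k * (C / (1 + norm x) ^ (k + 3))"
        by (intro mult_left_mono C) simp
      also have "\<dots> = C * (1 + norm x) powr (- 3)"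
        using norm_ge_zero[of x]
        by (simp add: powr_minus power_add divide_inverse add_nonneg_eq_0_iff)
      also have "\<dots> \<le> \<bar>C\<bar> * (1 + norm x) powr (- 3)"
        by (intro mult_right_mono) auto
      finally show "norm ((1 + norm x) ^ k * \<bar>\<psi> x\<bar>) \<le> norm (C * (1 + norm x) powr (- 3))"
        by (simp add: abs_mult)
    qed
  qed measurable
  show ?B
  proof (rule Bochner_Integration.integrable_bound)
    show "integrable lborel (\<lambda>x. C0 * ((1 + norm x) ^ k * \<bar>\<psi> x\<bar>))"
      by (intro integrable_mult_right A)
    show "AE x in lborel. norm ((1 + norm x) ^ k * (\<psi> x)\<^sup>2) \<le> norm (C0 * ((1 + norm x) ^ k * \<bar>\<psi> x\<bar>))"
    proof (intro AE_I2)
      fix x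
      have "(\<psi> x)\<^sup>2 \<le> C0 * \<bar>\<psi> x\<bar>"
        using mult_right_mono[OF C0[of x], of "\<bar>\<psi> x\<bar>"] by (simp add: power2_eq_square flip: abs_mult)
      then have "(1 + norm x) ^ k * (\<psi> x)\<^sup>2 \<le> (1 + norm x) ^ k * (C0 * \<bar>\<psi> x\<bar>)"
        by (intro mult_left_mono) auto
      then show "norm ((1 + norm x) ^ k * (\<psi> x)\<^sup>2) \<le> norm (C0 * ((1 + norm x) ^ k * \<bar>\<psi> x\<bar>))"
        using order_trans[OF abs_ge_zero C0[of 0]] by (simp add: abs_mult mult.left_commute)
    qed
  qed measurable
qed

section \<open>The transform of the wavelet near the origin\<close>

text \<open>Factor out the phase of b: what remains is a second order Taylor remainder in a - b and
  the product of a - b with 1 - exp (- i b). Compared with a plain Lipschitz bound the factor |a| +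
  |b| is gained, at the price of the linear correction on the left.\<close>

lemma exp_second_order_bound:
  fixes a b :: real
  shows "cmod (exp (- (\<i> * complex_of_real a)) - exp (- (\<i> * complex_of_real b)) + \<i> * complex_of_real (a - b))
    \<le> 2 * \<bar>a - b\<bar> * (\<bar>a\<bar> + \<bar>b\<bar>)"
proof -
  define d where "d = a - b"
  have e: "exp (- (\<i> * complex_of_real x)) = iexp (- x)" for x by simp
  have "iexp (- a) = iexp (- b) * iexp (- d)"
    by (simp add: d_def algebra_simps flip: exp_add)
  then have "exp (- (\<i> * complex_of_real a)) - exp (- (\<i> * complex_of_real b)) + \<i> * complex_of_real (a - b)
     = iexp (- b) * (iexp (- d) - (1 + \<i> * complex_of_real (- d))) + \<i> * complex_of_real d * (1 - iexp (- b))"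
    unfolding e d_def[symmetric] by (simp add: algebra_simps)
  also have "cmod \<dots> \<le> \<bar>d\<bar>\<^sup>2 / 2 + \<bar>d\<bar> * \<bar>b\<bar>"
  proof (rule norm_triangle_le, intro add_mono)
    show "cmod (iexp (- b) * (iexp (- d) - (1 + \<i> * complex_of_real (- d)))) \<le> \<bar>d\<bar>\<^sup>2 / 2"
      using iexp_approx1[of "- d" 1] by (simp add: norm_mult numeral_2_eq_2)
    have "cmod (1 - iexp (- b)) \<le> \<bar>b\<bar>"
      using iexp_approx1[of "- b" 0] by (simp add: norm_minus_commute)
    then show "cmod (\<i> * complex_of_real d * (1 - iexp (- b))) \<le> \<bar>d\<bar> * \<bar>b\<bar>"
      by (simp add: norm_mult mult_left_mono)
  qed
  also have "\<dots> = \<bar>d\<bar> * (\<bar>d\<bar> / 2 + \<bar>b\<bar>)" by (simp add: power2_eq_square algebra_simps)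
  also have "\<dots> \<le> \<bar>d\<bar> * (2 * (\<bar>a\<bar> + \<bar>b\<bar>))"
    by (intro mult_left_mono) (auto simp: d_def)
  finally show ?thesis unfolding d_def by (simp only: mult.assoc mult.left_commute)
qed

text \<open>The vanishing moments make the linear correction of
  \<open>exp_second_order_bound\<close> free of charge. The resulting Lipschitz constant is small
  near the origin, and this is what later compensates the singularities 1 / |xi| and 1 / |xi|^2 of
  differences of the direction; \<eta> = 0 gives the quadratic bound.\<close>

lemma fourier_zero_moments_lipschitz:
  assumes [measurable]: "\<psi> \<in> borel_measurable borel" and dec: "fast_decay \<psi>" and "zero_moments 2 \<psi>"
  obtains C where "0 \<le> C"
    "\<And>\<xi> \<eta>. cmod (fourier (\<lambda>x. complex_of_real (\<psi> x)) \<xi> - fourier (\<lambda>x. complex_of_real (\<psi> x)) \<eta>)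
       \<le> C * norm (\<xi> - \<eta>) * (norm \<xi> + norm \<eta>)"
    "\<And>\<xi>. cmod (fourier (\<lambda>x. complex_of_real (\<psi> x)) \<xi>) \<le> C * (norm \<xi>)\<^sup>2"
proof -
  let ?F = "fourier (\<lambda>x. complex_of_real (\<psi> x))"
  have m0: "(LINT x|lborel. \<psi> x) = 0"
    using assms(3)[unfolded zero_moments_def, rule_format, of "\<lambda>_. 0"] by simp
  have m1: "(LINT x|lborel. x $ l * \<psi> x) = 0" for l
  proof -
    have "(\<Sum>i\<in>UNIV. (if i = l then 1 else 0 :: nat)) < 2" by simp
    from assms(3)[unfolded zero_moments_def, rule_format, OF this]
    have "(LINT x|lborel. (\<Prod>i\<in>UNIV. (x $ i) ^ (if i = l then 1 else 0)) * \<psi> x) = 0" .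
    also have "(\<lambda>x::real^2. (\<Prod>i\<in>UNIV. (x $ i) ^ (if i = l then 1 else 0))) = (\<lambda>x. x $ l)"
      by (intro ext) (simp add: if_distrib[of "\<lambda>k. _ ^ k"] cong: if_cong)
    finally show ?thesis by (simp only:)
  qed
  have i0: "integrable lborel \<psi>"
    using fast_decay_integrable(1)[OF assms(1) dec, of 0] by (simp add: integrable_iff_bounded)
  have i2: "integrable lborel (\<lambda>x. (1 + norm x)\<^sup>2 * \<bar>\<psi> x\<bar>)"
    by (rule fast_decay_integrable(1)[OF assms(1) dec])
  have i1: "integrable lborel (\<lambda>x. x $ l * \<psi> x)" for l
  proof (rule Bochner_Integration.integrable_bound[OF i2])
    show "AE x in lborel. norm (x $ l * \<psi> x) \<le> norm ((1 + norm x)\<^sup>2 * \<bar>\<psi> x\<bar>)"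
    proof (intro AE_I2)
      fix x :: "real^2"
      have "\<bar>x $ l\<bar> \<le> (1 + norm x)\<^sup>2"
        using component_le_norm_cart[of x l] zero_le_power2[of "norm x"] norm_ge_zero[of x]
        unfolding power2_sum one_power2 mult_1_right by linarith
      then show "norm (x $ l * \<psi> x) \<le> norm ((1 + norm x)\<^sup>2 * \<bar>\<psi> x\<bar>)"
        by (simp add: abs_mult mult_right_mono)
    qed
  qed measurable
  have xv: "x \<bullet> v = (\<Sum>l\<in>UNIV. v $ l * x $ l)" for x v :: "real^2"
    by (simp add: inner_vec_def mult.commute)
  have iv: "integrable lborel (\<lambda>x. (x \<bullet> v) * \<psi> x)" and mv: "(LINT x|lborel. (x \<bullet> v) * \<psi> x) = 0" for v
  proof -
    have eq: "(x \<bullet> v) * \<psi> x = (\<Sum>l\<in>UNIV. v $ l * (x $ l * \<psi> x))" for x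
      unfolding xv sum_distrib_right by (simp add: mult.assoc)
    show "integrable lborel (\<lambda>x. (x \<bullet> v) * \<psi> x)" unfolding eq using i1 by simp
    show "(LINT x|lborel. (x \<bullet> v) * \<psi> x) = 0" unfolding eq using i1 m1 by simp
  qed
  define M where "M = (LINT x|lborel. (1 + norm x)\<^sup>2 * \<bar>\<psi> x\<bar>)"
  have M: "0 \<le> M" unfolding M_def by (rule integral_nonneg_AE) auto
  have main: "cmod (?F \<xi> - ?F \<eta>) \<le> 2 * M * norm (\<xi> - \<eta>) * (norm \<xi> + norm \<eta>)" for \<xi> \<eta>
  proof -
    let ?E = "\<lambda>x. exp (- (\<i> * complex_of_real (x \<bullet> \<xi>))) - exp (- (\<i> * complex_of_real (x \<bullet> \<eta>))) + \<i> * complex_of_real (x \<bullet> \<xi> - x \<bullet> \<eta>)"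
    note ie = fourier_integrand_integrable[of "\<lambda>x. complex_of_real (\<psi> x)"]
    \<comment> \<open>The correction term integrates to a combination of first moments, so the
      integral against \<open>?E\<close> is just the difference of the two transforms.\<close>
    have "(LINT x|lborel. complex_of_real (\<psi> x) * ?E x) = (LINT x|lborel.
       complex_of_real (\<psi> x) * exp (- (\<i> * complex_of_real (x \<bullet> \<xi>))) - complex_of_real (\<psi> x) * exp (- (\<i> * complex_of_real (x \<bullet> \<eta>)))
         + \<i> * complex_of_real ((x \<bullet> (\<xi> - \<eta>)) * \<psi> x))"
      by (intro Bochner_Integration.integral_cong refl) (simp add: algebra_simps inner_diff_right)
    also have "\<dots> = (LINT x|lborel. complex_of_real (\<psi> x) * exp (- (\<i> * complex_of_real (x \<bullet> \<xi>))) - complex_of_real (\<psi> x) * exp (- (\<i> * complex_of_real (x \<bullet> \<eta>))))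
      + (LINT x|lborel. \<i> * complex_of_real ((x \<bullet> (\<xi> - \<eta>)) * \<psi> x))"
      by (intro Bochner_Integration.integral_add Bochner_Integration.integrable_diff ie integrable_mult_right integrable_of_real iv i0)
    also have "(LINT x|lborel. \<i> * complex_of_real ((x \<bullet> (\<xi> - \<eta>)) * \<psi> x)) = 0"
      unfolding integral_mult_right_zero integral_complex_of_real mv by simp
    also have "(LINT x|lborel. complex_of_real (\<psi> x) * exp (- (\<i> * complex_of_real (x \<bullet> \<xi>))) - complex_of_real (\<psi> x) * exp (- (\<i> * complex_of_real (x \<bullet> \<eta>))))
      = ?F \<xi> - ?F \<eta>"
      unfolding fourier_def
      by (intro Bochner_Integration.integral_diff ie integrable_of_real i0)
    finally have "cmod (?F \<xi> - ?F \<eta>) = cmod (LINT x|lborel. complex_of_real (\<psi> x) * ?E x)" by simp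
    also have "\<dots> \<le> (LINT x|lborel. 2 * norm (\<xi> - \<eta>) * (norm \<xi> + norm \<eta>) * ((1 + norm x)\<^sup>2 * \<bar>\<psi> x\<bar>))"
    proof (rule order_trans[OF integral_norm_bound], rule integral_mono_AE')
      show "integrable lborel (\<lambda>x. 2 * norm (\<xi> - \<eta>) * (norm \<xi> + norm \<eta>) * ((1 + norm x)\<^sup>2 * \<bar>\<psi> x\<bar>))"
        by (intro integrable_mult_right i2)
      show "AE x in lborel. norm (complex_of_real (\<psi> x) * ?E x) \<le> 2 * norm (\<xi> - \<eta>) * (norm \<xi> + norm \<eta>) * ((1 + norm x)\<^sup>2 * \<bar>\<psi> x\<bar>)"
      proof (intro AE_I2)
        fix x :: "real^2"
        have "cmod (?E x) \<le> 2 * \<bar>x \<bullet> \<xi> - x \<bullet> \<eta>\<bar> * (\<bar>x \<bullet> \<xi>\<bar> + \<bar>x \<bullet> \<eta>\<bar>)"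
          by (rule exp_second_order_bound)
        also have "\<dots> \<le> 2 * (norm x * norm (\<xi> - \<eta>)) * (norm x * norm \<xi> + norm x * norm \<eta>)"
          unfolding inner_diff_right[symmetric]
          by (intro mult_mono add_mono Cauchy_Schwarz_ineq2) auto
        also have "\<dots> = 2 * norm (\<xi> - \<eta>) * (norm \<xi> + norm \<eta>) * (norm x)\<^sup>2"
          by (simp add: power2_eq_square algebra_simps)
        also have "\<dots> \<le> 2 * norm (\<xi> - \<eta>) * (norm \<xi> + norm \<eta>) * (1 + norm x)\<^sup>2"
          by (intro mult_left_mono power_mono) auto
        finally have "\<bar>\<psi> x\<bar> * cmod (?E x) \<le> \<bar>\<psi> x\<bar> * \<dots>" by (intro mult_left_mono) auto
        then show "norm (complex_of_real (\<psi> x) * ?E x) \<le> 2 * norm (\<xi> - \<eta>) * (norm \<xi> + norm \<eta>) * ((1 + norm x)\<^sup>2 * \<bar>\<psi> x\<bar>)"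
          by (simp add: norm_mult mult_ac)
      qed
    qed auto
    finally show ?thesis
      unfolding integral_mult_right_zero M_def[symmetric] by (simp only: mult_ac)
  qed
  have F0: "?F 0 = 0"
    using m0 by (simp add: fourier_def)
  show thesis
  proof (rule that[of "2 * M"])
    show "cmod (?F \<xi>) \<le> 2 * M * (norm \<xi>)\<^sup>2" for \<xi>
      using main[of \<xi> 0] by (simp add: F0 power2_eq_square mult.assoc)
  qed (use M main in auto)
qed

section \<open>Differences of the direction and of the Riesz symbol\<close>

text \<open>The Riesz multiplier without its factor -i. Division by zero gives it the value 0 at the
  origin, so that it is bounded by 1 everywhere.\<close>

definition direction :: "2 \<Rightarrow> real^2 \<Rightarrow> real" where
  "direction l \<xi> = \<xi> $ l / norm \<xi>"

lemma direction_measurable [measurable]: "direction l \<in> borel_measurable borel"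
  unfolding direction_def by measurable

lemma direction_le_1: "\<bar>direction l \<xi>\<bar> \<le> 1"
  using component_le_norm_cart[of \<xi> l] by (auto simp: direction_def divide_le_eq)

text \<open>The factor norm \<eta> cancels from the common denominator, so the bound does not
  deteriorate when \<eta> approaches the origin.\<close>

lemma direction_diff_le:
  assumes "\<xi> \<noteq> 0"
  shows "\<bar>direction l \<xi> - direction l \<eta>\<bar> \<le> 2 * norm (\<xi> - \<eta>) / norm \<xi>"
proof (cases "\<eta> = 0")
  case True
  then show ?thesis using direction_le_1[of l \<xi>] assms by (simp add: direction_def[of l 0])
next
  case False
  have "direction l \<xi> - direction l \<eta> = ((\<xi> - \<eta>) $ l * norm \<eta> + \<eta> $ l * (norm \<eta> - norm \<xi>)) / (norm \<xi> * norm \<eta>)"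
    using assms False by (simp add: direction_def field_simps)
  also have "\<bar>\<dots>\<bar> \<le> (norm (\<xi> - \<eta>) * norm \<eta> + norm \<eta> * norm (\<xi> - \<eta>)) / (norm \<xi> * norm \<eta>)"
    unfolding abs_divide abs_mult abs_norm_cancel
  proof (intro divide_right_mono order_trans[OF abs_triangle_ineq] add_mono)
    show "\<bar>(\<xi> - \<eta>) $ l * norm \<eta>\<bar> \<le> norm (\<xi> - \<eta>) * norm \<eta>"
      unfolding abs_mult by (intro mult_mono component_le_norm_cart) auto
    show "\<bar>\<eta> $ l * (norm \<eta> - norm \<xi>)\<bar> \<le> norm \<eta> * norm (\<xi> - \<eta>)"
      unfolding abs_mult using norm_triangle_ineq3[of \<eta> \<xi>]
      by (intro mult_mono component_le_norm_cart) (auto simp: norm_minus_commute)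
  qed auto
  also have "\<dots> = 2 * norm (\<xi> - \<eta>) / norm \<xi>" using assms False by (simp add: field_simps)
  finally show ?thesis .
qed

text \<open>By the parallelogram identity, second differences of the norm are quadratically small.\<close>
lemma direction_second_difference_le:
  assumes "\<xi> \<noteq> 0"
  shows "\<bar>direction l (\<xi> - 2 *\<^sub>R h) - 2 * direction l (\<xi> - h) + direction l \<xi>\<bar> \<le> 64 * (norm h)\<^sup>2 / (norm \<xi>)\<^sup>2"
proof (cases "norm \<xi> \<le> 4 * norm h")
  case True
  have "\<bar>direction l (\<xi> - 2 *\<^sub>R h) - 2 * direction l (\<xi> - h) + direction l \<xi>\<bar> \<le> 4"
    using direction_le_1[of l \<xi>] direction_le_1[of l "\<xi> - h"] direction_le_1[of l "\<xi> - 2 *\<^sub>R h"] by linarith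
  \<comment> \<open>At distance comparable to the step there is no cancellation; the constant 64 is
    large enough for the trivial bound 4 to have the required form.\<close>
  also have "4 \<le> 64 * (norm h)\<^sup>2 / (norm \<xi>)\<^sup>2"
    using power_mono[OF True norm_ge_zero, of 2] assms by (simp add: field_simps)
  finally show ?thesis .
next
  case False
  define t where "t = norm h"
  define n0 where "n0 = norm \<xi>"
  define n1 where "n1 = norm (\<xi> - h)"
  define n2 where "n2 = norm (\<xi> - 2 *\<^sub>R h)"
  define x1 where "x1 = (\<xi> - h) $ l"
  define d where "d = h $ l"
  have t: "0 \<le> t" "4 * t < n0" using False by (auto simp: t_def n0_def)
  have x1: "\<bar>x1\<bar> \<le> n1" and d: "\<bar>d\<bar> \<le> t" unfolding x1_def d_def n1_def t_def by (rule component_le_norm_cart)+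
  have n2: "\<bar>n0 - n2\<bar> \<le> 2 * t"
    using norm_triangle_ineq3[of \<xi> "\<xi> - 2 *\<^sub>R h"] by (simp add: n0_def n2_def t_def)
  have n1: "n0 - t \<le> n1" using norm_triangle_ineq2[of \<xi> h] by (simp add: n0_def n1_def t_def)
  have pos: "0 < n0" "0 < n1" "n0 / 2 \<le> n2" "0 < n2" using t n1 n2 by linarith+
  have par: "n0\<^sup>2 + n2\<^sup>2 = 2 * n1\<^sup>2 + 2 * t\<^sup>2"
    unfolding n0_def n1_def n2_def t_def power2_norm_eq_inner
    by (simp add: inner_diff_left inner_diff_right inner_commute algebra_simps)
  have q: "(n0 + n2)\<^sup>2 - (2 * n1)\<^sup>2 = 4 * t\<^sup>2 - (n0 - n2)\<^sup>2"
    using par by (simp add: power2_eq_square algebra_simps)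
  have sq: "(n0 - n2)\<^sup>2 \<le> 4 * t\<^sup>2"
    using power_mono[OF n2, of 2] by (simp add: power_mult_distrib)
  have "2 * n1 \<le> n0 + n2"
    using q sq pos by (intro power2_le_imp_le[of "2 * n1"]) auto
  have "(n0 + n2) * (n0 + n2 - 2 * n1) \<le> (n0 + n2 + 2 * n1) * (n0 + n2 - 2 * n1)"
    using \<open>2 * n1 \<le> n0 + n2\<close> pos by (intro mult_right_mono) auto
  also have "\<dots> = (n0 + n2)\<^sup>2 - (2 * n1)\<^sup>2" by (simp add: power2_eq_square algebra_simps)
  also have "\<dots> \<le> 4 * t\<^sup>2" using q by simp
  finally have b1: "(n0 + n2) * (n0 + n2 - 2 * n1) \<le> 4 * t\<^sup>2" .
  have b0: "0 \<le> (n0 + n2) * (n0 + n2 - 2 * n1)"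
    using \<open>2 * n1 \<le> n0 + n2\<close> pos by simp
  \<comment> \<open>The numerator of 1 / n2 - 2 / n1 + 1 / n0, rewritten so that both parts are
    visibly of order t^2: the first by the triangle inequality, the second by
    \<open>b1\<close>.\<close>
  have num: "n1 * (n0 + n2) - 2 * n0 * n2 = (n0 - n2)\<^sup>2 / 2 - (n0 + n2) * (n0 + n2 - 2 * n1) / 2"
    by (simp add: power2_eq_square field_simps)
  have "\<bar>n1 * (n0 + n2) - 2 * n0 * n2\<bar> \<le> 4 * t\<^sup>2"
    unfolding num using b0 b1 sq zero_le_power2[of "n0 - n2"] by linarith
  then have A: "\<bar>1 / n2 - 2 / n1 + 1 / n0\<bar> \<le> 4 * t\<^sup>2 / (n0 * n1 * n2)"
  proof -
    have "1 / n2 - 2 / n1 + 1 / n0 = (n1 * (n0 + n2) - 2 * n0 * n2) / (n0 * n1 * n2)"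
      using pos by (simp add: field_simps)
    then show ?thesis using pos \<open>\<bar>_\<bar> \<le> 4 * t\<^sup>2\<close> by (simp add: abs_mult divide_right_mono)
  qed
  have B: "\<bar>1 / n2 - 1 / n0\<bar> \<le> 2 * t / (n0 * n2)"
  proof -
    have "1 / n2 - 1 / n0 = (n0 - n2) / (n0 * n2)" using pos by (simp add: field_simps)
    then show ?thesis using pos n2 by (simp add: abs_mult divide_right_mono)
  qed
  \<comment> \<open>The three numerators are x1 - d, x1 and x1 + d, so the expression splits into a
    second difference and a first difference of the reciprocal norms.\<close>
  have "direction l (\<xi> - 2 *\<^sub>R h) - 2 * direction l (\<xi> - h) + direction l \<xi>
      = x1 * (1 / n2 - 2 / n1 + 1 / n0) - d * (1 / n2 - 1 / n0)"
    by (simp add: direction_def n0_def n1_def n2_def x1_def d_def algebra_simps diff_divide_distrib add_divide_distrib)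
  also have "\<bar>\<dots>\<bar> \<le> n1 * (4 * t\<^sup>2 / (n0 * n1 * n2)) + t * (2 * t / (n0 * n2))"
    by (rule order_trans[OF abs_triangle_ineq4], unfold abs_mult, intro add_mono mult_mono A B x1 d)
       (use pos t in auto)
  also have "\<dots> = 6 * t\<^sup>2 / n0 * (1 / n2)" using pos by (simp add: field_simps power2_eq_square)
  also have "\<dots> \<le> 6 * t\<^sup>2 / n0 * (2 / n0)"
    using pos by (intro mult_left_mono) (auto simp: field_simps)
  also have "\<dots> \<le> 64 * t\<^sup>2 / n0\<^sup>2" using pos by (simp add: power2_eq_square divide_right_mono)
  finally show ?thesis by (simp add: t_def n0_def)
qed

lemma fourier_modulation:
  "fourier (\<lambda>x. exp (\<i> * complex_of_real (x \<bullet> h)) * u x) \<xi> = fourier u (\<xi> - h)"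
  unfolding fourier_def
  by (intro Bochner_Integration.integral_cong refl)
     (simp add: inner_diff_right algebra_simps exp_add[symmetric] exp_diff exp_minus divide_inverse)

lemma l2n_sum4:
  assumes [measurable]: "a \<in> borel_measurable borel" "b \<in> borel_measurable borel"
    "c \<in> borel_measurable borel" "d \<in> borel_measurable borel"
    and "\<And>x. cmod (f x) \<le> cmod (a x) + cmod (b x) + cmod (c x) + cmod (d x)"
  shows "l2n f \<le> 4 * (l2n a + l2n b + l2n c + l2n d)"
proof -
  have "l2n f \<le> (\<integral>\<^sup>+x. 4 * (ennreal ((cmod (a x))\<^sup>2) + ennreal ((cmod (b x))\<^sup>2) + ennreal ((cmod (c x))\<^sup>2) + ennreal ((cmod (d x))\<^sup>2)) \<partial>lborel)"
    unfolding l2n_def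
  proof (rule nn_integral_mono)
    fix x
    have "(p + q + r + s)\<^sup>2 \<le> 4 * (p\<^sup>2 + q\<^sup>2 + r\<^sup>2 + s\<^sup>2)" for p q r s :: real
    proof -
      have "4 * (p\<^sup>2 + q\<^sup>2 + r\<^sup>2 + s\<^sup>2) - (p + q + r + s)\<^sup>2
        = (p - q)\<^sup>2 + (p - r)\<^sup>2 + (p - s)\<^sup>2 + (q - r)\<^sup>2 + (q - s)\<^sup>2 + (r - s)\<^sup>2"
        by (simp add: power2_eq_square algebra_simps)
      also have "\<dots> \<ge> 0" by (intro add_nonneg_nonneg) auto
      finally show ?thesis by simp
    qed
    then have "(cmod (f x))\<^sup>2 \<le> 4 * ((cmod (a x))\<^sup>2 + (cmod (b x))\<^sup>2 + (cmod (c x))\<^sup>2 + (cmod (d x))\<^sup>2)"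
      using power_mono[OF assms(5)[of x] norm_ge_zero, of 2] by (meson order_trans)
    then have "ennreal ((cmod (f x))\<^sup>2) \<le> ennreal (4 * ((cmod (a x))\<^sup>2 + (cmod (b x))\<^sup>2 + (cmod (c x))\<^sup>2 + (cmod (d x))\<^sup>2))"
      by (rule ennreal_leI)
    then show "ennreal ((cmod (f x))\<^sup>2) \<le> 4 * (ennreal ((cmod (a x))\<^sup>2) + ennreal ((cmod (b x))\<^sup>2) + ennreal ((cmod (c x))\<^sup>2) + ennreal ((cmod (d x))\<^sup>2))"
      by (simp add: ennreal_mult)
  qed
  then show ?thesis
    by (simp add: nn_integral_cmult nn_integral_add l2n_def)
qed

lemma iexp_minus_1_le: "cmod (exp (\<i> * complex_of_real t) - 1) \<le> \<bar>t\<bar>"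
  using iexp_approx1[of t 0] by simp

text \<open>Differences in frequency are multiplications by small phases in space, each costing a
  factor |x|. The weight of order 2 leaves room for two of them, and Plancherel turns the pointwise
  bound into a bound on the transform.\<close>

lemma l2n_fourier_weighted:
  fixes \<psi> :: "real^2 \<Rightarrow> real"
  assumes \<psi>: "\<psi> \<in> borel_measurable borel" "fast_decay \<psi>"
    and [measurable]: "u \<in> borel_measurable borel"
    and "0 \<le> c" and le: "\<And>x. cmod (u x) \<le> c * ((1 + norm x)\<^sup>2 * \<bar>\<psi> x\<bar>)"
  shows "l2n (fourier u) \<le> ennreal (4 * pi\<^sup>2 * (c\<^sup>2 * (LINT x|lborel. (1 + norm x) ^ 4 * (\<psi> x)\<^sup>2)))"
    and "integrable lborel u" and "square_integrable u"
proof -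
  note [measurable] = \<psi>(1)
  note i4 = fast_decay_integrable(2)[OF \<psi>, of 4]
  show iu: "integrable lborel u"
    by (rule Bochner_Integration.integrable_bound[OF integrable_mult_right[OF fast_decay_integrable(1)[OF \<psi>, of 2], of c]])
       (use le assms(4) in \<open>auto simp: abs_mult\<close>)
  have sq: "(cmod (u x))\<^sup>2 \<le> c\<^sup>2 * ((1 + norm x) ^ 4 * (\<psi> x)\<^sup>2)" for x
    using power_mono[OF le[of x] norm_ge_zero, of 2]
    by (simp add: power_mult_distrib flip: power_mult)
  have "l2n u \<le> (\<integral>\<^sup>+x. ennreal (c\<^sup>2 * ((1 + norm x) ^ 4 * (\<psi> x)\<^sup>2)) \<partial>lborel)"
    unfolding l2n_def by (intro nn_integral_mono ennreal_leI sq)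
  also have "\<dots> = ennreal (c\<^sup>2 * (LINT x|lborel. (1 + norm x) ^ 4 * (\<psi> x)\<^sup>2))"
    using i4 by (subst nn_integral_eq_integral) auto
  finally have *: "l2n u \<le> \<dots>" .
  then show "square_integrable u" by (auto simp: square_integrable_iff_l2n le_less_trans)
  have "l2n (fourier u) = ennreal (4 * pi\<^sup>2) * l2n u"
    using * by (intro plancherel iu) (auto intro: le_less_trans)
  also have "\<dots> \<le> ennreal (4 * pi\<^sup>2) * ennreal (c\<^sup>2 * (LINT x|lborel. (1 + norm x) ^ 4 * (\<psi> x)\<^sup>2))"
    by (intro mult_left_mono *) auto
  also have "\<dots> = ennreal (4 * pi\<^sup>2 * (c\<^sup>2 * (LINT x|lborel. (1 + norm x) ^ 4 * (\<psi> x)\<^sup>2)))"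
    by (rule ennreal_mult'[symmetric]) simp
  finally show "l2n (fourier u) \<le> \<dots>" .
qed

definition riesz_symbol :: "2 \<Rightarrow> (real^2 \<Rightarrow> real) \<Rightarrow> real^2 \<Rightarrow> complex" where
  "riesz_symbol l \<psi> \<xi> = - \<i> * complex_of_real (direction l \<xi>) * fourier (\<lambda>x. complex_of_real (\<psi> x)) \<xi>"

lemma riesz_symbol_le: "cmod (riesz_symbol l \<psi> \<xi>) \<le> cmod (fourier (\<lambda>x. complex_of_real (\<psi> x)) \<xi>)"
  using direction_le_1[of l \<xi>] by (simp add: riesz_symbol_def norm_mult mult_left_le_one_le)

lemma riesz_symbol_measurable [measurable]:
  assumes [measurable]: "\<psi> \<in> borel_measurable borel"
  shows "riesz_symbol l \<psi> \<in> borel_measurable borel"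
  unfolding riesz_symbol_def by measurable

text \<open>The discrete Leibniz rule: m times the second difference of p, twice the product of
  first differences, and the second difference of m times p.\<close>

lemma leibniz_second_difference_le:
  fixes m0 m1 m2 :: real and p0 p1 p2 :: complex
  shows "cmod (complex_of_real m2 * p2 - 2 * (complex_of_real m1 * p1) + complex_of_real m0 * p0)
    \<le> \<bar>m0\<bar> * cmod (p2 - 2 * p1 + p0) + 2 * (\<bar>m0 - m1\<bar> * cmod (p2 - p1)) + \<bar>m2 - 2 * m1 + m0\<bar> * cmod p2"
proof -
  have "complex_of_real m2 * p2 - 2 * (complex_of_real m1 * p1) + complex_of_real m0 * p0
    = complex_of_real m0 * (p2 - 2 * p1 + p0) + 2 * (complex_of_real (m1 - m0) * (p2 - p1))
      + complex_of_real (m2 - 2 * m1 + m0) * p2"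
    by (simp add: algebra_simps)
  also have "cmod \<dots> \<le> cmod (complex_of_real m0 * (p2 - 2 * p1 + p0)) + cmod (2 * (complex_of_real (m1 - m0) * (p2 - p1)))
      + cmod (complex_of_real (m2 - 2 * m1 + m0) * p2)"
    by (intro norm_triangle_le add_mono) auto
  finally show ?thesis
    by (simp only: norm_mult norm_of_real norm_numeral abs_minus_commute[of m1])
qed

text \<open>The discrete Leibniz rule is estimated in two regions. Outside the unit ball the
  differences of the direction are of order t and t^2 and those of the transform are controlled in
  L2. Inside, pointwise bounds on the transform cancel the singularities of the direction and leave
  O(t^2) on a set of finite measure.\<close>

lemma riesz_symbol_second_difference:
  assumes \<psi>: "\<psi> \<in> borel_measurable borel" "fast_decay \<psi>" "zero_moments 2 \<psi>"
  shows "\<exists>K\<ge>0. \<forall>h. l2n (\<lambda>\<xi>. riesz_symbol l \<psi> (\<xi> - 2 *\<^sub>R h) - 2 * riesz_symbol l \<psi> (\<xi> - h) + riesz_symbol l \<psi> \<xi>)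
     \<le> ennreal (K * norm h ^ 4)"
proof -
  note [measurable] = \<psi>(1)
  define u where "u x = complex_of_real (\<psi> x)" for x
  define P where "P = fourier u"
  have [measurable]: "u \<in> borel_measurable borel" "P \<in> borel_measurable borel"
    unfolding u_def P_def by measurable
  obtain C where C: "0 \<le> C" "\<And>\<xi> \<eta>. cmod (P \<xi> - P \<eta>) \<le> C * norm (\<xi> - \<eta>) * (norm \<xi> + norm \<eta>)"
      "\<And>\<xi>. cmod (P \<xi>) \<le> C * (norm \<xi>)\<^sup>2"
    using fourier_zero_moments_lipschitz[OF \<psi>] unfolding P_def u_def by blast
  define M where "M = (LINT x|lborel. (1 + norm x) ^ 4 * (\<psi> x)\<^sup>2)"
  have M: "0 \<le> M" unfolding M_def by (rule integral_nonneg_AE) auto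
  define V where "V = measure lborel (ball (0::real^2) 1)"
  \<comment> \<open>The leading 4 comes from \<open>l2n_sum4\<close>; 16, 4096 and 600^2 are the
    squares of the coefficients 4, 64 and 600 in the pointwise bound \<open>pt\<close>.\<close>
  define K where "K = 4 * (4 * pi\<^sup>2 * M + 16 * (4 * pi\<^sup>2 * M) + 4096 * (4 * pi\<^sup>2 * M) + (600 * C)\<^sup>2 * V)"
  have V: "0 \<le> V" by (simp add: V_def)
  have [measurable]: "ball (0::real^2) 1 \<in> sets borel" by (rule borel_open) simp
  have Kp: "0 \<le> K" unfolding K_def using M C V by (intro mult_nonneg_nonneg add_nonneg_nonneg) auto
  have w1: "1 \<le> (1 + norm x)\<^sup>2" "norm x \<le> (1 + norm x)\<^sup>2" "(norm x)\<^sup>2 \<le> (1 + norm x)\<^sup>2" for x :: "real^2"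
    using norm_ge_zero[of x] zero_le_power2[of "norm x"] unfolding power2_sum one_power2 mult_1_right by linarith+
  have "l2n (\<lambda>\<xi>. riesz_symbol l \<psi> (\<xi> - 2 *\<^sub>R h) - 2 * riesz_symbol l \<psi> (\<xi> - h) + riesz_symbol l \<psi> \<xi>) \<le> ennreal (K * norm h ^ 4)" for h
  proof -
    define t where "t = norm h"
    have t: "0 \<le> t" by (simp add: t_def)
    define e where "e x = exp (\<i> * complex_of_real (x \<bullet> h))" for x
    have [measurable]: "e \<in> borel_measurable borel" unfolding e_def by measurable
    have e: "cmod (e x) = 1" "cmod (e x - 1) \<le> t * norm x" for x
      using order_trans[OF iexp_minus_1_le Cauchy_Schwarz_ineq2[of x h]]
      by (auto simp: e_def t_def mult.commute)
    have iu: "integrable lborel u"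
      by (rule l2n_fourier_weighted(2)[OF \<psi>(1,2), of _ 1]) (use mult_right_mono[OF w1(1)] in \<open>auto simp: u_def\<close>)
    have eu: "integrable lborel (\<lambda>x. e x * v x)" if "integrable lborel v" for v
      by (rule Bochner_Integration.integrable_bound[OF that]) (use that in \<open>auto simp: norm_mult e\<close>)
    have Fe: "fourier (\<lambda>x. e x * v x) \<xi> = fourier v (\<xi> - h)" for v \<xi>
      unfolding e_def by (rule fourier_modulation)
    \<comment> \<open>Multiplication by \<open>e\<close> shifts the transform by \<open>h\<close>,
      so every factor \<open>e - 1\<close> is a difference with step \<open>h\<close>, and its bound
      t |x| measures that difference on the space side.\<close>
    have FB: "fourier (\<lambda>x. e x * ((e x - 1) * u x)) \<xi> = P (\<xi> - 2 *\<^sub>R h) - P (\<xi> - h)" for \<xi>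
    proof -
      have "fourier (\<lambda>x. (e x - 1) * u x) \<eta> = P (\<eta> - h) - P \<eta>" for \<eta>
        using fourier_diff[OF eu[OF iu] iu, of \<eta>] by (simp add: left_diff_distrib Fe P_def)
      then show ?thesis by (simp add: Fe scaleR_2 diff_diff_add)
    qed
    have FA: "fourier (\<lambda>x. (e x - 1) * ((e x - 1) * u x)) \<xi> = P (\<xi> - 2 *\<^sub>R h) - 2 * P (\<xi> - h) + P \<xi>" for \<xi>
    proof -
      have i: "integrable lborel (\<lambda>x. (e x - 1) * u x)"
        using Bochner_Integration.integrable_diff[OF eu[OF iu] iu] by (simp add: left_diff_distrib)
      have "fourier (\<lambda>x. e x * ((e x - 1) * u x) - (e x - 1) * u x) \<xi> = P (\<xi> - 2 *\<^sub>R h) - P (\<xi> - h) - fourier (\<lambda>x. (e x - 1) * u x) \<xi>"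
        by (subst fourier_diff[OF eu[OF i] i]) (simp only: FB)
      also have "fourier (\<lambda>x. (e x - 1) * u x) \<xi> = P (\<xi> - h) - P \<xi>"
        using fourier_diff[OF eu[OF iu] iu, of \<xi>] by (simp add: left_diff_distrib Fe P_def)
      finally show ?thesis by (simp add: algebra_simps)
    qed
    define A where "A \<xi> = P (\<xi> - 2 *\<^sub>R h) - 2 * P (\<xi> - h) + P \<xi>" for \<xi>
    define B where "B \<xi> = P (\<xi> - 2 *\<^sub>R h) - P (\<xi> - h)" for \<xi>
    have [measurable]: "A \<in> borel_measurable borel" "B \<in> borel_measurable borel"
      unfolding A_def B_def by measurable
    have lA: "l2n A \<le> ennreal (4 * pi\<^sup>2 * ((t\<^sup>2)\<^sup>2 * M))"
    proof -
      have "l2n (fourier (\<lambda>x. (e x - 1) * ((e x - 1) * u x))) \<le> ennreal (4 * pi\<^sup>2 * ((t\<^sup>2)\<^sup>2 * M))"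
        unfolding M_def
      proof (rule l2n_fourier_weighted(1)[OF \<psi>(1,2)])
        fix x
        have "cmod ((e x - 1) * ((e x - 1) * u x)) \<le> (t * norm x) * ((t * norm x) * \<bar>\<psi> x\<bar>)"
          unfolding norm_mult u_def norm_of_real by (intro mult_mono e) (auto simp: t)
        also have "\<dots> = t\<^sup>2 * ((norm x)\<^sup>2 * \<bar>\<psi> x\<bar>)" by (simp add: power2_eq_square)
        also have "\<dots> \<le> t\<^sup>2 * ((1 + norm x)\<^sup>2 * \<bar>\<psi> x\<bar>)" by (intro mult_left_mono mult_right_mono w1) auto
        finally show "cmod ((e x - 1) * ((e x - 1) * u x)) \<le> \<dots>" .
      qed auto
      then show ?thesis unfolding FA[abs_def] A_def .
    qed
    have lB: "l2n B \<le> ennreal (4 * pi\<^sup>2 * (t\<^sup>2 * M))"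
    proof -
      have "l2n (fourier (\<lambda>x. e x * ((e x - 1) * u x))) \<le> ennreal (4 * pi\<^sup>2 * (t\<^sup>2 * M))"
        unfolding M_def
      proof (rule l2n_fourier_weighted(1)[OF \<psi>(1,2)])
        fix x
        have "cmod (e x * ((e x - 1) * u x)) \<le> 1 * ((t * norm x) * \<bar>\<psi> x\<bar>)"
          unfolding norm_mult u_def norm_of_real by (intro mult_mono e) (auto simp: t e)
        also have "\<dots> = t * (norm x * \<bar>\<psi> x\<bar>)" by simp
        also have "\<dots> \<le> t * ((1 + norm x)\<^sup>2 * \<bar>\<psi> x\<bar>)" by (intro mult_left_mono mult_right_mono w1 t) auto
        finally show "cmod (e x * ((e x - 1) * u x)) \<le> \<dots>" .
      qed (auto simp: t)
      then show ?thesis unfolding FB[abs_def] B_def .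
    qed
    have lP: "l2n (\<lambda>\<xi>. P (\<xi> - 2 *\<^sub>R h)) \<le> ennreal (4 * pi\<^sup>2 * M)"
    proof -
      have "l2n (\<lambda>\<xi>. P (\<xi> - 2 *\<^sub>R h)) = l2n P"
        using l2n_shift[of P "- (2 *\<^sub>R h)"] by simp
      also have "\<dots> \<le> ennreal (4 * pi\<^sup>2 * (1\<^sup>2 * M))"
        unfolding M_def P_def
        by (rule l2n_fourier_weighted(1)[OF \<psi>(1,2)]) (use mult_right_mono[OF w1(1)] in \<open>auto simp: u_def\<close>)
      finally show ?thesis by simp
    qed
    have lV: "l2n (\<lambda>\<xi>::real^2. indicator (ball 0 1) \<xi>) = ennreal V"
    proof -
      have "l2n (\<lambda>\<xi>::real^2. indicator (ball 0 1) \<xi>) = (\<integral>\<^sup>+\<xi>. indicator (ball (0::real^2) 1) \<xi> \<partial>lborel)"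
        unfolding l2n_def by (intro nn_integral_cong) (auto simp: indicator_def)
      also have "\<dots> = emeasure lborel (ball (0::real^2) 1)" by simp
      also have "\<dots> = ennreal V"
        unfolding V_def by (rule emeasure_eq_ennreal_measure)
          (use emeasure_lborel_ball_finite[of "0::real^2" 1] in auto)
      finally show ?thesis .
    qed
    let ?m = "direction l"
    \<comment> \<open>The second and third terms serve the complement of the unit ball, where 1 /
      |xi| \<le> 1; the last term serves the ball, and the first is needed in both.\<close>
    have pt: "cmod (riesz_symbol l \<psi> (\<xi> - 2 *\<^sub>R h) - 2 * riesz_symbol l \<psi> (\<xi> - h) + riesz_symbol l \<psi> \<xi>)
       \<le> cmod (A \<xi>) + cmod (complex_of_real (4 * t) * B \<xi>) + cmod (complex_of_real (64 * t\<^sup>2) * P (\<xi> - 2 *\<^sub>R h))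
         + cmod (complex_of_real (600 * C * t\<^sup>2) * indicator (ball 0 1) \<xi>)" for \<xi>
    proof (cases "t = 0")
      case True
      then show ?thesis by (simp add: t_def)
    next
      case False
      then have t: "0 < t" using t by simp
      have "riesz_symbol l \<psi> (\<xi> - 2 *\<^sub>R h) - 2 * riesz_symbol l \<psi> (\<xi> - h) + riesz_symbol l \<psi> \<xi>
        = - \<i> * (complex_of_real (?m (\<xi> - 2 *\<^sub>R h)) * P (\<xi> - 2 *\<^sub>R h) - 2 * (complex_of_real (?m (\<xi> - h)) * P (\<xi> - h)) + complex_of_real (?m \<xi>) * P \<xi>)"
        by (simp add: riesz_symbol_def P_def u_def[abs_def] algebra_simps)
      then have "cmod (riesz_symbol l \<psi> (\<xi> - 2 *\<^sub>R h) - 2 * riesz_symbol l \<psi> (\<xi> - h) + riesz_symbol l \<psi> \<xi>)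
         \<le> \<bar>?m \<xi>\<bar> * cmod (A \<xi>) + 2 * (\<bar>?m \<xi> - ?m (\<xi> - h)\<bar> * cmod (B \<xi>))
           + \<bar>?m (\<xi> - 2 *\<^sub>R h) - 2 * ?m (\<xi> - h) + ?m \<xi>\<bar> * cmod (P (\<xi> - 2 *\<^sub>R h))" (is "?L \<le> _ + 2 * (?d1 * _) + ?d2 * _")
        unfolding A_def B_def using leibniz_second_difference_le by (simp add: norm_mult)
      also have "\<bar>?m \<xi>\<bar> * cmod (A \<xi>) \<le> cmod (A \<xi>)"
        using direction_le_1[of l \<xi>] by (simp add: mult_left_le_one_le)
      finally have L: "?L \<le> cmod (A \<xi>) + (2 * (?d1 * cmod (B \<xi>)) + ?d2 * cmod (P (\<xi> - 2 *\<^sub>R h)))" by simp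
      have n1: "norm (\<xi> - h) \<le> norm \<xi> + t" and n2: "norm (\<xi> - 2 *\<^sub>R h) \<le> norm \<xi> + 2 * t"
        using norm_triangle_ineq4[of \<xi> h] norm_triangle_ineq4[of \<xi> "2 *\<^sub>R h"] by (auto simp: t_def)
      have PB: "cmod (B \<xi>) \<le> C * t * (2 * norm \<xi> + 3 * t)"
      proof -
        have "cmod (B \<xi>) \<le> C * norm ((\<xi> - 2 *\<^sub>R h) - (\<xi> - h)) * (norm (\<xi> - 2 *\<^sub>R h) + norm (\<xi> - h))"
          unfolding B_def by (rule C)
        also have "norm ((\<xi> - 2 *\<^sub>R h) - (\<xi> - h)) = t"
          unfolding t_def by (simp add: scaleR_2)
        also have "C * t * (norm (\<xi> - 2 *\<^sub>R h) + norm (\<xi> - h)) \<le> C * t * (2 * norm \<xi> + 3 * t)"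
          using n1 n2 C(1) t by (intro mult_left_mono) auto
        finally show ?thesis .
      qed
      have PP: "cmod (P (\<xi> - 2 *\<^sub>R h)) \<le> C * (norm \<xi> + 2 * t)\<^sup>2"
        by (rule order_trans[OF C(3)]) (intro mult_left_mono power_mono n2 C norm_ge_zero)
      have dd: "?d1 \<le> 2" "?d2 \<le> 4"
        using direction_le_1[of l \<xi>] direction_le_1[of l "\<xi> - h"] direction_le_1[of l "\<xi> - 2 *\<^sub>R h"] by linarith+
      have d1: "?d1 \<le> 2 * t / norm \<xi>" and d2: "?d2 \<le> 64 * t\<^sup>2 / (norm \<xi>)\<^sup>2" if "\<xi> \<noteq> 0"
        using direction_diff_le[OF that, of l "\<xi> - h"] direction_second_difference_le[OF that, of l h]
        by (simp_all add: t_def)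
      show ?thesis
      proof (cases "norm \<xi> < 1")
        case False
        then have "\<xi> \<noteq> 0" by auto
        have "2 * t / norm \<xi> \<le> 2 * t" "64 * t\<^sup>2 / (norm \<xi>)\<^sup>2 \<le> 64 * t\<^sup>2"
          using False t by (auto simp: divide_le_eq mult_le_cancel_left1 one_le_power)
        then have "?d1 \<le> 2 * t" "?d2 \<le> 64 * t\<^sup>2"
          using d1[OF \<open>\<xi> \<noteq> 0\<close>] d2[OF \<open>\<xi> \<noteq> 0\<close>] by linarith+
        then have "2 * (?d1 * cmod (B \<xi>)) + ?d2 * cmod (P (\<xi> - 2 *\<^sub>R h)) \<le> 2 * (2 * t * cmod (B \<xi>)) + 64 * t\<^sup>2 * cmod (P (\<xi> - 2 *\<^sub>R h))"
          by (intro add_mono mult_left_mono mult_right_mono) auto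
        then show ?thesis using L False t by (simp add: norm_mult norm_power)
      next
        case True
        \<comment> \<open>600 covers 2 * 2 * 5 + 4 * 9 = 56 for |xi| below t and 2 * 2 * 5 + 64 * 9
          = 596 above. Below the scale t the differences of the direction are merely bounded, but
          \<open>P\<close> and its difference are of order t^2; above it the powers of |xi|
          cancel.\<close>
        have "2 * (?d1 * cmod (B \<xi>)) + ?d2 * cmod (P (\<xi> - 2 *\<^sub>R h)) \<le> 600 * C * t\<^sup>2"
        proof (cases "norm \<xi> < t")
          case True
          have "2 * (?d1 * cmod (B \<xi>)) + ?d2 * cmod (P (\<xi> - 2 *\<^sub>R h)) \<le> 2 * (2 * (C * t * (5 * t))) + 4 * (C * (3 * t)\<^sup>2)"
          proof (intro add_mono mult_left_mono mult_mono dd)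
            show "cmod (B \<xi>) \<le> C * t * (5 * t)"
              by (rule order_trans[OF PB]) (use True t C(1) in \<open>auto intro!: mult_left_mono\<close>)
            show "cmod (P (\<xi> - 2 *\<^sub>R h)) \<le> C * (3 * t)\<^sup>2"
              by (rule order_trans[OF PP], intro mult_left_mono power_mono) (use True t C(1) in auto)
          qed auto
          also have "\<dots> = 56 * (C * t\<^sup>2)" by (simp add: power2_eq_square)
          also have "\<dots> \<le> 600 * C * t\<^sup>2" using C(1) by simp
          finally show ?thesis .
        next
          case False
          define n where "n = norm \<xi>"
          have n: "t \<le> n" "0 < n" "\<xi> \<noteq> 0" using False t by (auto simp: n_def)
          have "2 * (?d1 * cmod (B \<xi>)) + ?d2 * cmod (P (\<xi> - 2 *\<^sub>R h)) \<le> 2 * (2 * t / n * (C * t * (5 * n))) + 64 * t\<^sup>2 / n\<^sup>2 * (C * (3 * n)\<^sup>2)"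
          proof (intro add_mono mult_left_mono mult_mono)
            show "?d1 \<le> 2 * t / n" "?d2 \<le> 64 * t\<^sup>2 / n\<^sup>2"
              unfolding n_def by (intro d1 d2 n)+
            show "cmod (B \<xi>) \<le> C * t * (5 * n)"
              by (rule order_trans[OF PB]) (use n t C(1) in \<open>auto intro!: mult_left_mono simp: n_def\<close>)
            show "cmod (P (\<xi> - 2 *\<^sub>R h)) \<le> C * (3 * n)\<^sup>2"
              by (rule order_trans[OF PP], intro mult_left_mono power_mono) (use n t C(1) in \<open>auto simp: n_def\<close>)
          qed (use t n in auto)
          also have "\<dots> = 596 * (C * t\<^sup>2)" using n by (simp add: power2_eq_square)
          also have "\<dots> \<le> 600 * C * t\<^sup>2" using C(1) by simp
          finally show ?thesis .
        qed
        also have "600 * C * t\<^sup>2 = cmod (complex_of_real (600 * C * t\<^sup>2) * indicator (ball 0 1) \<xi>)"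
          using True C(1) by (simp add: norm_mult norm_power)
        finally have "2 * (?d1 * cmod (B \<xi>)) + ?d2 * cmod (P (\<xi> - 2 *\<^sub>R h)) \<le> \<dots>" .
        moreover have "0 \<le> cmod (complex_of_real (4 * t) * B \<xi>)" "0 \<le> cmod (complex_of_real (64 * t\<^sup>2) * P (\<xi> - 2 *\<^sub>R h))"
          by auto
        ultimately show ?thesis using L by linarith
      qed
    qed
    have "l2n (\<lambda>\<xi>. riesz_symbol l \<psi> (\<xi> - 2 *\<^sub>R h) - 2 * riesz_symbol l \<psi> (\<xi> - h) + riesz_symbol l \<psi> \<xi>)
       \<le> 4 * (l2n A + l2n (\<lambda>\<xi>. complex_of_real (4 * t) * B \<xi>) + l2n (\<lambda>\<xi>. complex_of_real (64 * t\<^sup>2) * P (\<xi> - 2 *\<^sub>R h))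
           + l2n (\<lambda>\<xi>::real^2. complex_of_real (600 * C * t\<^sup>2) * indicator (ball 0 1) \<xi>))"
      by (rule l2n_sum4; (rule pt | measurable))
    also have "\<dots> = 4 * (l2n A + ennreal ((4 * t)\<^sup>2) * l2n B + ennreal ((64 * t\<^sup>2)\<^sup>2) * l2n (\<lambda>\<xi>. P (\<xi> - 2 *\<^sub>R h))
        + ennreal ((600 * C * t\<^sup>2)\<^sup>2) * l2n (\<lambda>\<xi>::real^2. indicator (ball 0 1) \<xi>))"
    proof -
      have r: "l2n (\<lambda>\<xi>. complex_of_real a * f \<xi>) = ennreal (a\<^sup>2) * l2n f"
        if "f \<in> borel_measurable borel" for a and f :: "real^2 \<Rightarrow> complex"
        using l2n_cmult[OF that, of "complex_of_real a"] by (simp only: norm_of_real power2_abs)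
      have m: "(\<lambda>\<xi>. P (\<xi> - 2 *\<^sub>R h)) \<in> borel_measurable borel"
        "(\<lambda>\<xi>. indicator (ball 0 1) \<xi> :: complex) \<in> borel_measurable (borel :: (real^2) measure)" by measurable
      show ?thesis by (simp only: r[OF \<open>B \<in> borel_measurable borel\<close>] r[OF m(1)] r[OF m(2)])
    qed
    also have "\<dots> \<le> ennreal 4 * (ennreal (4 * pi\<^sup>2 * ((t\<^sup>2)\<^sup>2 * M)) + ennreal ((4 * t)\<^sup>2) * ennreal (4 * pi\<^sup>2 * (t\<^sup>2 * M))
        + ennreal ((64 * t\<^sup>2)\<^sup>2) * ennreal (4 * pi\<^sup>2 * M) + ennreal ((600 * C * t\<^sup>2)\<^sup>2) * ennreal V)"
      unfolding lV by (intro mult_mono add_mono lA lB lP mult_left_mono) auto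
    also have "\<dots> = ennreal (4 * (4 * pi\<^sup>2 * ((t\<^sup>2)\<^sup>2 * M) + (4 * t)\<^sup>2 * (4 * pi\<^sup>2 * (t\<^sup>2 * M))
        + (64 * t\<^sup>2)\<^sup>2 * (4 * pi\<^sup>2 * M) + (600 * C * t\<^sup>2)\<^sup>2 * V))"
    proof -
      have r: "ennreal 4 * (ennreal a + ennreal p * ennreal b + ennreal q * ennreal c + ennreal r * ennreal d)
         = ennreal (4 * (a + p * b + q * c + r * d))"
        if "0 \<le> a" "0 \<le> b" "0 \<le> c" "0 \<le> d" "0 \<le> p" "0 \<le> q" "0 \<le> r" for a b c d p q r
        using that by (simp only: ennreal_mult[symmetric] ennreal_plus[symmetric] mult_nonneg_nonneg add_nonneg_nonneg zero_le_numeral)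
      show ?thesis by (rule r) (use M V in auto)
    qed
    also have "4 * (4 * pi\<^sup>2 * ((t\<^sup>2)\<^sup>2 * M) + (4 * t)\<^sup>2 * (4 * pi\<^sup>2 * (t\<^sup>2 * M))
        + (64 * t\<^sup>2)\<^sup>2 * (4 * pi\<^sup>2 * M) + (600 * C * t\<^sup>2)\<^sup>2 * V) = K * t ^ 4"
      unfolding K_def power2_eq_square power4_eq_xxxx by algebra
    finally show ?thesis by (simp add: t_def)
  qed
  then show ?thesis using Kp by blast
qed

section \<open>From second differences to weighted integrability\<close>

text \<open>Stated for the L2 transform because it is applied to the Riesz transform before that
  function is known to be integrable.\<close>

lemma has_fourier_L2_second_difference:
  assumes "has_fourier_L2 g G"
  shows "has_fourier_L2 (\<lambda>x. (exp (\<i> * complex_of_real (x \<bullet> h)) - 1)\<^sup>2 * g x)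
    (\<lambda>\<xi>. G (\<xi> - 2 *\<^sub>R h) - 2 * G (\<xi> - h) + G \<xi>)"
proof -
  have e: "exp (\<i> * complex_of_real (x \<bullet> (2 *\<^sub>R h))) = (exp (\<i> * complex_of_real (x \<bullet> h)))\<^sup>2" for x
    by (simp add: exp_double[symmetric] mult.left_commute)
  have "has_fourier_L2 (\<lambda>x. exp (\<i> * complex_of_real (x \<bullet> (2 *\<^sub>R h))) * g x
      - 2 * (exp (\<i> * complex_of_real (x \<bullet> h)) * g x) + g x) (\<lambda>\<xi>. G (\<xi> - 2 *\<^sub>R h) - 2 * G (\<xi> - h) + G \<xi>)"
    by (intro has_fourier_L2_add has_fourier_L2_diff has_fourier_L2_cmult has_fourier_L2_modulation assms)
  then show ?thesis unfolding e by (simp add: power2_eq_square algebra_simps)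
qed

lemma iexp_difference_quotient:
  "(\<lambda>n. real (Suc n) * cmod (exp (\<i> * complex_of_real (s / real (Suc n))) - 1)) \<longlonglongrightarrow> \<bar>s\<bar>"
proof -
  have "(\<lambda>n. complex_of_real (real (Suc n)) * (exp (\<i> * complex_of_real (s / real (Suc n))) - 1) - \<i> * complex_of_real s) \<longlonglongrightarrow> 0"
  proof (rule Lim_null_comparison)
    show "(\<lambda>n. s\<^sup>2 / 2 * (1 / real (Suc n))) \<longlonglongrightarrow> 0"
      using tendsto_mult[OF tendsto_const[of "s\<^sup>2 / 2"] LIMSEQ_Suc[OF lim_1_over_n[where 'a=real]]] by simp
    show "\<forall>\<^sub>F n in sequentially. norm (complex_of_real (real (Suc n)) * (exp (\<i> * complex_of_real (s / real (Suc n))) - 1) - \<i> * complex_of_real s)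
      \<le> s\<^sup>2 / 2 * (1 / real (Suc n))"
    proof (intro always_eventually allI)
      fix n
      define N where "N = real (Suc n)"
      have N: "0 < N" by (simp add: N_def)
      have "complex_of_real N * (exp (\<i> * complex_of_real (s / N)) - 1) - \<i> * complex_of_real s
        = complex_of_real N * (iexp (s / N) - (\<Sum>k\<le>1. (\<i> * complex_of_real (s / N)) ^ k / fact k))"
        using N by (simp add: algebra_simps)
      also have "cmod \<dots> \<le> N * (\<bar>s / N\<bar> ^ Suc 1 / fact (Suc 1))"
        unfolding norm_mult norm_of_real abs_of_pos[OF N]
        by (intro mult_left_mono iexp_approx1) (use N in auto)
      also have "\<dots> = s\<^sup>2 / 2 * (1 / N)"
        using N by (simp add: power2_eq_square field_simps)
      finally show "norm (complex_of_real (real (Suc n)) * (exp (\<i> * complex_of_real (s / real (Suc n))) - 1) - \<i> * complex_of_real s)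
         \<le> s\<^sup>2 / 2 * (1 / real (Suc n))"
        by (simp only: N_def)
    qed
  qed
  from tendsto_norm[OF Lim_transform[OF tendsto_const[of "\<i> * complex_of_real s"] this]]
  show ?thesis by (simp only: norm_mult norm_of_real norm_ii) simp
qed

text \<open>Take steps v / (n + 1). The second differences, scaled by (n + 1)^2, stay bounded in L2,
  while the scaled phases (n + 1) |exp - 1| tend to |x . v|; Fatou's lemma then bounds the
  moment.\<close>

lemma riesz_transform_fourth_moment:
  assumes \<psi>: "\<psi> \<in> borel_measurable borel" "fast_decay \<psi>" "zero_moments 2 \<psi>"
    and g: "has_fourier_L2 g (riesz_symbol l \<psi>)"
  shows "(\<integral>\<^sup>+x. ennreal ((x \<bullet> v) ^ 4 * (cmod (g x))\<^sup>2) \<partial>lborel) < \<infinity>"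
proof -
  have [measurable]: "g \<in> borel_measurable borel"
    using g by (auto simp: has_fourier_L2_iff square_integrable_def)
  obtain K where K: "0 \<le> K" "\<And>h. l2n (\<lambda>\<xi>. riesz_symbol l \<psi> (\<xi> - 2 *\<^sub>R h) - 2 * riesz_symbol l \<psi> (\<xi> - h) + riesz_symbol l \<psi> \<xi>)
     \<le> ennreal (K * norm h ^ 4)"
    using riesz_symbol_second_difference[OF \<psi>] by blast
  define E where "E n x = real (Suc n) * cmod (exp (\<i> * complex_of_real ((x \<bullet> v) / real (Suc n))) - 1)" for n x
  have [measurable]: "E n \<in> borel_measurable borel" for n unfolding E_def by measurable
  have bd: "(\<integral>\<^sup>+x. ennreal (E n x ^ 4 * (cmod (g x))\<^sup>2) \<partial>lborel) \<le> ennreal (K * norm v ^ 4)" for n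
  proof -
    define N where "N = real (Suc n)"
    have N: "0 < N" by (simp add: N_def)
    let ?u = "\<lambda>x. (exp (\<i> * complex_of_real (x \<bullet> ((1 / N) *\<^sub>R v))) - 1)\<^sup>2 * g x"
    have "E n x ^ 4 * (cmod (g x))\<^sup>2 = N ^ 4 * (cmod (?u x))\<^sup>2" for x
      by (simp add: E_def N_def norm_mult norm_power power_mult_distrib flip: power_mult)
    then have "(\<integral>\<^sup>+x. ennreal (E n x ^ 4 * (cmod (g x))\<^sup>2) \<partial>lborel) = ennreal (N ^ 4) * l2n ?u"
      unfolding l2n_def by (simp add: ennreal_mult nn_integral_cmult)
    also have "\<dots> \<le> ennreal (N ^ 4) * ennreal (K * norm ((1 / N) *\<^sub>R v) ^ 4)"
      by (intro mult_left_mono order_trans[OF has_fourier_L2_norm_le[OF has_fourier_L2_second_difference[OF g]] K(2)]) simp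
    also have "\<dots> = ennreal (N ^ 4 * (K * norm ((1 / N) *\<^sub>R v) ^ 4))"
      by (rule ennreal_mult'[symmetric]) simp
    also have "N ^ 4 * (K * norm ((1 / N) *\<^sub>R v) ^ 4) = K * norm v ^ 4"
      using N by (simp add: power_mult_distrib power_divide)
    finally show ?thesis .
  qed
  have "(\<integral>\<^sup>+x. ennreal ((x \<bullet> v) ^ 4 * (cmod (g x))\<^sup>2) \<partial>lborel)
     = (\<integral>\<^sup>+x. liminf (\<lambda>n. ennreal (E n x ^ 4 * (cmod (g x))\<^sup>2)) \<partial>lborel)"
  proof (intro nn_integral_cong)
    fix x
    have "(\<lambda>n. ennreal (E n x ^ 4 * (cmod (g x))\<^sup>2)) \<longlonglongrightarrow> ennreal (\<bar>x \<bullet> v\<bar> ^ 4 * (cmod (g x))\<^sup>2)"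
      unfolding E_def by (intro tendsto_ennrealI tendsto_mult tendsto_power tendsto_const iexp_difference_quotient)
    from lim_imp_Liminf[OF sequentially_bot this]
    show "ennreal ((x \<bullet> v) ^ 4 * (cmod (g x))\<^sup>2) = liminf (\<lambda>n. ennreal (E n x ^ 4 * (cmod (g x))\<^sup>2))"
      by simp
  qed
  also have "\<dots> \<le> liminf (\<lambda>n. \<integral>\<^sup>+x. ennreal (E n x ^ 4 * (cmod (g x))\<^sup>2) \<partial>lborel)"
    by (rule nn_integral_liminf) simp
  also have "\<dots> \<le> liminf (\<lambda>n::nat. ennreal (K * norm v ^ 4))"
    by (rule Liminf_mono) (use bd in auto)
  finally show ?thesis by (auto simp: Liminf_const le_less_trans)
qed

text \<open>Cauchy-Schwarz with the factors (1 + |x|)^(H - 2) and (1 + |x|)^2 |g|. The square of the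
  first has exponent -(4 - 2 H), which exceeds the dimension 2 in size because H < 1; the second is
  controlled by the fourth moments along the two axes.\<close>

lemma fourth_moment_imp_weighted_integrable:
  fixes g :: "real^2 \<Rightarrow> complex"
  assumes "square_integrable g" "\<And>v. (\<integral>\<^sup>+x. ennreal ((x \<bullet> v) ^ 4 * (cmod (g x))\<^sup>2) \<partial>lborel) < \<infinity>" "H < 1"
  shows "integrable lborel (\<lambda>x. (1 + norm x) powr H * cmod (g x))"
proof -
  have [measurable]: "g \<in> borel_measurable borel" and fin: "l2n g < \<infinity>"
    using assms(1) by (auto simp: square_integrable_iff_l2n)
  let ?I = "\<lambda>l::2. \<integral>\<^sup>+x. ennreal ((x \<bullet> axis l 1) ^ 4 * (cmod (g x))\<^sup>2) \<partial>lborel"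
  have "(\<integral>\<^sup>+x. ennreal ((1 + norm x) ^ 4 * (cmod (g x))\<^sup>2) \<partial>lborel)
     \<le> (\<integral>\<^sup>+x. 8 * ennreal ((cmod (g x))\<^sup>2) + 16 * ennreal ((x \<bullet> axis 1 1) ^ 4 * (cmod (g x))\<^sup>2)
         + 16 * ennreal ((x \<bullet> axis 2 1) ^ 4 * (cmod (g x))\<^sup>2) \<partial>lborel)"
  proof (intro nn_integral_mono)
    fix x :: "real^2"
    have sq: "(a + b)\<^sup>2 \<le> 2 * a\<^sup>2 + 2 * b\<^sup>2" for a b :: real
      using zero_le_power2[of "a - b"] by (simp add: power2_eq_square algebra_simps)
    have n: "(norm x)\<^sup>2 = (x $ 1)\<^sup>2 + (x $ 2)\<^sup>2"
      unfolding power2_norm_eq_inner by (simp add: inner_vec_def sum_2 power2_eq_square)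
    have "(1 + norm x) ^ 4 = ((1 + norm x)\<^sup>2)\<^sup>2" by simp
    also have "\<dots> \<le> (2 * 1\<^sup>2 + 2 * (norm x)\<^sup>2)\<^sup>2" by (intro power_mono sq) auto
    also have "\<dots> \<le> 2 * (2 * 1\<^sup>2)\<^sup>2 + 2 * (2 * (norm x)\<^sup>2)\<^sup>2" by (rule sq)
    also have "\<dots> = 8 + 8 * ((x $ 1)\<^sup>2 + (x $ 2)\<^sup>2)\<^sup>2" unfolding n power_mult_distrib by simp
    also have "\<dots> \<le> 8 + 8 * (2 * ((x $ 1)\<^sup>2)\<^sup>2 + 2 * ((x $ 2)\<^sup>2)\<^sup>2)" by (intro add_left_mono mult_left_mono sq) auto
    also have "\<dots> = 8 + 16 * (x \<bullet> axis 1 1) ^ 4 + 16 * (x \<bullet> axis 2 1) ^ 4" by (simp add: inner_axis)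
    finally have "(1 + norm x) ^ 4 * (cmod (g x))\<^sup>2 \<le> (8 + 16 * (x \<bullet> axis 1 1) ^ 4 + 16 * (x \<bullet> axis 2 1) ^ 4) * (cmod (g x))\<^sup>2"
      by (intro mult_right_mono) auto
    then have le: "ennreal ((1 + norm x) ^ 4 * (cmod (g x))\<^sup>2) \<le> ennreal (8 * (cmod (g x))\<^sup>2 + 16 * ((x \<bullet> axis 1 1) ^ 4 * (cmod (g x))\<^sup>2)
         + 16 * ((x \<bullet> axis 2 1) ^ 4 * (cmod (g x))\<^sup>2))"
      by (intro ennreal_leI) (simp add: distrib_right mult.assoc)
    have "ennreal (8 * a + 16 * b + 16 * c) = 8 * ennreal a + 16 * ennreal b + 16 * ennreal c"
      if "0 \<le> a" "0 \<le> b" "0 \<le> c" for a b c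
      using that by (simp add: ennreal_mult)
    note this[of "(cmod (g x))\<^sup>2" "(x \<bullet> axis 1 1) ^ 4 * (cmod (g x))\<^sup>2" "(x \<bullet> axis 2 1) ^ 4 * (cmod (g x))\<^sup>2", OF _ mult_nonneg_nonneg mult_nonneg_nonneg]
    with le show "ennreal ((1 + norm x) ^ 4 * (cmod (g x))\<^sup>2) \<le> 8 * ennreal ((cmod (g x))\<^sup>2) + 16 * ennreal ((x \<bullet> axis 1 1) ^ 4 * (cmod (g x))\<^sup>2)
         + 16 * ennreal ((x \<bullet> axis 2 1) ^ 4 * (cmod (g x))\<^sup>2)"
      by simp
  qed
  also have "\<dots> = 8 * l2n g + 16 * ?I 1 + 16 * ?I 2"
    unfolding l2n_def by (simp add: nn_integral_add nn_integral_cmult)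
  also have "\<dots> < \<infinity>"
    using fin assms(2)[of "axis 1 1"] assms(2)[of "axis 2 1"] by (simp add: ennreal_mult_less_top)
  finally have w: "(\<integral>\<^sup>+x. ennreal ((1 + norm x) ^ 4 * (cmod (g x))\<^sup>2) \<partial>lborel) < \<infinity>" .
  have p: "(\<integral>\<^sup>+x. ennreal ((1 + norm (x::real^2)) powr (- (4 - 2 * H))) \<partial>lborel) < \<infinity>"
    using integrable_inverse_power[of "4 - 2 * H"] assms(3) by (simp add: integrable_iff_bounded)
  have finite_if_square: "a < \<infinity>" if "a\<^sup>2 < \<infinity>" for a :: ennreal
    using that by (cases "a = \<infinity>") (auto simp: power2_eq_square less_top)
  have "(\<integral>\<^sup>+x. ennreal ((1 + norm x) powr (H - 2)) * ennreal ((1 + norm x)\<^sup>2 * cmod (g x)) \<partial>lborel)\<^sup>2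
    \<le> (\<integral>\<^sup>+x. (ennreal ((1 + norm (x::real^2)) powr (H - 2)))\<^sup>2 \<partial>lborel) * (\<integral>\<^sup>+x. (ennreal ((1 + norm x)\<^sup>2 * cmod (g x)))\<^sup>2 \<partial>lborel)"
    by (rule Cauchy_Schwarz_nn_integral) auto
  also have "(\<integral>\<^sup>+x. (ennreal ((1 + norm (x::real^2)) powr (H - 2)))\<^sup>2 \<partial>lborel) = (\<integral>\<^sup>+x. ennreal ((1 + norm (x::real^2)) powr (- (4 - 2 * H))) \<partial>lborel)"
    by (intro nn_integral_cong) (simp add: power2_eq_square powr_add[symmetric] flip: ennreal_mult)
  also have "(\<integral>\<^sup>+x. (ennreal ((1 + norm x)\<^sup>2 * cmod (g x)))\<^sup>2 \<partial>lborel) = (\<integral>\<^sup>+x. ennreal ((1 + norm x) ^ 4 * (cmod (g x))\<^sup>2) \<partial>lborel)"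
    by (intro nn_integral_cong) (simp add: ennreal_power power_mult_distrib flip: power_mult)
  also have "(\<integral>\<^sup>+x. ennreal ((1 + norm (x::real^2)) powr (- (4 - 2 * H))) \<partial>lborel) * (\<integral>\<^sup>+x. ennreal ((1 + norm x) ^ 4 * (cmod (g x))\<^sup>2) \<partial>lborel) < \<infinity>"
    using p w by (simp add: ennreal_mult_less_top)
  finally have "(\<integral>\<^sup>+x. ennreal ((1 + norm x) powr (H - 2)) * ennreal ((1 + norm x)\<^sup>2 * cmod (g x)) \<partial>lborel)\<^sup>2 < \<infinity>" .
  then have "(\<integral>\<^sup>+x. ennreal ((1 + norm x) powr (H - 2)) * ennreal ((1 + norm x)\<^sup>2 * cmod (g x)) \<partial>lborel) < \<infinity>"
    by (rule finite_if_square)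
  also have "(\<integral>\<^sup>+x. ennreal ((1 + norm x) powr (H - 2)) * ennreal ((1 + norm x)\<^sup>2 * cmod (g x)) \<partial>lborel)
    = (\<integral>\<^sup>+x. ennreal ((1 + norm x) powr H * cmod (g x)) \<partial>lborel)"
  proof (intro nn_integral_cong)
    fix x :: "real^2"
    have "(1 + norm x)\<^sup>2 = (1 + norm x) powr 2"
      using norm_ge_zero[of x] by (simp add: powr_numeral add_pos_nonneg)
    then have "(1 + norm x) powr (H - 2) * (1 + norm x)\<^sup>2 = (1 + norm x) powr H"
      by (simp only: powr_add[symmetric]) simp
    then have "(1 + norm x) powr (H - 2) * ((1 + norm x)\<^sup>2 * cmod (g x)) = (1 + norm x) powr H * cmod (g x)"
      by (simp only: mult.assoc[symmetric])
    then show "ennreal ((1 + norm x) powr (H - 2)) * ennreal ((1 + norm x)\<^sup>2 * cmod (g x)) = ennreal ((1 + norm x) powr H * cmod (g x))"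
      by (simp flip: ennreal_mult)
  qed
  finally show ?thesis by (simp add: integrable_iff_bounded abs_mult)
qed

text \<open>Sets of full measure are dense. This supplies points tending to 0 at which an almost
  everywhere identity holds.\<close>

lemma AE_lborel_arbitrarily_close:
  assumes "AE x in lborel. P (x::'a::euclidean_space)" "0 < e"
  shows "\<exists>x\<in>ball a e. P x"
proof (rule ccontr)
  assume "\<not> (\<exists>x\<in>ball a e. P x)"
  then have "AE x in lborel. x \<notin> ball a e" using assms(1) by (auto elim!: eventually_mono)
  then have "ball a e \<in> null_sets lborel"
    by (subst (asm) AE_iff_null) (auto simp del: mem_ball)
  then have "negligible (ball a e)" by (simp add: negligible_iff_null_sets null_sets_completionI)
  then show False using open_not_negligible[of "ball a e"] assms(2) by simp
qed

lemma fourier_tendsto_0: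
  assumes "integrable lborel u" "\<xi> \<longlonglongrightarrow> 0"
  shows "(\<lambda>n. fourier u (\<xi> n)) \<longlonglongrightarrow> fourier u 0"
proof -
  have [measurable]: "u \<in> borel_measurable borel" using assms by auto
  show ?thesis
    unfolding fourier_def
  proof (rule integral_dominated_convergence[where w="\<lambda>x. cmod (u x)"])
    show "AE x in lborel. (\<lambda>i. u x * exp (- (\<i> * complex_of_real (x \<bullet> \<xi> i)))) \<longlonglongrightarrow> u x * exp (- (\<i> * complex_of_real (x \<bullet> 0)))"
      by (intro AE_I2 tendsto_intros assms)
  qed (use assms(1) in \<open>auto simp: norm_mult\<close>)
qed

section \<open>The Riesz transforms of the wavelet\<close>

context
  fixes \<psi> :: "real^2 \<Rightarrow> real"
  assumes \<psi>: "\<psi> \<in> borel_measurable borel" "fast_decay \<psi>" "zero_moments 2 \<psi>"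
begin

lemma wavelet_integrable: "integrable lborel (\<lambda>x. complex_of_real (\<psi> x))"
  and wavelet_square_integrable: "square_integrable (\<lambda>x. complex_of_real (\<psi> x))"
proof -
  note [measurable] = \<psi>(1)
  have "1 \<le> (1 + norm x)\<^sup>2" for x :: "real^2"
    using norm_ge_zero[of x] zero_le_power2[of "norm x"] unfolding power2_sum one_power2 mult_1_right by linarith
  then have le: "cmod (complex_of_real (\<psi> x)) \<le> 1 * ((1 + norm x)\<^sup>2 * \<bar>\<psi> x\<bar>)" for x
    using mult_right_mono[of 1 "(1 + norm x)\<^sup>2" "\<bar>\<psi> x\<bar>"] by simp
  show "integrable lborel (\<lambda>x. complex_of_real (\<psi> x))"
    by (rule l2n_fourier_weighted(2)[OF \<psi>(1,2) _ _ le]) auto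
  show "square_integrable (\<lambda>x. complex_of_real (\<psi> x))"
    by (rule l2n_fourier_weighted(3)[OF \<psi>(1,2) _ _ le]) auto
qed

text \<open>Surjectivity makes the choice in \<open>riesz\<close> meaningful. The choice comes with
  some L2 transform of the wavelet, which uniqueness identifies almost everywhere with the pointwise
  one.\<close>

lemma riesz_has_fourier_L2:
  "has_fourier_L2 (riesz l (\<lambda>x. complex_of_real (\<psi> x))) (riesz_symbol l \<psi>)"
proof -
  note [measurable] = \<psi>(1)
  let ?u = "\<lambda>x. complex_of_real (\<psi> x)"
  have F: "has_fourier_L2 ?u (fourier ?u)"
    by (rule has_fourier_L2_fourier[OF wavelet_square_integrable wavelet_integrable])
  have G: "square_integrable (riesz_symbol l \<psi>)"
    by (rule square_integrable_bound[of "fourier ?u"])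
       (use F riesz_symbol_le in \<open>auto simp: has_fourier_L2_iff\<close>)
  have eq: "(\<lambda>\<xi>. - \<i> * complex_of_real (\<xi> $ l / norm \<xi>) * fourier ?u \<xi>) = riesz_symbol l \<psi>"
    by (simp add: riesz_symbol_def[abs_def] direction_def)
  have "\<exists>g F. has_fourier_L2 ?u F \<and> has_fourier_L2 g (\<lambda>\<xi>. - \<i> * complex_of_real (\<xi> $ l / norm \<xi>) * F \<xi>)"
    using F has_fourier_L2_surj[OF G] eq by metis
  from someI_ex[OF this] obtain F' where F': "has_fourier_L2 ?u F'"
      "has_fourier_L2 (riesz l ?u) (\<lambda>\<xi>. - \<i> * complex_of_real (\<xi> $ l / norm \<xi>) * F' \<xi>)"
    unfolding riesz_def by blast
  show ?thesis
  proof (rule has_fourier_L2_cong_AE[OF F'(2)])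
    show "AE \<xi> in lborel. - \<i> * complex_of_real (\<xi> $ l / norm \<xi>) * F' \<xi> = riesz_symbol l \<psi> \<xi>"
      using has_fourier_L2_transform_unique[OF F'(1) F] unfolding eq[symmetric] by eventually_elim simp
  qed measurable
qed

lemma riesz_measurable: "riesz l (\<lambda>x. complex_of_real (\<psi> x)) \<in> borel_measurable borel"
  using riesz_has_fourier_L2 by (auto simp: has_fourier_L2_iff square_integrable_def)

lemma riesz_weighted_integrable:
  assumes "H < 1"
  shows "integrable lborel (\<lambda>x. (1 + norm x) powr H * cmod (riesz l (\<lambda>x. complex_of_real (\<psi> x)) x))"
  by (rule fourth_moment_imp_weighted_integrable)
     (use riesz_has_fourier_L2[of l] riesz_transform_fourth_moment[OF \<psi> riesz_has_fourier_L2] assms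
      in \<open>auto simp: has_fourier_L2_iff\<close>)

lemma riesz_integrable: "integrable lborel (riesz l (\<lambda>x. complex_of_real (\<psi> x)))"
proof -
  have "(1 + norm x) powr 0 = 1" for x :: "real^2"
    by (simp add: add_nonneg_eq_0_iff)
  then have "integrable lborel (\<lambda>x. norm (riesz l (\<lambda>x. complex_of_real (\<psi> x)) x))"
    using riesz_weighted_integrable[of 0 l] by simp
  then show ?thesis
    by (subst (asm) integrable_norm_iff) (simp_all add: riesz_measurable)
qed

lemma fourier_riesz: "AE \<xi> in lborel. fourier (riesz l (\<lambda>x. complex_of_real (\<psi> x))) \<xi> = riesz_symbol l \<psi> \<xi>"
proof -
  have "square_integrable (riesz l (\<lambda>x. complex_of_real (\<psi> x)))"
    using riesz_has_fourier_L2 by (auto simp: has_fourier_L2_iff)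
  from has_fourier_L2_transform_unique[OF has_fourier_L2_fourier[OF this riesz_integrable] riesz_has_fourier_L2]
  show ?thesis .
qed

text \<open>The integral is the transform at 0, a single point about which the almost everywhere
  identity \<open>fourier_riesz\<close> is silent. So 0 is approached through points where it holds:
  there the symbol is O(|xi|^2), and the transform of an integrable function is continuous.\<close>

lemma integral_riesz: "(LINT x|lborel. riesz l (\<lambda>x. complex_of_real (\<psi> x)) x) = 0"
proof -
  let ?g = "riesz l (\<lambda>x. complex_of_real (\<psi> x))"
  obtain C where C: "0 \<le> C" "\<And>\<xi>. cmod (fourier (\<lambda>x. complex_of_real (\<psi> x)) \<xi>) \<le> C * (norm \<xi>)\<^sup>2"
    using fourier_zero_moments_lipschitz[OF \<psi>] by metis
  have "\<exists>\<xi>\<in>ball 0 (1 / real (Suc n)). fourier ?g \<xi> = riesz_symbol l \<psi> \<xi>" for n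
    by (rule AE_lborel_arbitrarily_close[OF fourier_riesz]) simp
  then obtain \<xi> where \<xi>: "\<And>n. norm (\<xi> n) < 1 / real (Suc n)" "\<And>n. fourier ?g (\<xi> n) = riesz_symbol l \<psi> (\<xi> n)"
    by (metis dist_0_norm mem_ball)
  have \<xi>0: "\<xi> \<longlonglongrightarrow> 0"
    by (rule Lim_null_comparison[OF _ LIMSEQ_Suc[OF lim_1_over_n]]) (use \<xi>(1) in \<open>auto intro!: always_eventually less_imp_le\<close>)
  have "(\<lambda>n. fourier ?g (\<xi> n)) \<longlonglongrightarrow> 0"
  proof (rule Lim_null_comparison)
    show "\<forall>\<^sub>F n in sequentially. norm (fourier ?g (\<xi> n)) \<le> C * (norm (\<xi> n))\<^sup>2"
      unfolding \<xi>(2) by (intro always_eventually allI order_trans[OF riesz_symbol_le C(2)])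
    show "(\<lambda>n. C * (norm (\<xi> n))\<^sup>2) \<longlonglongrightarrow> 0"
      using tendsto_mult[OF tendsto_const[of C] tendsto_power[OF tendsto_norm[OF \<xi>0], of 2]] by simp
  qed
  moreover have "(\<lambda>n. fourier ?g (\<xi> n)) \<longlonglongrightarrow> fourier ?g 0"
    by (rule fourier_tendsto_0[OF riesz_integrable \<xi>0])
  ultimately have "fourier ?g 0 = 0" by (rule LIMSEQ_unique[symmetric])
  then show ?thesis by (simp add: fourier_def)
qed

text \<open>The symbol is Hermitian: the wavelet is real, the direction is odd, and conjugation
  changes the sign of -i. Hence the conjugate of the Riesz transform has the same transform, and
  injectivity applies.\<close>

lemma riesz_real: "AE x in lborel. Im (riesz l (\<lambda>x. complex_of_real (\<psi> x)) x) = 0"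
proof -
  have "cnj (riesz_symbol l \<psi> (- \<xi>)) = riesz_symbol l \<psi> \<xi>" for \<xi>
    using fourier_cnj[of "\<lambda>x. complex_of_real (\<psi> x)" \<xi>] by (simp add: riesz_symbol_def direction_def)
  then have "has_fourier_L2 (\<lambda>x. cnj (riesz l (\<lambda>x. complex_of_real (\<psi> x)) x)) (riesz_symbol l \<psi>)"
    using has_fourier_L2_cnj[OF riesz_has_fourier_L2[of l]] by simp
  from has_fourier_L2_unique[OF this riesz_has_fourier_L2]
  show ?thesis by eventually_elim (simp add: complex_eq_iff)
qed

end

section \<open>Polar coordinates\<close>

definition plane :: "real \<times> real \<Rightarrow> real^2" where
  "plane p = fst p *\<^sub>R axis 1 1 + snd p *\<^sub>R axis 2 1"

lemma plane_nth [simp]: "plane p $ 1 = fst p" "plane p $ 2 = snd p"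
  by (auto simp: plane_def axis_def)

lemma plane_measurable [measurable]: "plane \<in> borel_measurable borel"
  unfolding plane_def[abs_def] by (intro borel_measurable_continuous_onI continuous_intros)

lemma vector_eq_plane: "vector [a, b] = plane (a, b)"
  by (simp add: vec_eq_iff forall_2)

lemma Basis_real2: "(Basis :: (real^2) set) = {axis 1 1, axis 2 1}"
  by (auto simp: Basis_vec_def axis_eq_axis UNIV_2)

lemma prod_Basis_real2: "(\<Prod>b\<in>(Basis::(real^2) set). h b) = h (axis 1 1) * h (axis 2 1)"
  by (simp add: Basis_real2 axis_eq_axis)

lemma lborel_real2: "(lborel :: (real^2) measure) = distr (lborel \<Otimes>\<^sub>M lborel) borel plane"
proof (rule lborel_eqI)
  fix l u :: "real^2" assume *: "\<And>b. b \<in> Basis \<Longrightarrow> l \<bullet> b \<le> u \<bullet> b"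
  have le: "l $ 1 \<le> u $ 1" "l $ 2 \<le> u $ 2"
    using *[of "axis 1 1"] *[of "axis 2 1"] by (auto simp: Basis_real2 inner_axis)
  have "plane -` box l u = {l $ 1<..<u $ 1} \<times> {l $ 2<..<u $ 2}"
    by (auto simp: mem_box_cart forall_2)
  moreover have "plane \<in> (lborel \<Otimes>\<^sub>M lborel) \<rightarrow>\<^sub>M borel"
    by (simp add: lborel_prod)
  ultimately have "emeasure (distr (lborel \<Otimes>\<^sub>M lborel) borel plane) (box l u)
      = emeasure (lborel \<Otimes>\<^sub>M lborel) ({l $ 1<..<u $ 1} \<times> {l $ 2<..<u $ 2})"
    by (subst emeasure_distr) (auto simp: space_pair_measure)
  also have "\<dots> = ennreal (u $ 1 - l $ 1) * ennreal (u $ 2 - l $ 2)"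
    by (subst lborel.emeasure_pair_measure_Times) (use le in auto)
  also have "\<dots> = ennreal (\<Prod>b\<in>Basis. (u - l) \<bullet> b)"
    using le by (simp add: prod_Basis_real2 inner_axis ennreal_mult)
  finally show "emeasure (distr (lborel \<Otimes>\<^sub>M lborel) borel plane) (box l u) = (\<Prod>b\<in>Basis. (u - l) \<bullet> b)" .
qed simp

text \<open>Radius and angle are encoded as the two components of a vector, so that the map goes
  from the plane to itself and change of variables applies to it.\<close>

definition polar :: "real^2 \<Rightarrow> real^2" where
  "polar x = x $ 1 *\<^sub>R plane (cos (x $ 2), sin (x $ 2))"

text \<open>The angle 0 is left out. The image then misses only a half-line of the first axis, which
  is negligible.\<close>

definition polar_domain :: "(real^2) set" where
  "polar_domain = {x. 0 < x $ 1 \<and> 0 < x $ 2 \<and> x $ 2 < 2 * pi}"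

lemma polar_nth [simp]: "polar x $ 1 = x $ 1 * cos (x $ 2)" "polar x $ 2 = x $ 1 * sin (x $ 2)"
  by (simp_all add: polar_def)

lemma norm_real2: "norm (x::real^2) = sqrt ((x $ 1)\<^sup>2 + (x $ 2)\<^sup>2)"
  by (simp add: norm_vec_def L2_set_def sum_2)

lemma norm_plane_cos_sin [simp]: "norm (plane (cos t, sin t)) = 1"
  by (simp add: norm_real2)

lemma polar_measurable [measurable]: "polar \<in> borel_measurable borel"
  unfolding polar_def[abs_def] plane_def by (simp; measurable)

lemma polar_domain_measurable [measurable]: "polar_domain \<in> sets borel"
  unfolding polar_domain_def by measurable

lemma inj_on_polar: "inj_on polar polar_domain"
proof (rule inj_onI)
  fix x y assume x: "x \<in> polar_domain" and y: "y \<in> polar_domain" and eq: "polar x = polar y"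
  have "norm (polar x) = x $ 1" "norm (polar y) = y $ 1"
    using x y by (auto simp: polar_def polar_domain_def)
  with eq have r: "x $ 1 = y $ 1" by simp
  have "x $ 1 * cos (x $ 2) = y $ 1 * cos (y $ 2)" "x $ 1 * sin (x $ 2) = y $ 1 * sin (y $ 2)"
    using arg_cong[OF eq, of "\<lambda>v. v $ 1"] arg_cong[OF eq, of "\<lambda>v. v $ 2"] by auto
  then have "sin (x $ 2) = sin (y $ 2) \<and> cos (x $ 2) = cos (y $ 2)"
    using r x by (auto simp: polar_domain_def)
  then obtain n :: int where n: "x $ 2 = y $ 2 + 2 * pi * n"
    unfolding sin_cos_eq_iff by blast
  have "\<bar>x $ 2 - y $ 2\<bar> < 2 * pi" using x y by (auto simp: polar_domain_def)
  then have "2 * pi * \<bar>real_of_int n\<bar> < 2 * pi * 1" using n by (simp add: abs_mult)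
  then have "\<bar>real_of_int n\<bar> < 1" by (subst (asm) mult_less_cancel_left_pos) auto
  then have "n = 0" by linarith
  then show "x = y" using r n by (simp add: vec_eq_iff forall_2)
qed

lemma polar_image:
  assumes "x \<notin> {x. x $ 2 = 0}"
  shows "x \<in> polar ` polar_domain"
proof -
  define r where "r = norm x"
  have r: "0 < r" using assms by (auto simp: r_def)
  have "(x $ 1 / r)\<^sup>2 + (x $ 2 / r)\<^sup>2 = 1"
    using r by (simp add: r_def norm_real2 power_divide add_divide_distrib[symmetric] sum_power2_gt_zero_iff)
  then obtain t where t: "0 \<le> t" "t < 2 * pi" "x $ 1 / r = cos t" "x $ 2 / r = sin t"
    by (rule sincos_total_2pi)
  have "t \<noteq> 0" using t(4) assms r by auto
  then have "plane (r, t) \<in> polar_domain" using t r by (auto simp: polar_domain_def)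
  moreover have "polar (plane (r, t)) = x"
    using t(3,4) r by (auto simp: vec_eq_iff forall_2 field_simps)
  ultimately show ?thesis by (metis imageI)
qed

lemma polar_has_derivative:
  "(polar has_derivative (\<lambda>h. plane (h $ 1 * cos (x $ 2) - x $ 1 * sin (x $ 2) * h $ 2,
      h $ 1 * sin (x $ 2) + x $ 1 * cos (x $ 2) * h $ 2))) (at x within S)"
  unfolding polar_def[abs_def] plane_def fst_conv snd_conv
  by (auto intro!: derivative_eq_intros bounded_linear_imp_has_derivative bounded_linear_vec_nth ext
      simp: algebra_simps vec_eq_iff forall_2 axis_def)

lemma polar_jacobian:
  "det (matrix (\<lambda>h. plane (h $ 1 * cos t - r * sin t * h $ 2, h $ 1 * sin t + r * cos t * h $ 2))) = r"
proof -
  have "r * cos t * cos t + r * sin t * sin t = r"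
    by (metis distrib_left mult.assoc mult.right_neutral power2_eq_square sin_cos_squared_add2)
  then show ?thesis
    by (simp add: det_2 matrix_def axis_def algebra_simps)
qed

text \<open>It suffices to compare boxes. The image of the preimage of a box differs from the box
  within the first coordinate axis only, so it has the same measure, and injectivity with Jacobian
  \<open>x $ 1\<close> expresses that measure as the integral of the density.\<close>

lemma lborel_polar:
  "(lborel :: (real^2) measure) = distr (density lborel (\<lambda>x. ennreal (indicator polar_domain x * x $ 1))) borel polar"
proof (rule lborel_eqI)
  fix l u :: "real^2" assume le: "\<And>b. b \<in> Basis \<Longrightarrow> l \<bullet> b \<le> u \<bullet> b"
  define B where "B = polar_domain \<inter> polar -` box l u"
  define Z where "Z = {x::real^2. x $ 2 = 0}"
  have box: "box l u \<in> sets borel" by simp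
  have B[measurable]: "B \<in> sets borel"
    unfolding B_def using measurable_sets[OF polar_measurable box] by simp
  have Z: "negligible Z"
    unfolding Z_def using negligible_hyperplane[of "axis 2 1 :: real^2" 0] by (simp add: inner_axis' axis_eq_0_iff)
  have img: "polar ` B \<subseteq> box l u" "box l u - polar ` B \<subseteq> Z"
    using polar_image unfolding B_def Z_def by auto
  have neg: "negligible (polar ` B - box l u \<union> (box l u - polar ` B))"
    using img by (intro negligible_subset[OF Z]) auto
  have bl: "box l u \<in> lmeasurable" by simp
  have pB: "polar ` B \<in> lmeasurable" "measure lebesgue (polar ` B) = measure lebesgue (box l u)"
    using lmeasurable_negligible_symdiff[OF bl, of "polar ` B"] measure_negligible_symdiff[OF bl, of "polar ` B"] neg
    by (auto simp: Un_commute)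
  have "((\<lambda>x. \<bar>x $ 1\<bar>) has_integral measure lebesgue (box l u)) B"
    using has_measure_differentiable_image[of B polar, OF _ polar_has_derivative inj_on_subset[OF inj_on_polar], of "measure lebesgue (box l u)"] pB
    by (simp add: polar_jacobian B_def[symmetric]) (simp add: B_def)
  then have "integral\<^sup>N lborel (\<lambda>x. ennreal (indicator B x * \<bar>x $ 1\<bar>)) = ennreal (measure lebesgue (box l u))"
    by (intro nn_integral_has_integral_lebesgue) auto
  moreover have "emeasure (distr (density lborel (\<lambda>x. ennreal (indicator polar_domain x * x $ 1))) borel polar) (box l u)
     = integral\<^sup>N lborel (\<lambda>x. ennreal (indicator B x * \<bar>x $ 1\<bar>))"
    by (subst emeasure_distr, simp, simp, subst emeasure_density)
       (auto intro!: nn_integral_cong simp: B_def polar_domain_def indicator_def measurable_sets_borel[OF polar_measurable])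
  moreover have "measure lebesgue (box l u) = (\<Prod>b\<in>Basis. (u - l) \<bullet> b)"
    using le by (simp add: measure_lborel_box_eq inner_diff_left)
  ultimately show "emeasure (distr (density lborel (\<lambda>x. ennreal (indicator polar_domain x * x $ 1))) borel polar) (box l u)
     = (\<Prod>b\<in>Basis. (u - l) \<bullet> b)" by simp
qed simp

lemma plane_cos_sin_measurable: "(\<lambda>t. plane (cos t, sin t)) \<in> borel_measurable borel"
  unfolding plane_def fst_conv snd_conv by (intro borel_measurable_continuous_onI continuous_intros)

lemma space_arc_length: "space arc_length = sphere 0 1"
  and sets_arc_length: "sets arc_length = sets (restrict_space borel (sphere 0 1))"
  by (simp_all add: arc_length_def space_restrict_space)

text \<open>The half-open interval of \<open>arc_length\<close> is exchanged for the open one of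
  \<open>polar_domain\<close>; they differ by the null set {0}.\<close>

lemma integral_arc_length:
  fixes h :: "real^2 \<Rightarrow> real"
  assumes h: "h \<in> borel_measurable (restrict_space borel (sphere 0 1))"
  shows "(LINT \<Theta>|arc_length. h \<Theta>) = (LINT t|lborel. indicator {0<..<2 * pi} t * h (plane (cos t, sin t)))"
proof -
  have "(\<lambda>t. plane (cos t, sin t)) \<in> borel_measurable (restrict_space lborel {0..<2 * pi})"
    using plane_cos_sin_measurable by (intro measurable_restrict_space1) simp
  then have m: "(\<lambda>t. vector [cos t, sin t] :: real^2) \<in> restrict_space lborel {0..<2 * pi} \<rightarrow>\<^sub>M restrict_space borel (sphere 0 1)"
    unfolding vector_eq_plane by (intro measurable_restrict_space2) auto
  have "(LINT \<Theta>|arc_length. h \<Theta>) = (LINT t|restrict_space lborel {0..<2 * pi}. h (plane (cos t, sin t)))"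
    unfolding arc_length_def by (subst integral_distr[OF m h]) (simp add: vector_eq_plane)
  also have "\<dots> = (LINT t|lborel. indicator {0..<2 * pi} t *\<^sub>R h (plane (cos t, sin t)))"
    by (rule integral_restrict_space) simp
  also have "\<dots> = (LINT t|lborel. indicator {0<..<2 * pi} t * h (plane (cos t, sin t)))"
  proof (rule integral_cong_AE)
    have hh: "(\<lambda>x. indicator (sphere 0 1) x *\<^sub>R h x) \<in> borel_measurable borel"
      using h by (subst (asm) borel_measurable_restrict_space_iff) auto
    from measurable_compose[OF plane_cos_sin_measurable hh]
    have [measurable]: "(\<lambda>t. h (plane (cos t, sin t))) \<in> borel_measurable borel" by simp
    show "(\<lambda>t. indicator {0..<2 * pi} t *\<^sub>R h (plane (cos t, sin t))) \<in> borel_measurable lborel"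
      "(\<lambda>t. indicator {0<..<2 * pi} t * h (plane (cos t, sin t))) \<in> borel_measurable lborel"
      by measurable
    show "AE t in lborel. indicator {0..<2 * pi} t *\<^sub>R h (plane (cos t, sin t)) = indicator {0<..<2 * pi} t * h (plane (cos t, sin t))"
      using AE_lborel_singleton[of 0] by eventually_elim (auto simp: indicator_def)
  qed
  finally show ?thesis .
qed

text \<open>In polar coordinates the integrand, including the Jacobian, separates into functions of
  radius and angle. The angular factor is bounded on a bounded interval, so Fubini applies to the
  product.\<close>

lemma integral_polar_product:
  fixes \<rho> :: "real \<Rightarrow> real" and \<kappa> :: "real^2 \<Rightarrow> real"
  assumes [measurable]: "\<rho> \<in> borel_measurable borel" "\<kappa> \<in> borel_measurable borel"
    and \<rho>: "integrable lborel (\<lambda>r. indicator {0<..} r * (r * \<rho> r))" and \<kappa>: "\<And>x. norm x = 1 \<Longrightarrow> \<bar>\<kappa> x\<bar> \<le> B"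
  shows "(LINT \<xi>|lborel. \<rho> (norm \<xi>) * \<kappa> (\<xi> /\<^sub>R norm \<xi>))
    = (LINT r|lborel. indicator {0<..} r * (r * \<rho> r)) * (LINT \<Theta>|arc_length. \<kappa> \<Theta>)"
proof -
  define F where "F \<xi> = \<rho> (norm \<xi>) * \<kappa> (\<xi> /\<^sub>R norm \<xi>)" for \<xi>
  have [measurable]: "F \<in> borel_measurable borel" unfolding F_def by measurable
  define a where "a r = indicator {0<..} r * (r * \<rho> r)" for r
  define b where "b t = indicator {0<..<2 * pi} t * \<kappa> (plane (cos t, sin t))" for t :: real
  have [measurable]: "a \<in> borel_measurable borel" unfolding a_def by measurable
  have [measurable]: "b \<in> borel_measurable borel"
    unfolding b_def using measurable_compose[OF plane_cos_sin_measurable assms(2)] by measurable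
  have ib: "integrable lborel b"
  proof (rule Bochner_Integration.integrable_bound)
    show "integrable lborel (\<lambda>t. indicator {0<..<2 * pi} t * \<bar>B\<bar>)" by simp
    show "AE t in lborel. norm (b t) \<le> norm (indicator {0<..<2 * pi} t * \<bar>B\<bar>)"
      unfolding b_def using order_trans[OF \<kappa>[OF norm_plane_cos_sin] abs_ge_self] by (auto simp: indicator_def)
  qed measurable
  have "(LINT \<xi>|lborel. F \<xi>) = (LINT x|lborel. indicator polar_domain x * x $ 1 * F (polar x))"
    by (subst lborel_polar, subst integral_distr, simp, simp, subst integral_density)
       (auto simp: polar_domain_def indicator_def)
  also have "\<dots> = (LINT x|lborel. a (x $ 1) * b ((x::real^2) $ 2))"
  proof (intro Bochner_Integration.integral_cong refl)
    fix x :: "real^2"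
    show "indicator polar_domain x * x $ 1 * F (polar x) = a (x $ 1) * b (x $ 2)"
      by (auto simp: indicator_def polar_domain_def a_def b_def F_def polar_def)
  qed
  also have "\<dots> = (LINT p|(lborel \<Otimes>\<^sub>M lborel). a (fst p) * b (snd p))"
    by (subst lborel_real2, subst integral_distr) (auto simp: lborel_prod)
  also have "\<dots> = (LINT p|(lborel \<Otimes>\<^sub>M lborel). (case p of (r, t) \<Rightarrow> a r * b t))"
    by (simp add: case_prod_beta)
  also have "\<dots> = (LINT r|lborel. LINT t|lborel. a r * b t)"
  proof (rule lborel_pair.integral_fst[symmetric], rule lborel_pair.Fubini_integrable)
    show "integrable lborel (\<lambda>r. LINT t|lborel. norm (case (r, t) of (r, t) \<Rightarrow> a r * b t))"
      using \<rho> by (simp add: abs_mult a_def[symmetric])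
    show "AE r in lborel. integrable lborel (\<lambda>t. case (r, t) of (r, t) \<Rightarrow> a r * b t)"
      using ib by simp
  qed measurable
  also have "\<dots> = (LINT r|lborel. a r) * (LINT t|lborel. b t)" by simp
  also have "(LINT t|lborel. b t) = (LINT \<Theta>|arc_length. \<kappa> \<Theta>)"
    unfolding b_def by (rule integral_arc_length[symmetric]) (rule measurable_restrict_space1, simp)
  finally show ?thesis by (simp add: F_def a_def)
qed

section \<open>The spectral isometry\<close>

lemma integral_lborel_product:
  fixes f :: "'a::euclidean_space \<Rightarrow> complex" and g :: "'b::euclidean_space \<Rightarrow> complex"
  assumes f: "integrable lborel f" and g: "integrable lborel g"
  shows "integrable (lborel \<Otimes>\<^sub>M lborel) (\<lambda>p. f (fst p) * g (snd p))"
    and "(LINT p|(lborel \<Otimes>\<^sub>M lborel). f (fst p) * g (snd p)) = (LINT x|lborel. f x) * (LINT y|lborel. g y)"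
proof -
  have [measurable]: "f \<in> borel_measurable borel" "g \<in> borel_measurable borel" using f g by auto
  have i: "integrable (lborel \<Otimes>\<^sub>M lborel) (\<lambda>(x, y). f x * g y)"
  proof (rule lborel_pair.Fubini_integrable)
    show "integrable lborel (\<lambda>x. LINT y|lborel. norm (case (x, y) of (x, y) \<Rightarrow> f x * g y))"
      using f by (simp add: norm_mult)
    show "AE x in lborel. integrable lborel (\<lambda>y. case (x, y) of (x, y) \<Rightarrow> f x * g y)"
      using g by simp
  qed measurable
  then show "integrable (lborel \<Otimes>\<^sub>M lborel) (\<lambda>p. f (fst p) * g (snd p))"
    by (simp add: case_prod_beta')
  show "(LINT p|(lborel \<Otimes>\<^sub>M lborel). f (fst p) * g (snd p)) = (LINT x|lborel. f x) * (LINT y|lborel. g y)"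
    using lborel_pair.integral_fst[OF i] by (simp add: case_prod_beta')
qed

lemma integral_lborel_product_norm:
  fixes f g :: "real^2 \<Rightarrow> complex"
  assumes f: "integrable lborel f" and g: "integrable lborel g"
  shows "(LINT p|(lborel \<Otimes>\<^sub>M lborel). norm (f (fst p) * g (snd p))) = (LINT x|lborel. norm (f x)) * (LINT y|lborel. norm (g y))"
proof -
  have "complex_of_real (LINT p|(lborel \<Otimes>\<^sub>M lborel). norm (f (fst p) * g (snd p)))
     = complex_of_real ((LINT x|lborel. norm (f x)) * (LINT y|lborel. norm (g y)))"
    using integral_lborel_product(2)[of "\<lambda>x. complex_of_real (norm (f x))" "\<lambda>y. complex_of_real (norm (g y))"] f g
    by (simp add: norm_mult flip: of_real_mult)
  then show ?thesis by (simp only: of_real_eq_iff)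
qed

text \<open>The growth of the standard deviation of an H-self-similar field, made positive at the
  origin so that division by it is harmless.\<close>

definition weight :: "real \<Rightarrow> real^2 \<Rightarrow> real" where
  "weight H x = (1 + norm x) powr H"

lemma weight_pos: "0 < weight H x"
  using norm_ge_zero[of x] by (simp add: weight_def add_nonneg_eq_0_iff)

lemma weight_measurable [measurable]: "weight H \<in> borel_measurable borel"
  unfolding weight_def by measurable

definition weighted_integrable :: "real \<Rightarrow> (real^2 \<Rightarrow> real) \<Rightarrow> bool" where
  "weighted_integrable H \<gamma> \<longleftrightarrow> \<gamma> \<in> borel_measurable borel \<and> integrable lborel (\<lambda>x. weight H x * \<bar>\<gamma> x\<bar>)"

text \<open>Cauchy-Schwarz in the space variable with respect to \<open>\<bar>\<gamma>\<bar> dx\<close>, followed by Tonelli.\<close>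
lemma second_moment_le:
  fixes Z :: "'n \<times> (real^2) \<Rightarrow> complex"
  assumes "sigma_finite_measure N" and [measurable]: "Z \<in> borel_measurable (N \<Otimes>\<^sub>M lborel)" "\<gamma> \<in> borel_measurable borel"
  shows "(\<integral>\<^sup>+n. (\<integral>\<^sup>+x. ennreal (cmod (complex_of_real (\<gamma> x) * Z (n, x))) \<partial>lborel)\<^sup>2 \<partial>N)
    \<le> (\<integral>\<^sup>+x. ennreal (weight H x * \<bar>\<gamma> x\<bar>) \<partial>lborel) *
      (\<integral>\<^sup>+x. ennreal (\<bar>\<gamma> x\<bar> / weight H x) * (\<integral>\<^sup>+n. ennreal ((cmod (Z (n, x)))\<^sup>2) \<partial>N) \<partial>lborel)"
proof -
  interpret N: sigma_finite_measure N by fact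
  interpret P: pair_sigma_finite N lborel ..
  let ?W = "\<integral>\<^sup>+x. ennreal (weight H x * \<bar>\<gamma> x\<bar>) \<partial>lborel"
  have 1: "(\<integral>\<^sup>+x. ennreal (cmod (complex_of_real (\<gamma> x) * Z (n, x))) \<partial>lborel)\<^sup>2
     \<le> ?W * (\<integral>\<^sup>+x. ennreal (\<bar>\<gamma> x\<bar> / weight H x) * ennreal ((cmod (Z (n, x)))\<^sup>2) \<partial>lborel)" if "n \<in> space N" for n
  proof -
    have [measurable]: "(\<lambda>x. Z (n, x)) \<in> borel_measurable lborel"
      using that by measurable
    have "ennreal (cmod (complex_of_real (\<gamma> x) * Z (n, x))) = ennreal (sqrt (weight H x * \<bar>\<gamma> x\<bar>)) * ennreal (sqrt (\<bar>\<gamma> x\<bar> / weight H x) * cmod (Z (n, x)))" for x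
    proof -
      have "sqrt (weight H x * \<bar>\<gamma> x\<bar>) * sqrt (\<bar>\<gamma> x\<bar> / weight H x) = \<bar>\<gamma> x\<bar>"
        using weight_pos[of H x] by (simp add: real_sqrt_mult[symmetric])
      then have "cmod (complex_of_real (\<gamma> x) * Z (n, x)) = sqrt (weight H x * \<bar>\<gamma> x\<bar>) * (sqrt (\<bar>\<gamma> x\<bar> / weight H x) * cmod (Z (n, x)))"
        unfolding norm_mult norm_of_real by (metis mult.assoc)
      then show ?thesis
        using weight_pos[of H x] by (simp only:) (rule ennreal_mult, auto simp: less_imp_le)
    qed
    then have "(\<integral>\<^sup>+x. ennreal (cmod (complex_of_real (\<gamma> x) * Z (n, x))) \<partial>lborel)\<^sup>2
      \<le> (\<integral>\<^sup>+x. (ennreal (sqrt (weight H x * \<bar>\<gamma> x\<bar>)))\<^sup>2 \<partial>lborel) * (\<integral>\<^sup>+x. (ennreal (sqrt (\<bar>\<gamma> x\<bar> / weight H x) * cmod (Z (n, x))))\<^sup>2 \<partial>lborel)"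
      by (simp only:) (rule Cauchy_Schwarz_nn_integral; measurable)
    also have "(\<integral>\<^sup>+x. (ennreal (sqrt (weight H x * \<bar>\<gamma> x\<bar>)))\<^sup>2 \<partial>lborel) = ?W"
      using weight_pos[of H] by (intro nn_integral_cong) (simp add: ennreal_power less_imp_le)
    also have "(\<integral>\<^sup>+x. (ennreal (sqrt (\<bar>\<gamma> x\<bar> / weight H x) * cmod (Z (n, x))))\<^sup>2 \<partial>lborel)
      = (\<integral>\<^sup>+x. ennreal (\<bar>\<gamma> x\<bar> / weight H x) * ennreal ((cmod (Z (n, x)))\<^sup>2) \<partial>lborel)"
      using weight_pos[of H]
      by (intro nn_integral_cong) (simp add: ennreal_power power_mult_distrib less_imp_le flip: ennreal_mult)
    finally show ?thesis .
  qed
  have "(\<integral>\<^sup>+n. (\<integral>\<^sup>+x. ennreal (cmod (complex_of_real (\<gamma> x) * Z (n, x))) \<partial>lborel)\<^sup>2 \<partial>N)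
    \<le> (\<integral>\<^sup>+n. ?W * (\<integral>\<^sup>+x. ennreal (\<bar>\<gamma> x\<bar> / weight H x) * ennreal ((cmod (Z (n, x)))\<^sup>2) \<partial>lborel) \<partial>N)"
    by (rule nn_integral_mono) (rule 1)
  also have "\<dots> = ?W * (\<integral>\<^sup>+n. \<integral>\<^sup>+x. ennreal (\<bar>\<gamma> x\<bar> / weight H x) * ennreal ((cmod (Z (n, x)))\<^sup>2) \<partial>lborel \<partial>N)"
    by (rule nn_integral_cmult) measurable
  also have "(\<integral>\<^sup>+n. \<integral>\<^sup>+x. ennreal (\<bar>\<gamma> x\<bar> / weight H x) * ennreal ((cmod (Z (n, x)))\<^sup>2) \<partial>lborel \<partial>N)
     = (\<integral>\<^sup>+x. \<integral>\<^sup>+n. ennreal (\<bar>\<gamma> x\<bar> / weight H x) * ennreal ((cmod (Z (n, x)))\<^sup>2) \<partial>N \<partial>lborel)"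
    by (rule P.Fubini'[symmetric]) measurable
  also have "\<dots> = (\<integral>\<^sup>+x. ennreal (\<bar>\<gamma> x\<bar> / weight H x) * (\<integral>\<^sup>+n. ennreal ((cmod (Z (n, x)))\<^sup>2) \<partial>N) \<partial>lborel)"
    by (intro nn_integral_cong nn_integral_cmult) measurable
  finally show ?thesis .
qed

section \<open>Integrals of a field with weighted second moments\<close>

context
  fixes N :: "'n measure" and Z :: "'n \<times> (real^2) \<Rightarrow> complex" and C H :: real
  assumes sf: "sigma_finite_measure N" and Z[measurable]: "Z \<in> borel_measurable (N \<Otimes>\<^sub>M lborel)"
    and C: "0 \<le> C" "\<And>x. (\<integral>\<^sup>+n. ennreal ((cmod (Z (n, x)))\<^sup>2) \<partial>N) \<le> ennreal (C * (weight H x)\<^sup>2)"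
begin

text \<open>The weights in \<open>second_moment_le\<close> are balanced: the moment bound C w^2
  times |\<gamma>| / w is again C w |\<gamma>|, so weighted integrability makes both factors
  finite.\<close>

lemma second_moment_finite:
  assumes \<gamma>: "weighted_integrable H \<gamma>"
  shows "(\<integral>\<^sup>+n. (\<integral>\<^sup>+x. ennreal (cmod (complex_of_real (\<gamma> x) * Z (n, x))) \<partial>lborel)\<^sup>2 \<partial>N) < \<infinity>"
proof -
  have [measurable]: "\<gamma> \<in> borel_measurable borel" using \<gamma> by (simp add: weighted_integrable_def)
  have W: "(\<integral>\<^sup>+x. ennreal (weight H x * \<bar>\<gamma> x\<bar>) \<partial>lborel) < \<infinity>"
    using \<gamma> weight_pos[of H] by (simp add: weighted_integrable_def integrable_iff_bounded abs_mult less_imp_le)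
  have "(\<integral>\<^sup>+x. ennreal (\<bar>\<gamma> x\<bar> / weight H x) * (\<integral>\<^sup>+n. ennreal ((cmod (Z (n, x)))\<^sup>2) \<partial>N) \<partial>lborel)
     \<le> (\<integral>\<^sup>+x. ennreal C * ennreal (weight H x * \<bar>\<gamma> x\<bar>) \<partial>lborel)"
  proof (rule nn_integral_mono)
    fix x
    have "ennreal (\<bar>\<gamma> x\<bar> / weight H x) * (\<integral>\<^sup>+n. ennreal ((cmod (Z (n, x)))\<^sup>2) \<partial>N) \<le> ennreal (\<bar>\<gamma> x\<bar> / weight H x) * ennreal (C * (weight H x)\<^sup>2)"
      by (intro mult_left_mono C) simp
    also have "\<dots> = ennreal C * ennreal (weight H x * \<bar>\<gamma> x\<bar>)"
      using weight_pos[of H x] C(1) by (simp add: power2_eq_square field_simps flip: ennreal_mult)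
    finally show "ennreal (\<bar>\<gamma> x\<bar> / weight H x) * (\<integral>\<^sup>+n. ennreal ((cmod (Z (n, x)))\<^sup>2) \<partial>N) \<le> \<dots>" .
  qed
  also have "\<dots> < \<infinity>" using W by (simp add: nn_integral_cmult ennreal_mult_less_top)
  finally show ?thesis
    using W by (intro le_less_trans[OF second_moment_le[OF sf Z, of \<gamma> H]]) (auto simp: ennreal_mult_less_top)
qed

lemma AE_field_integrable:
  assumes \<gamma>: "weighted_integrable H \<gamma>"
  shows "AE n in N. integrable lborel (\<lambda>x. complex_of_real (\<gamma> x) * Z (n, x))"
proof -
  have [measurable]: "\<gamma> \<in> borel_measurable borel" using \<gamma> by (simp add: weighted_integrable_def)
  interpret N: sigma_finite_measure N by (rule sf)
  have "AE n in N. (\<integral>\<^sup>+x. ennreal (cmod (complex_of_real (\<gamma> x) * Z (n, x))) \<partial>lborel)\<^sup>2 \<noteq> \<infinity>"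
    by (rule nn_integral_PInf_AE) (use second_moment_finite[OF \<gamma>] in auto)
  then show ?thesis
  proof (rule AE_mp, intro AE_I2 impI)
    fix n assume n: "n \<in> space N"
      and "(\<integral>\<^sup>+x. ennreal (cmod (complex_of_real (\<gamma> x) * Z (n, x))) \<partial>lborel)\<^sup>2 \<noteq> \<infinity>"
    then have "(\<integral>\<^sup>+x. ennreal (cmod (complex_of_real (\<gamma> x) * Z (n, x))) \<partial>lborel) < \<infinity>"
      by (cases "(\<integral>\<^sup>+x. ennreal (cmod (complex_of_real (\<gamma> x) * Z (n, x))) \<partial>lborel) = \<infinity>") (auto simp: power2_eq_square less_top)
    moreover have "(\<lambda>x. complex_of_real (\<gamma> x) * Z (n, x)) \<in> borel_measurable lborel"
      using n by measurable
    ultimately show "integrable lborel (\<lambda>x. complex_of_real (\<gamma> x) * Z (n, x))"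
      by (simp add: integrable_iff_bounded)
  qed
qed

lemma field_integral_measurable:
  assumes [measurable]: "\<gamma> \<in> borel_measurable borel"
  shows "(\<lambda>n. LINT x|lborel. complex_of_real (\<gamma> x) * Z (n, x)) \<in> borel_measurable N"
    "(\<lambda>n. LINT x|lborel. cmod (complex_of_real (\<gamma> x) * Z (n, x))) \<in> borel_measurable N"
  by (rule lborel.borel_measurable_lebesgue_integral, measurable)+

lemma field_integral_square_integrable:
  assumes \<gamma>: "weighted_integrable H \<gamma>"
  shows "integrable N (\<lambda>n. (LINT x|lborel. cmod (complex_of_real (\<gamma> x) * Z (n, x)))\<^sup>2)"
proof -
  have m: "\<gamma> \<in> borel_measurable borel" using \<gamma> by (simp add: weighted_integrable_def)
  note [measurable] = field_integral_measurable(2)[OF m]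
  have "(\<integral>\<^sup>+n. ennreal ((LINT x|lborel. cmod (complex_of_real (\<gamma> x) * Z (n, x)))\<^sup>2) \<partial>N)
      = (\<integral>\<^sup>+n. (\<integral>\<^sup>+x. ennreal (cmod (complex_of_real (\<gamma> x) * Z (n, x))) \<partial>lborel)\<^sup>2 \<partial>N)"
  proof (rule nn_integral_cong_AE, use AE_field_integrable[OF \<gamma>] in eventually_elim)
    case (elim n)
    then have "(\<integral>\<^sup>+x. ennreal (cmod (complex_of_real (\<gamma> x) * Z (n, x))) \<partial>lborel) = ennreal (LINT x|lborel. cmod (complex_of_real (\<gamma> x) * Z (n, x)))"
      by (intro nn_integral_eq_integral integrable_norm) auto
    then show ?case by (simp add: ennreal_power integral_nonneg_AE)
  qed
  then show ?thesis
    using second_moment_finite[OF \<gamma>] by (subst integrable_iff_bounded) auto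
qed

text \<open>The right-hand side involves the field only through its kernel of mixed second moments.
  Two fields over different measure spaces with the same kernel therefore give the same left-hand
  side; this is how the random field and the spectral kernel are compared.\<close>

lemma field_integral_isometry:
  assumes \<gamma>1: "weighted_integrable H \<gamma>1" and \<gamma>2: "weighted_integrable H \<gamma>2"
  defines "I \<equiv> \<lambda>\<gamma> n. LINT x|lborel. complex_of_real (\<gamma> x) * Z (n, x)"
  shows "integrable N (\<lambda>n. I \<gamma>1 n * cnj (I \<gamma>2 n))"
    and "(LINT n|N. I \<gamma>1 n * cnj (I \<gamma>2 n)) = (LINT p|(lborel \<Otimes>\<^sub>M lborel).
      complex_of_real (\<gamma>1 (fst p)) * complex_of_real (\<gamma>2 (snd p)) * (LINT n|N. Z (n, fst p) * cnj (Z (n, snd p))))"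
proof -
  have m[measurable]: "\<gamma>1 \<in> borel_measurable borel" "\<gamma>2 \<in> borel_measurable borel"
    using \<gamma>1 \<gamma>2 by (simp_all add: weighted_integrable_def)
  interpret N: sigma_finite_measure N by (rule sf)
  have L: "sigma_finite_measure (lborel \<Otimes>\<^sub>M lborel :: ((real^2) \<times> (real^2)) measure)"
    unfolding lborel_prod by (rule sigma_finite_lborel)
  interpret P: pair_sigma_finite N "lborel \<Otimes>\<^sub>M lborel :: ((real^2) \<times> (real^2)) measure"
    by (intro pair_sigma_finite.intro sf L)
  define A where "A \<gamma> n = (LINT x|lborel. cmod (complex_of_real (\<gamma> x) * Z (n, x)))" for \<gamma> :: "real^2 \<Rightarrow> real" and n
  have A0: "0 \<le> A \<gamma> n" for \<gamma> n unfolding A_def by (rule integral_nonneg_AE) auto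
  have [measurable]: "A \<gamma>1 \<in> borel_measurable N" "A \<gamma>2 \<in> borel_measurable N"
      "I \<gamma>1 \<in> borel_measurable N" "I \<gamma>2 \<in> borel_measurable N"
    unfolding A_def I_def using field_integral_measurable m by auto
  have iA: "integrable N (\<lambda>n. A \<gamma>1 n * A \<gamma>2 n)"
  proof (rule Bochner_Integration.integrable_bound)
    show "integrable N (\<lambda>n. (A \<gamma>1 n)\<^sup>2 + (A \<gamma>2 n)\<^sup>2)"
      unfolding A_def by (intro Bochner_Integration.integrable_add field_integral_square_integrable \<gamma>1 \<gamma>2)
    show "AE n in N. norm (A \<gamma>1 n * A \<gamma>2 n) \<le> norm ((A \<gamma>1 n)\<^sup>2 + (A \<gamma>2 n)\<^sup>2)"
    proof (intro AE_I2)
      fix n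
      show "norm (A \<gamma>1 n * A \<gamma>2 n) \<le> norm ((A \<gamma>1 n)\<^sup>2 + (A \<gamma>2 n)\<^sup>2)"
        using sum_squares_bound[of "A \<gamma>1 n" "A \<gamma>2 n"] mult_nonneg_nonneg[OF A0[of \<gamma>1 n] A0[of \<gamma>2 n]]
        by (simp add: abs_of_nonneg)
    qed
  qed measurable
  have le: "cmod (I \<gamma> n) \<le> A \<gamma> n" for \<gamma> n
    unfolding I_def A_def by (rule integral_norm_bound)
  show "integrable N (\<lambda>n. I \<gamma>1 n * cnj (I \<gamma>2 n))"
    by (rule Bochner_Integration.integrable_bound[OF iA])
       (use le A0 in \<open>auto simp: norm_mult abs_mult intro!: mult_mono order_trans[OF le abs_ge_self]\<close>)
  define h where "h q = (complex_of_real (\<gamma>1 (fst (snd q))) * Z (fst q, fst (snd q))) * (complex_of_real (\<gamma>2 (snd (snd q))) * cnj (Z (fst q, snd (snd q))))" for q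
  have [measurable]: "h \<in> borel_measurable (N \<Otimes>\<^sub>M (lborel \<Otimes>\<^sub>M lborel))"
    unfolding h_def by measurable
  \<comment> \<open>For almost every n the integrand is a product of functions of the two space
    variables, so its integral and the integral of its norm both factor.\<close>
  have good: "AE n in N. integrable (lborel \<Otimes>\<^sub>M lborel) (\<lambda>p. h (n, p)) \<and>
      (LINT p|(lborel \<Otimes>\<^sub>M lborel). h (n, p)) = I \<gamma>1 n * cnj (I \<gamma>2 n) \<and>
      (LINT p|(lborel \<Otimes>\<^sub>M lborel). norm (h (n, p))) = A \<gamma>1 n * A \<gamma>2 n"
    using AE_field_integrable[OF \<gamma>1] AE_field_integrable[OF \<gamma>2]
  proof eventually_elim
    case (elim n)
    have 2: "integrable lborel (\<lambda>x. complex_of_real (\<gamma>2 x) * cnj (Z (n, x)))"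
      using integrable_cnj[OF elim(2)] by simp
    have c: "cnj (I \<gamma>2 n) = (LINT x|lborel. complex_of_real (\<gamma>2 x) * cnj (Z (n, x)))"
      unfolding I_def Bochner_Integration.integral_cnj[symmetric] by simp
    have a: "A \<gamma>2 n = (LINT x|lborel. cmod (complex_of_real (\<gamma>2 x) * cnj (Z (n, x))))"
      unfolding A_def by (simp add: norm_mult)
    show ?case
      unfolding h_def fst_conv snd_conv c
      using integral_lborel_product[OF elim(1) 2] integral_lborel_product_norm[OF elim(1) 2]
      by (simp add: I_def A_def[of \<gamma>1] a)
  qed
  have ih: "integrable (N \<Otimes>\<^sub>M (lborel \<Otimes>\<^sub>M lborel)) h"
  proof (rule P.Fubini_integrable)
    show "AE n in N. integrable (lborel \<Otimes>\<^sub>M lborel) (\<lambda>p. h (n, p))"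
      using good by eventually_elim simp
    show "integrable N (\<lambda>n. LINT p|(lborel \<Otimes>\<^sub>M lborel). norm (h (n, p)))"
    proof (rule integrable_cong_AE_imp[OF iA])
      show "(\<lambda>n. LINT p|(lborel \<Otimes>\<^sub>M lborel). norm (h (n, p))) \<in> borel_measurable N"
        by (rule sigma_finite_measure.borel_measurable_lebesgue_integral[OF L]) measurable
      show "AE n in N. A \<gamma>1 n * A \<gamma>2 n = (LINT p|(lborel \<Otimes>\<^sub>M lborel). norm (h (n, p)))"
        using good by eventually_elim simp
    qed
  qed measurable
  have "(LINT n|N. I \<gamma>1 n * cnj (I \<gamma>2 n)) = (LINT n|N. LINT p|(lborel \<Otimes>\<^sub>M lborel). h (n, p))"
  proof (rule integral_cong_AE)
    show "(\<lambda>n. LINT p|(lborel \<Otimes>\<^sub>M lborel). h (n, p)) \<in> borel_measurable N"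
      by (rule sigma_finite_measure.borel_measurable_lebesgue_integral[OF L]) measurable
    show "AE n in N. I \<gamma>1 n * cnj (I \<gamma>2 n) = (LINT p|(lborel \<Otimes>\<^sub>M lborel). h (n, p))"
      using good by eventually_elim simp
  qed measurable
  also have "\<dots> = (LINT p|(lborel \<Otimes>\<^sub>M lborel). LINT n|N. h (n, p))"
    by (rule P.Fubini_integral[symmetric]) (use ih in \<open>simp add: case_prod_beta'\<close>)
  also have "\<dots> = (LINT p|(lborel \<Otimes>\<^sub>M lborel). complex_of_real (\<gamma>1 (fst p)) * complex_of_real (\<gamma>2 (snd p)) * (LINT n|N. Z (n, fst p) * cnj (Z (n, snd p))))"
  proof (intro Bochner_Integration.integral_cong refl)
    fix p :: "(real^2) \<times> (real^2)"
    have "(LINT n|N. h (n, p)) = (LINT n|N. (complex_of_real (\<gamma>1 (fst p)) * complex_of_real (\<gamma>2 (snd p))) * (Z (n, fst p) * cnj (Z (n, snd p))))"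
      unfolding h_def by (intro Bochner_Integration.integral_cong refl) (simp add: mult_ac)
    then show "(LINT n|N. h (n, p)) = complex_of_real (\<gamma>1 (fst p)) * complex_of_real (\<gamma>2 (snd p)) * (LINT n|N. Z (n, fst p) * cnj (Z (n, snd p)))"
      by simp
  qed
  finally show "(LINT n|N. I \<gamma>1 n * cnj (I \<gamma>2 n)) = \<dots>" .
qed

end

section \<open>Gaussian random variables\<close>

context prob_space
begin

lemma normal_square_moment:
  assumes D: "distributed M lborel Y (normal_density 0 \<sigma>)" and "0 < \<sigma>"
  shows "integrable M (\<lambda>\<omega>. (Y \<omega>)\<^sup>2)" "expectation (\<lambda>\<omega>. (Y \<omega>)\<^sup>2) = \<sigma>\<^sup>2"
proof -
  have "integrable lborel (\<lambda>x. normal_density 0 \<sigma> x * x\<^sup>2)"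
    using integrable_normal_moment[OF assms(2), of 0 2] by simp
  then show "integrable M (\<lambda>\<omega>. (Y \<omega>)\<^sup>2)"
    by (subst distributed_integrable[OF D, of "\<lambda>x. x\<^sup>2", symmetric]) (auto simp: normal_density_nonneg)
  have "(LINT x|lborel. normal_density 0 \<sigma> x * x\<^sup>2) = \<sigma>\<^sup>2"
    using integral_normal_moment_even[OF assms(2), of 0 1] assms(2) by (simp add: fact_numeral)
  then show "expectation (\<lambda>\<omega>. (Y \<omega>)\<^sup>2) = \<sigma>\<^sup>2"
    by (subst distributed_integral[OF D, of "\<lambda>x. x\<^sup>2", symmetric]) (auto simp: normal_density_nonneg)
qed

lemma normal_char:
  assumes D: "distributed M lborel Y (normal_density 0 \<sigma>)" and "0 < \<sigma>"
  shows "expectation (\<lambda>\<omega>. iexp (t * Y \<omega>)) = complex_of_real (exp (- (t\<^sup>2 * \<sigma>\<^sup>2) / 2))"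
proof -
  have [measurable]: "Y \<in> borel_measurable M" using distributed_measurable[OF D] by simp
  have "distributed M lborel (\<lambda>\<omega>. Y \<omega> / \<sigma>) std_normal_density"
    using normal_standard_normal_convert[OF assms(2), of Y 0] D by simp
  then have d: "distr M lborel (\<lambda>\<omega>. Y \<omega> / \<sigma>) = std_normal_distribution"
    by (simp add: distributed_distr_eq_density)
  have "complex_of_real (exp (- ((t * \<sigma>)\<^sup>2) / 2)) = (LINT x|std_normal_distribution. iexp (t * \<sigma> * x))"
    using fun_cong[OF char_std_normal_distribution, of "t * \<sigma>"] by (simp add: char_def)
  also have "\<dots> = expectation (\<lambda>\<omega>. iexp (t * \<sigma> * (Y \<omega> / \<sigma>)))"
    unfolding d[symmetric] by (subst integral_distr) auto
  finally show ?thesis using assms(2) by (simp add: power_mult_distrib)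
qed

text \<open>A variable that vanishes almost surely satisfies the formulas with variance 0, so later
  arguments are free of the case distinction in the definition.\<close>

lemma centered_gaussian_facts:
  assumes "centered_gaussian M Y"
  shows "Y \<in> borel_measurable M" "integrable M (\<lambda>\<omega>. (Y \<omega>)\<^sup>2)" "expectation Y = 0"
    "expectation (\<lambda>\<omega>. iexp (t * Y \<omega>)) = complex_of_real (exp (- (t\<^sup>2 * expectation (\<lambda>\<omega>. (Y \<omega>)\<^sup>2)) / 2))"
proof -
  show m[measurable]: "Y \<in> borel_measurable M" using assms by (simp add: centered_gaussian_def)
  consider \<sigma> where "0 < \<sigma>" "distributed M lborel Y (normal_density 0 \<sigma>)" | "AE \<omega> in M. Y \<omega> = 0"
    using assms unfolding centered_gaussian_def by blast
  then have "integrable M (\<lambda>\<omega>. (Y \<omega>)\<^sup>2) \<and> expectation Y = 0 \<and>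
    expectation (\<lambda>\<omega>. iexp (t * Y \<omega>)) = complex_of_real (exp (- (t\<^sup>2 * expectation (\<lambda>\<omega>. (Y \<omega>)\<^sup>2)) / 2))"
  proof cases
    case 1
    then show ?thesis
      using normal_square_moment[OF 1(2,1)] normal_char[OF 1(2,1)] normal_distributed_expectation[OF 1(1,2)] by simp
  next
    case 2
    have "integrable M (\<lambda>\<omega>. (Y \<omega>)\<^sup>2)"
      by (rule integrable_cong_AE_imp[of _ "\<lambda>_. 0"]) (use 2 in auto)
    moreover have "expectation Y = 0" "expectation (\<lambda>\<omega>. (Y \<omega>)\<^sup>2) = 0"
      using 2 by (auto intro!: integral_eq_zero_AE)
    moreover have "expectation (\<lambda>\<omega>. iexp (t * Y \<omega>)) = expectation (\<lambda>\<omega>. 1 :: complex)"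
      by (rule integral_cong_AE) (use 2 in auto)
    ultimately show ?thesis by (simp add: prob_space)
  qed
  then show "integrable M (\<lambda>\<omega>. (Y \<omega>)\<^sup>2)" "expectation Y = 0"
    "expectation (\<lambda>\<omega>. iexp (t * Y \<omega>)) = complex_of_real (exp (- (t\<^sup>2 * expectation (\<lambda>\<omega>. (Y \<omega>)\<^sup>2)) / 2))"
    by auto
qed

text \<open>Positive variance is settled by uniqueness of characteristic functions. Variance 0 has
  no density and falls under the degenerate alternative.\<close>

lemma centered_gaussianI_char:
  assumes [measurable]: "Y \<in> borel_measurable M" and sq: "integrable M (\<lambda>\<omega>. (Y \<omega>)\<^sup>2)"
    and char: "\<And>t. expectation (\<lambda>\<omega>. iexp (t * Y \<omega>)) = complex_of_real (exp (- (t\<^sup>2 * expectation (\<lambda>\<omega>. (Y \<omega>)\<^sup>2)) / 2))"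
  shows "centered_gaussian M Y"
proof (cases "expectation (\<lambda>\<omega>. (Y \<omega>)\<^sup>2) = 0")
  case True
  then have "AE \<omega> in M. (Y \<omega>)\<^sup>2 = 0"
    using sq by (subst (asm) integral_nonneg_eq_0_iff_AE) auto
  then show ?thesis by (simp add: centered_gaussian_def)
next
  case False
  define \<sigma> where "\<sigma> = sqrt (expectation (\<lambda>\<omega>. (Y \<omega>)\<^sup>2))"
  have "0 \<le> expectation (\<lambda>\<omega>. (Y \<omega>)\<^sup>2)" by (rule integral_nonneg_AE) auto
  with False have "0 < expectation (\<lambda>\<omega>. (Y \<omega>)\<^sup>2)" by linarith
  then have \<sigma>: "0 < \<sigma>" "\<sigma>\<^sup>2 = expectation (\<lambda>\<omega>. (Y \<omega>)\<^sup>2)" unfolding \<sigma>_def by auto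
  define D where "D = density lborel (normal_density 0 \<sigma>)"
  interpret D: prob_space D unfolding D_def by (rule prob_space_normal_density[OF \<sigma>(1)])
  have dD: "distributed D lborel (\<lambda>x. x) (normal_density 0 \<sigma>)"
    unfolding distributed_def D_def by (auto simp: distr_id2)
  have "distr M borel Y = D"
  proof (rule Levy_uniqueness)
    show "real_distribution (distr M borel Y)" by (rule real_distribution_distr) simp
    show "real_distribution D"
      using D.prob_space_axioms by (simp add: real_distribution_def real_distribution_axioms_def D_def)
    show "char (distr M borel Y) = char D"
    proof
      fix t
      have "char (distr M borel Y) t = expectation (\<lambda>\<omega>. iexp (t * Y \<omega>))"
        unfolding char_def by (subst integral_distr) auto
      also have "\<dots> = char D t"
        unfolding char char_def using D.normal_char[OF dD \<sigma>(1), of t] \<sigma>(2) by simp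
      finally show "char (distr M borel Y) t = char D t" .
    qed
  qed
  then have "distributed M lborel Y (normal_density 0 \<sigma>)"
    unfolding distributed_def D_def by (simp cong: distr_cong)
  with \<sigma>(1) show ?thesis by (auto simp: centered_gaussian_def)
qed

lemma centered_gaussian_cong_AE:
  assumes "centered_gaussian M Y" "AE \<omega> in M. Y \<omega> = Y' \<omega>" and [measurable]: "Y' \<in> borel_measurable M"
  shows "centered_gaussian M Y'"
proof -
  note [measurable] = centered_gaussian_facts(1)[OF assms(1)]
  have sq: "expectation (\<lambda>\<omega>. (Y \<omega>)\<^sup>2) = expectation (\<lambda>\<omega>. (Y' \<omega>)\<^sup>2)"
    by (rule integral_cong_AE) (use assms(2) in auto)
  show ?thesis
  proof (rule centered_gaussianI_char)
    show "integrable M (\<lambda>\<omega>. (Y' \<omega>)\<^sup>2)"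
      by (rule integrable_cong_AE_imp[OF centered_gaussian_facts(2)[OF assms(1)]]) (use assms(2) in auto)
    fix t
    have "expectation (\<lambda>\<omega>. iexp (t * Y' \<omega>)) = expectation (\<lambda>\<omega>. iexp (t * Y \<omega>))"
      by (rule integral_cong_AE) (use assms(2) in auto)
    then show "expectation (\<lambda>\<omega>. iexp (t * Y' \<omega>)) = complex_of_real (exp (- (t\<^sup>2 * expectation (\<lambda>\<omega>. (Y' \<omega>)\<^sup>2)) / 2))"
      by (simp only: centered_gaussian_facts(4)[OF assms(1)] sq)
  qed simp
qed

lemma cmod_iexp_diff_le: "cmod (iexp a - iexp b) \<le> \<bar>a - b\<bar>"
proof -
  have "iexp a - iexp b = iexp b * (iexp (a - b) - 1)"
    by (simp add: algebra_simps flip: exp_add)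
  then show ?thesis using iexp_minus_1_le[of "a - b"] by (simp add: norm_mult)
qed

text \<open>Mean square convergence carries both the variances and the characteristic functions to
  the limit, so the limit again has a characteristic function of Gaussian form with its own
  variance.\<close>

lemma centered_gaussian_limit:
  assumes S: "\<And>n. centered_gaussian M (S n)" and [measurable]: "Y \<in> borel_measurable M"
    and lim: "(\<lambda>n. \<integral>\<^sup>+\<omega>. ennreal ((S n \<omega> - Y \<omega>)\<^sup>2) \<partial>M) \<longlonglongrightarrow> 0"
  shows "centered_gaussian M Y"
proof -
  note [measurable] = centered_gaussian_facts(1)[OF S]
  have sq2: "(a + b)\<^sup>2 \<le> 2 * a\<^sup>2 + 2 * b\<^sup>2" for a b :: real
    using zero_le_power2[of "a - b"] by (simp add: power2_eq_square algebra_simps)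
  obtain n where n: "(\<integral>\<^sup>+\<omega>. ennreal ((S n \<omega> - Y \<omega>)\<^sup>2) \<partial>M) < 1"
    using order_tendstoD(2)[OF lim, of 1] eventually_happens'[OF sequentially_bot] by fastforce
  then have "integrable M (\<lambda>\<omega>. (S n \<omega> - Y \<omega>)\<^sup>2)"
    by (subst integrable_iff_bounded) (auto intro: less_trans)
  then have iY: "integrable M (\<lambda>\<omega>. (Y \<omega>)\<^sup>2)"
  proof -
    assume i: "integrable M (\<lambda>\<omega>. (S n \<omega> - Y \<omega>)\<^sup>2)"
    show ?thesis
    proof (rule Bochner_Integration.integrable_bound)
      show "integrable M (\<lambda>\<omega>. 2 * (S n \<omega>)\<^sup>2 + 2 * (S n \<omega> - Y \<omega>)\<^sup>2)"
        using i centered_gaussian_facts(2)[OF S] by simp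
      show "AE \<omega> in M. norm ((Y \<omega>)\<^sup>2) \<le> norm (2 * (S n \<omega>)\<^sup>2 + 2 * (S n \<omega> - Y \<omega>)\<^sup>2)"
      proof (intro AE_I2)
        fix \<omega>
        show "norm ((Y \<omega>)\<^sup>2) \<le> norm (2 * (S n \<omega>)\<^sup>2 + 2 * (S n \<omega> - Y \<omega>)\<^sup>2)"
          using sq2[of "S n \<omega>" "Y \<omega> - S n \<omega>"] by (simp add: power2_commute[of "Y \<omega>"])
      qed
    qed simp
  qed
  have iD: "integrable M (\<lambda>\<omega>. (S n \<omega> - Y \<omega>)\<^sup>2)" for n
  proof (rule Bochner_Integration.integrable_bound)
    show "integrable M (\<lambda>\<omega>. 2 * (S n \<omega>)\<^sup>2 + 2 * (Y \<omega>)\<^sup>2)"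
      using iY centered_gaussian_facts(2)[OF S] by simp
    show "AE \<omega> in M. norm ((S n \<omega> - Y \<omega>)\<^sup>2) \<le> norm (2 * (S n \<omega>)\<^sup>2 + 2 * (Y \<omega>)\<^sup>2)"
    proof (intro AE_I2)
      fix \<omega>
      show "norm ((S n \<omega> - Y \<omega>)\<^sup>2) \<le> norm (2 * (S n \<omega>)\<^sup>2 + 2 * (Y \<omega>)\<^sup>2)"
        using sq2[of "S n \<omega>" "- Y \<omega>"] by simp
    qed
  qed simp
  define d where "d n = expectation (\<lambda>\<omega>. (S n \<omega> - Y \<omega>)\<^sup>2)" for n
  have d0: "0 \<le> d n" for n unfolding d_def by (rule integral_nonneg_AE) auto
  have "(\<lambda>n. ennreal (d n)) \<longlonglongrightarrow> 0"
    using lim by (simp add: d_def nn_integral_eq_integral iD)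
  then have d: "d \<longlonglongrightarrow> 0"
    using d0 by (subst (asm) ennreal_0[symmetric], subst (asm) ennreal_tendsto_0_iff) auto
  \<comment> \<open>Cauchy-Schwarz against a fixed factor, used with \<open>Z = Y\<close> for
    convergence of the variances and with \<open>Z = 1\<close> for convergence of the characteristic
    functions.\<close>
  have CS: "(\<lambda>n. expectation (\<lambda>\<omega>. \<bar>Z \<omega>\<bar> * \<bar>S n \<omega> - Y \<omega>\<bar>)) \<longlonglongrightarrow> 0"
    and iCS: "\<And>n. integrable M (\<lambda>\<omega>. \<bar>Z \<omega>\<bar> * \<bar>S n \<omega> - Y \<omega>\<bar>)"
    if [measurable]: "Z \<in> borel_measurable M" and iZ: "integrable M (\<lambda>\<omega>. (Z \<omega>)\<^sup>2)" for Z
  proof -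
    show i: "integrable M (\<lambda>\<omega>. \<bar>Z \<omega>\<bar> * \<bar>S n \<omega> - Y \<omega>\<bar>)" for n
    proof (rule Bochner_Integration.integrable_bound)
      show "integrable M (\<lambda>\<omega>. (Z \<omega>)\<^sup>2 + (S n \<omega> - Y \<omega>)\<^sup>2)" using iZ iD by simp
      have "\<bar>a\<bar> * \<bar>b\<bar> \<le> a\<^sup>2 + b\<^sup>2" for a b :: real
        using sum_squares_bound[of "\<bar>a\<bar>" "\<bar>b\<bar>"] mult_nonneg_nonneg[OF abs_ge_zero abs_ge_zero, of a b]
        unfolding power2_abs mult.assoc by linarith
      then show "AE \<omega> in M. norm (\<bar>Z \<omega>\<bar> * \<bar>S n \<omega> - Y \<omega>\<bar>) \<le> norm ((Z \<omega>)\<^sup>2 + (S n \<omega> - Y \<omega>)\<^sup>2)"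
        by (simp add: abs_mult)
    qed simp
    have "(\<lambda>n. (ennreal (expectation (\<lambda>\<omega>. \<bar>Z \<omega>\<bar> * \<bar>S n \<omega> - Y \<omega>\<bar>)))\<^sup>2) \<longlonglongrightarrow> 0"
    proof (rule tendsto_0_ennreal_le)
      show "(\<lambda>n. ennreal (expectation (\<lambda>\<omega>. (Z \<omega>)\<^sup>2)) * ennreal (d n)) \<longlonglongrightarrow> 0"
        by (rule tendsto_0_ennreal_cmult) (use \<open>(\<lambda>n. ennreal (d n)) \<longlonglongrightarrow> 0\<close> in auto)
      fix n
      have "ennreal (expectation (\<lambda>\<omega>. \<bar>Z \<omega>\<bar> * \<bar>S n \<omega> - Y \<omega>\<bar>)) = (\<integral>\<^sup>+\<omega>. ennreal \<bar>Z \<omega>\<bar> * ennreal \<bar>S n \<omega> - Y \<omega>\<bar> \<partial>M)"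
        using i[of n] by (subst nn_integral_eq_integral[symmetric]) (auto simp: ennreal_mult)
      also have "\<dots>\<^sup>2 \<le> (\<integral>\<^sup>+\<omega>. (ennreal \<bar>Z \<omega>\<bar>)\<^sup>2 \<partial>M) * (\<integral>\<^sup>+\<omega>. (ennreal \<bar>S n \<omega> - Y \<omega>\<bar>)\<^sup>2 \<partial>M)"
        by (rule Cauchy_Schwarz_nn_integral) auto
      also have "\<dots> = ennreal (expectation (\<lambda>\<omega>. (Z \<omega>)\<^sup>2)) * ennreal (d n)"
        unfolding d_def using iZ iD[of n] by (simp add: ennreal_power nn_integral_eq_integral)
      finally show "(ennreal (expectation (\<lambda>\<omega>. \<bar>Z \<omega>\<bar> * \<bar>S n \<omega> - Y \<omega>\<bar>)))\<^sup>2 \<le> \<dots>" .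
    qed
    from tendsto_0_ennreal_square[OF this]
    show "(\<lambda>n. expectation (\<lambda>\<omega>. \<bar>Z \<omega>\<bar> * \<bar>S n \<omega> - Y \<omega>\<bar>)) \<longlonglongrightarrow> 0"
      by (subst (asm) ennreal_0[symmetric], subst (asm) ennreal_tendsto_0_iff) (auto intro!: integral_nonneg_AE)
  qed
  have v: "(\<lambda>n. expectation (\<lambda>\<omega>. (S n \<omega>)\<^sup>2)) \<longlonglongrightarrow> expectation (\<lambda>\<omega>. (Y \<omega>)\<^sup>2)"
  proof (rule LIM_zero_cancel, rule Lim_null_comparison)
    show "(\<lambda>n. d n + 2 * expectation (\<lambda>\<omega>. \<bar>Y \<omega>\<bar> * \<bar>S n \<omega> - Y \<omega>\<bar>)) \<longlonglongrightarrow> 0"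
      using tendsto_add[OF d tendsto_mult[OF tendsto_const[of 2] CS(1)[OF _ iY]]] by simp
    show "\<forall>\<^sub>F n in sequentially. norm (expectation (\<lambda>\<omega>. (S n \<omega>)\<^sup>2) - expectation (\<lambda>\<omega>. (Y \<omega>)\<^sup>2))
        \<le> d n + 2 * expectation (\<lambda>\<omega>. \<bar>Y \<omega>\<bar> * \<bar>S n \<omega> - Y \<omega>\<bar>)"
    proof (intro always_eventually allI)
      fix n
      have "norm (expectation (\<lambda>\<omega>. (S n \<omega>)\<^sup>2) - expectation (\<lambda>\<omega>. (Y \<omega>)\<^sup>2)) = norm (expectation (\<lambda>\<omega>. (S n \<omega>)\<^sup>2 - (Y \<omega>)\<^sup>2))"
        using iY centered_gaussian_facts(2)[OF S] by simp
      also have "\<dots> \<le> expectation (\<lambda>\<omega>. (S n \<omega> - Y \<omega>)\<^sup>2 + 2 * (\<bar>Y \<omega>\<bar> * \<bar>S n \<omega> - Y \<omega>\<bar>))"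
      proof (rule order_trans[OF integral_norm_bound], rule integral_mono_AE')
        show "integrable M (\<lambda>\<omega>. (S n \<omega> - Y \<omega>)\<^sup>2 + 2 * (\<bar>Y \<omega>\<bar> * \<bar>S n \<omega> - Y \<omega>\<bar>))"
          by (intro Bochner_Integration.integrable_add integrable_mult_right iD iCS iY) simp
        show "AE \<omega> in M. norm ((S n \<omega>)\<^sup>2 - (Y \<omega>)\<^sup>2) \<le> (S n \<omega> - Y \<omega>)\<^sup>2 + 2 * (\<bar>Y \<omega>\<bar> * \<bar>S n \<omega> - Y \<omega>\<bar>)"
        proof (intro AE_I2)
          fix \<omega>
          have "(S n \<omega>)\<^sup>2 - (Y \<omega>)\<^sup>2 = (S n \<omega> - Y \<omega>)\<^sup>2 + 2 * (Y \<omega> * (S n \<omega> - Y \<omega>))"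
            by (simp add: power2_eq_square algebra_simps)
          also have "\<bar>\<dots>\<bar> \<le> \<bar>(S n \<omega> - Y \<omega>)\<^sup>2\<bar> + \<bar>2 * (Y \<omega> * (S n \<omega> - Y \<omega>))\<bar>" by (rule abs_triangle_ineq)
          finally show "norm ((S n \<omega>)\<^sup>2 - (Y \<omega>)\<^sup>2) \<le> (S n \<omega> - Y \<omega>)\<^sup>2 + 2 * (\<bar>Y \<omega>\<bar> * \<bar>S n \<omega> - Y \<omega>\<bar>)"
            by (simp add: abs_mult)
        qed
      qed auto
      also have "\<dots> = d n + 2 * expectation (\<lambda>\<omega>. \<bar>Y \<omega>\<bar> * \<bar>S n \<omega> - Y \<omega>\<bar>)"
        unfolding d_def using iD[of n] iCS[OF _ iY, of n] by simp
      finally show "norm (expectation (\<lambda>\<omega>. (S n \<omega>)\<^sup>2) - expectation (\<lambda>\<omega>. (Y \<omega>)\<^sup>2)) \<le> \<dots>" .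
    qed
  qed
  show ?thesis
  proof (rule centered_gaussianI_char[OF _ iY])
    fix t
    have ie: "integrable M (\<lambda>\<omega>. iexp (t * V \<omega>))" if "V \<in> borel_measurable M" for V
      using that by (intro integrable_const_bound[where B=1]) auto
    have one: "(\<lambda>n. expectation (\<lambda>\<omega>. \<bar>S n \<omega> - Y \<omega>\<bar>)) \<longlonglongrightarrow> 0" "\<And>n. integrable M (\<lambda>\<omega>. \<bar>S n \<omega> - Y \<omega>\<bar>)"
      using CS[of "\<lambda>_. 1"] iCS[of "\<lambda>_. 1"] by simp_all
    have "(\<lambda>n. expectation (\<lambda>\<omega>. iexp (t * S n \<omega>))) \<longlonglongrightarrow> expectation (\<lambda>\<omega>. iexp (t * Y \<omega>))"
    proof (rule LIM_zero_cancel, rule Lim_null_comparison)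
      show "(\<lambda>n. \<bar>t\<bar> * expectation (\<lambda>\<omega>. \<bar>S n \<omega> - Y \<omega>\<bar>)) \<longlonglongrightarrow> 0"
        using tendsto_mult[OF tendsto_const[of "\<bar>t\<bar>"] one(1)] by simp
      show "\<forall>\<^sub>F n in sequentially. norm (expectation (\<lambda>\<omega>. iexp (t * S n \<omega>)) - expectation (\<lambda>\<omega>. iexp (t * Y \<omega>)))
         \<le> \<bar>t\<bar> * expectation (\<lambda>\<omega>. \<bar>S n \<omega> - Y \<omega>\<bar>)"
      proof (intro always_eventually allI)
        fix n
        have "expectation (\<lambda>\<omega>. iexp (t * S n \<omega>)) - expectation (\<lambda>\<omega>. iexp (t * Y \<omega>)) = expectation (\<lambda>\<omega>. iexp (t * S n \<omega>) - iexp (t * Y \<omega>))"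
          by (intro Bochner_Integration.integral_diff[symmetric] ie) auto
        also have "norm \<dots> \<le> expectation (\<lambda>\<omega>. \<bar>t\<bar> * \<bar>S n \<omega> - Y \<omega>\<bar>)"
        proof (rule order_trans[OF integral_norm_bound], rule integral_mono_AE')
          show "AE \<omega> in M. norm (iexp (t * S n \<omega>) - iexp (t * Y \<omega>)) \<le> \<bar>t\<bar> * \<bar>S n \<omega> - Y \<omega>\<bar>"
          proof (intro AE_I2)
            fix \<omega>
            show "norm (iexp (t * S n \<omega>) - iexp (t * Y \<omega>)) \<le> \<bar>t\<bar> * \<bar>S n \<omega> - Y \<omega>\<bar>"
              using cmod_iexp_diff_le[of "t * S n \<omega>" "t * Y \<omega>"] by (simp only: right_diff_distrib[symmetric] abs_mult)
          qed
        qed (use one(2) in auto)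
        finally show "norm (expectation (\<lambda>\<omega>. iexp (t * S n \<omega>)) - expectation (\<lambda>\<omega>. iexp (t * Y \<omega>)))
           \<le> \<bar>t\<bar> * expectation (\<lambda>\<omega>. \<bar>S n \<omega> - Y \<omega>\<bar>)" by simp
      qed
    qed
    moreover have "(\<lambda>n. expectation (\<lambda>\<omega>. iexp (t * S n \<omega>))) \<longlonglongrightarrow> complex_of_real (exp (- (t\<^sup>2 * expectation (\<lambda>\<omega>. (Y \<omega>)\<^sup>2)) / 2))"
      unfolding centered_gaussian_facts(4)[OF S] by (intro tendsto_intros v) auto
    ultimately show "expectation (\<lambda>\<omega>. iexp (t * Y \<omega>)) = complex_of_real (exp (- (t\<^sup>2 * expectation (\<lambda>\<omega>. (Y \<omega>)\<^sup>2)) / 2))"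
      by (rule LIMSEQ_unique)
  qed simp
qed

end

section \<open>Gaussian fields paired with functions\<close>

lemma same_fdd_second_moment:
  assumes "same_fdd M A B" and [measurable]: "A x \<in> borel_measurable M" "B x \<in> borel_measurable M"
  shows "(LINT \<omega>|M. (A x \<omega>)\<^sup>2) = (LINT \<omega>|M. (B x \<omega>)\<^sup>2)"
proof -
  have eq: "distr M (PiM {x} (\<lambda>_. borel)) (\<lambda>\<omega>. \<lambda>y\<in>{x}. A y \<omega>) = distr M (PiM {x} (\<lambda>_. borel)) (\<lambda>\<omega>. \<lambda>y\<in>{x}. B y \<omega>)"
    using assms(1) unfolding same_fdd_def by blast
  have g: "(\<lambda>p. (p x)\<^sup>2) \<in> borel_measurable (PiM {x} (\<lambda>_. borel :: real measure))"
    by measurable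
  have r: "(\<lambda>\<omega>. \<lambda>y\<in>{x}. V y \<omega>) \<in> M \<rightarrow>\<^sub>M PiM {x} (\<lambda>_. borel)" if "V x \<in> borel_measurable M" for V :: "real^2 \<Rightarrow> 'a \<Rightarrow> real"
    by (rule measurable_restrict) (use that in auto)
  have i: "(LINT p|distr M (PiM {x} (\<lambda>_. borel)) (\<lambda>\<omega>. \<lambda>y\<in>{x}. V y \<omega>). (p x)\<^sup>2) = (LINT \<omega>|M. (V x \<omega>)\<^sup>2)"
    if "V x \<in> borel_measurable M" for V :: "real^2 \<Rightarrow> 'a \<Rightarrow> real"
    by (subst integral_distr[OF r[of V, OF that] g]) simp
  show ?thesis using i[of A] i[of B] assms(2,3) by (simp only: eq)
qed

text \<open>Rounding each coordinate down to a multiple of \<open>1 / (n + 1)\<close>.\<close>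
definition grid :: "nat \<Rightarrow> real^2 \<Rightarrow> real^2" where
  "grid n x = plane (\<lfloor>real (Suc n) * x $ 1\<rfloor> / real (Suc n), \<lfloor>real (Suc n) * x $ 2\<rfloor> / real (Suc n))"

lemma grid_measurable [measurable]: "grid n \<in> borel_measurable borel"
  unfolding grid_def[abs_def] plane_def fst_conv snd_conv by measurable

lemma norm_grid_diff_le: "norm (grid n x - x) \<le> 2 / real (Suc n)"
proof -
  have c: "\<bar>\<lfloor>real (Suc n) * a\<rfloor> / real (Suc n) - a\<bar> \<le> 1 / real (Suc n)" for a
  proof -
    define N where "N = real (Suc n)"
    have N: "0 < N" by (simp add: N_def)
    have "\<lfloor>N * a\<rfloor> / N - a = (\<lfloor>N * a\<rfloor> - N * a) / N" using N by (simp add: field_simps)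
    moreover have "\<bar>\<lfloor>N * a\<rfloor> - N * a\<bar> \<le> 1" by linarith
    ultimately have "\<bar>\<lfloor>N * a\<rfloor> / N - a\<bar> \<le> 1 / N" using N by (simp add: divide_right_mono)
    then show ?thesis by (simp only: N_def)
  qed
  have "norm (grid n x - x) \<le> (\<Sum>i\<in>UNIV. \<bar>(grid n x - x) $ i\<bar>)" by (rule norm_le_l1_cart)
  also have "\<dots> = \<bar>(grid n x - x) $ 1\<bar> + \<bar>(grid n x - x) $ 2\<bar>" by (simp add: sum_2)
  also have "\<dots> \<le> 1 / real (Suc n) + 1 / real (Suc n)"
    unfolding grid_def vector_minus_component plane_nth fst_conv snd_conv by (intro add_mono c)
  finally show ?thesis by simp
qed

lemma countable_range_grid: "countable (range (grid n))"
proof -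
  have "range (grid n) \<subseteq> range (\<lambda>p :: int \<times> int. plane (of_int (fst p) / real (Suc n), of_int (snd p) / real (Suc n)))"
  proof (rule image_subsetI)
    fix x :: "real^2"
    show "grid n x \<in> range (\<lambda>p :: int \<times> int. plane (of_int (fst p) / real (Suc n), of_int (snd p) / real (Suc n)))"
      by (rule range_eqI[of _ _ "(\<lfloor>real (Suc n) * x $ 1\<rfloor>, \<lfloor>real (Suc n) * x $ 2\<rfloor>)"]) (simp add: grid_def)
  qed
  then show ?thesis using countable_subset by blast
qed

lemma finite_grid_ball: "finite (grid n ` ball 0 r)"
proof -
  define B where "B = {- \<lceil>real (Suc n) * r\<rceil> - 1 .. \<lceil>real (Suc n) * r\<rceil>}"
  have "grid n ` ball 0 r \<subseteq> (\<lambda>p. plane (of_int (fst p) / real (Suc n), of_int (snd p) / real (Suc n))) ` (B \<times> B)"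
  proof (rule image_subsetI)
    fix x :: "real^2" assume "x \<in> ball 0 r"
    then have "\<bar>x $ i\<bar> \<le> r" for i using component_le_norm_cart[of x i] by simp
    then have "\<bar>real (Suc n) * x $ i\<bar> \<le> real (Suc n) * r" for i
      unfolding abs_mult by (intro mult_mono) auto
    moreover have "- \<lceil>b\<rceil> - 1 \<le> \<lfloor>a\<rfloor>" "\<lfloor>a\<rfloor> \<le> \<lceil>b\<rceil>" if "\<bar>a\<bar> \<le> b" for a b :: real
      using that by linarith+
    ultimately have "\<lfloor>real (Suc n) * x $ i\<rfloor> \<in> B" for i
      unfolding B_def by (simp only: atLeastAtMost_iff)
    then show "grid n x \<in> (\<lambda>p. plane (of_int (fst p) / real (Suc n), of_int (snd p) / real (Suc n))) ` (B \<times> B)"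
      unfolding grid_def by (intro image_eqI[of _ _ "(\<lfloor>real (Suc n) * x $ 1\<rfloor>, \<lfloor>real (Suc n) * x $ 2\<rfloor>)"]) auto
  qed
  moreover have "finite (B \<times> B)" by (simp add: B_def)
  ultimately show ?thesis using finite_surj by blast
qed

lemma grid_measurable_count: "grid n \<in> borel \<rightarrow>\<^sub>M count_space (range (grid n))"
proof -
  have "grid n -` {a} \<inter> space borel \<in> sets borel" for a
    using measurable_sets[OF grid_measurable, of "{a}" n] by simp
  then show ?thesis by (subst measurable_count_space_eq_countable[OF countable_range_grid]) auto
qed

text \<open>The rounded point takes countably many values, and for each of them the field is a
  single random variable; so joint measurability holds although the field itself need not be jointly
  measurable.\<close>

lemma field_grid_measurable:
  assumes "\<And>x. X x \<in> borel_measurable M"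
  shows "(\<lambda>p. X (grid n (fst p)) (snd p) :: real) \<in> borel_measurable (lborel \<Otimes>\<^sub>M M)"
proof (rule measurable_compose_countable'[where f="\<lambda>y p. X y (snd p)" and g="\<lambda>p. grid n (fst p)", OF _ _ countable_range_grid])
  show "(\<lambda>p. X y (snd p)) \<in> borel_measurable (lborel \<Otimes>\<^sub>M M)" for y
    using assms[of y] by measurable
  show "(\<lambda>p. grid n (fst p)) \<in> lborel \<Otimes>\<^sub>M M \<rightarrow>\<^sub>M count_space (range (grid n))"
    by (rule measurable_compose[OF measurable_fst]) (use grid_measurable_count in simp)
qed

locale gaussian_field = prob_space M for M :: "'w measure" +
  fixes X :: "real^2 \<Rightarrow> 'w \<Rightarrow> real" and H :: real and f :: "real^2 \<Rightarrow> real"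
  assumes H: "0 < H" "H < 1"
    and gaussian: "centered_gaussian_field M X"
    and continuous: "stochastically_continuous M X"
    and increments: "stationary_increments M X"
    and selfsimilar: "self_similar M H X"
    and spectral: "spectral_density M X f"
begin

section \<open>The variance function\<close>

lemma X_gaussian: "centered_gaussian M (X x)"
  using gaussian[unfolded centered_gaussian_field_def, rule_format, of "{x}" "\<lambda>_. 1"] by simp

lemma X_measurable [measurable]: "X x \<in> borel_measurable M"
  by (rule centered_gaussian_facts(1)[OF X_gaussian])

lemma X_square_integrable: "integrable M (\<lambda>\<omega>. (X x \<omega>)\<^sup>2)"
  by (rule centered_gaussian_facts(2)[OF X_gaussian])

lemma X_diff_square_integrable: "integrable M (\<lambda>\<omega>. (X x \<omega> - X y \<omega>)\<^sup>2)"
proof (rule Bochner_Integration.integrable_bound)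
  show "integrable M (\<lambda>\<omega>. 2 * (X x \<omega>)\<^sup>2 + 2 * (X y \<omega>)\<^sup>2)"
    using X_square_integrable by simp
  have "(a - b)\<^sup>2 \<le> 2 * a\<^sup>2 + 2 * b\<^sup>2" for a b :: real
    using zero_le_power2[of "a + b"] by (simp add: power2_eq_square algebra_simps)
  then show "AE \<omega> in M. norm ((X x \<omega> - X y \<omega>)\<^sup>2) \<le> norm (2 * (X x \<omega>)\<^sup>2 + 2 * (X y \<omega>)\<^sup>2)"
    by simp
qed measurable

text \<open>By stationarity of the increments this variance is at the same time the variogram, as
  \<open>v_diff\<close> records.\<close>

definition v :: "real^2 \<Rightarrow> real" where
  "v x = expectation (\<lambda>\<omega>. (X x \<omega>)\<^sup>2)"

lemma v_nonneg: "0 \<le> v x"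
  unfolding v_def by (rule integral_nonneg_AE) auto

lemma v_increment: "expectation (\<lambda>\<omega>. (X (x + h) \<omega> - X x \<omega>)\<^sup>2) = v h"
  unfolding v_def
  by (rule same_fdd_second_moment[of M "\<lambda>h \<omega>. X (x + h) \<omega> - X x \<omega>"])
     (use increments in \<open>auto simp: stationary_increments_def\<close>)

lemma v_diff: "expectation (\<lambda>\<omega>. (X y \<omega> - X x \<omega>)\<^sup>2) = v (y - x)"
  using v_increment[of x "y - x"] by simp

lemma v_scale:
  assumes "0 < c"
  shows "v (c *\<^sub>R x) = c powr (2 * H) * v x"
proof -
  have "v (c *\<^sub>R x) = expectation (\<lambda>\<omega>. (c powr H * X x \<omega>)\<^sup>2)"
    unfolding v_def
    by (rule same_fdd_second_moment[of M "\<lambda>x. X (c *\<^sub>R x)"])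
       (use selfsimilar assms in \<open>auto simp: self_similar_def\<close>)
  then show ?thesis
    using assms by (simp add: v_def power_mult_distrib powr_power mult.commute)
qed

text \<open>The factor exp 0 - 1 kills the spectral integrand at the origin.\<close>

lemma v_0: "v 0 = 0"
proof -
  have "complex_of_real (expectation (\<lambda>\<omega>. X 0 \<omega> * X 0 \<omega>)) = (LINT \<xi>|lborel. (exp (\<i> * complex_of_real (0 \<bullet> \<xi>)) - 1) *
          (exp (- (\<i> * complex_of_real (0 \<bullet> \<xi>))) - 1) * complex_of_real (f \<xi>))"
    using spectral unfolding spectral_density_def by blast
  then show ?thesis by (simp add: v_def power2_eq_square)
qed

lemma v_continuous: "continuous_on UNIV v"
proof -
  have "continuous_on UNIV (\<lambda>x. (\<lambda>(x, y). expectation (\<lambda>\<omega>. X x \<omega> * X y \<omega>)) (x, x))"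
    by (rule continuous_on_compose2[OF continuous[unfolded stochastically_continuous_def]])
       (auto intro!: continuous_intros)
  then show ?thesis by (simp add: v_def[abs_def] power2_eq_square)
qed

text \<open>Self-similarity reduces the bound to the unit circle, where continuity and compactness
  give it.\<close>

lemma v_bound: "\<exists>K\<ge>0. \<forall>x. v x \<le> K * (weight H x)\<^sup>2"
proof -
  have "compact (v ` sphere 0 1)"
    by (intro compact_continuous_image continuous_on_subset[OF v_continuous]) auto
  then obtain K where "\<forall>y\<in>v ` sphere 0 1. \<bar>y\<bar> \<le> K"
    using compact_imp_bounded bounded_real by metis
  then have K: "v x \<le> K" if "x \<in> sphere 0 1" for x
    using that by (auto dest: abs_le_D1)
  define K' where "K' = max K 0"
  have "v x \<le> K' * (weight H x)\<^sup>2" for x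
  proof (cases "x = 0")
    case True
    then show ?thesis by (simp add: v_0 K'_def)
  next
    case False
    then have "v x = norm x powr (2 * H) * v (x /\<^sub>R norm x)"
      using v_scale[of "norm x" "x /\<^sub>R norm x"] by simp
    also have "\<dots> \<le> norm x powr (2 * H) * K'"
      using K[of "x /\<^sub>R norm x"] False by (intro mult_left_mono) (auto simp: K'_def)
    also have "\<dots> \<le> (1 + norm x) powr (2 * H) * K'"
      using H by (intro mult_right_mono powr_mono2) (auto simp: K'_def)
    also have "\<dots> = K' * (weight H x)\<^sup>2"
      by (simp add: weight_def power2_eq_square mult.commute flip: powr_add mult_2)
    finally show ?thesis .
  qed
  then show ?thesis by (intro exI[of _ K']) (auto simp: K'_def)
qed

section \<open>A jointly measurable version of the field\<close>

lemma nn_integral_X_diff: "(\<integral>\<^sup>+\<omega>. ennreal ((X x \<omega> - X y \<omega>)\<^sup>2) \<partial>M) = ennreal (v (x - y))"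
  by (simp add: nn_integral_eq_integral X_diff_square_integrable v_diff)

text \<open>Discretised fields are jointly measurable. Along grids so fine that the mean square
  error is at most 4^-k the squared errors are almost surely summable, hence the discretisations
  converge to the field at each fixed point.\<close>

lemma measurable_version_exists:
  "\<exists>Y. jointly_measurable M Y \<and> (\<forall>x. AE \<omega> in M. Y x \<omega> = X x \<omega>)"
proof -
  have "\<exists>n. \<forall>h. norm h \<le> 2 / real (Suc n) \<longrightarrow> v h \<le> (1 / 4) ^ k" for k :: nat
  proof -
    have "isCont v 0" using v_continuous by (simp add: continuous_on_eq_continuous_at)
    then obtain d where d: "0 < d" "\<And>h. norm h < d \<Longrightarrow> v h < (1 / 4) ^ k"
      using order_tendstoD(2)[of v "v 0" "at 0" "(1 / 4) ^ k"]
      unfolding continuous_at_eps_delta dist_norm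
      by (metis diff_zero v_0 v_nonneg abs_of_nonneg real_norm_def zero_less_divide_1_iff zero_less_numeral zero_less_power)
    obtain n where n: "2 / d < real (Suc n)" using reals_Archimedean2[of "2 / d"] by (metis less_trans lessI of_nat_less_iff)
    then have "2 / real (Suc n) < d" using d(1) by (simp add: field_simps)
    then show ?thesis using d(2) by (intro exI[of _ n]) (auto intro!: less_imp_le)
  qed
  then obtain n where n: "\<And>k h. norm h \<le> 2 / real (Suc (n k)) \<Longrightarrow> v h \<le> (1 / 4) ^ k" by metis
  define A where "A k p = X (grid (n k) (fst p)) (snd p)" for k p
  have [measurable]: "A k \<in> borel_measurable (lborel \<Otimes>\<^sub>M M)" for k
    unfolding A_def by (rule field_grid_measurable) simp
  \<comment> \<open>\<open>lim\<close> has an unspecified value where the discretisations diverge;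
    for each fixed x this happens only on a null set.\<close>
  define Y where "Y x \<omega> = lim (\<lambda>k. A k (x, \<omega>))" for x \<omega>
  have "(\<lambda>p. lim (\<lambda>k. A k p)) \<in> borel_measurable (lborel \<Otimes>\<^sub>M M)"
    by (rule borel_measurable_lim_metric) simp
  then have "jointly_measurable M Y"
    by (simp add: jointly_measurable_def Y_def case_prod_beta')
  moreover have "AE \<omega> in M. Y x \<omega> = X x \<omega>" for x
  proof -
    define d where "d k \<omega> = (X (grid (n k) x) \<omega> - X x \<omega>)\<^sup>2" for k \<omega>
    have [measurable]: "d k \<in> borel_measurable M" for k unfolding d_def by measurable
    have "(\<integral>\<^sup>+\<omega>. (\<Sum>k. ennreal (d k \<omega>)) \<partial>M) = (\<Sum>k. \<integral>\<^sup>+\<omega>. ennreal (d k \<omega>) \<partial>M)"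
      by (rule nn_integral_suminf) simp
    also have "\<dots> \<le> (\<Sum>k. ennreal ((1 / 4) ^ k))"
      by (rule suminf_le) (auto simp: d_def nn_integral_X_diff intro!: ennreal_leI n norm_grid_diff_le)
    also have "\<dots> < \<infinity>" by (subst suminf_ennreal2) (auto intro: summable_geometric)
    finally have "AE \<omega> in M. (\<Sum>k. ennreal (d k \<omega>)) \<noteq> \<infinity>"
      by (intro nn_integral_PInf_AE) auto
    then show ?thesis
    proof eventually_elim
      case (elim \<omega>)
      then have "summable (\<lambda>k. d k \<omega>)"
        by (intro summable_suminf_not_top) (auto simp: d_def)
      then have "(\<lambda>k. sqrt (d k \<omega>)) \<longlonglongrightarrow> sqrt 0" by (intro tendsto_real_sqrt summable_LIMSEQ_zero)
      then have "(\<lambda>k. X (grid (n k) x) \<omega> - X x \<omega>) \<longlonglongrightarrow> 0"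
        by (simp add: d_def tendsto_rabs_zero_iff)
      then have "(\<lambda>k. A k (x, \<omega>)) \<longlonglongrightarrow> X x \<omega>"
        unfolding A_def by (simp add: LIM_zero_iff)
      then show ?case by (simp add: Y_def limI)
    qed
  qed
  ultimately show ?thesis by blast
qed

definition X' :: "real^2 \<Rightarrow> 'w \<Rightarrow> real" where "X' = measurable_version M X"

lemma X'_version: "jointly_measurable M X'" "AE \<omega> in M. X' x \<omega> = X x \<omega>"
proof -
  have "jointly_measurable M X' \<and> (\<forall>x. AE \<omega> in M. X' x \<omega> = X x \<omega>)"
    unfolding X'_def measurable_version_def using someI_ex[OF measurable_version_exists] by auto
  then show "jointly_measurable M X'" "AE \<omega> in M. X' x \<omega> = X x \<omega>" by auto
qed

text \<open>Chance comes first and space second, as in the abstract setting of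
  \<open>second_moment_le\<close>.\<close>

definition Z :: "'w \<times> (real^2) \<Rightarrow> complex" where "Z p = complex_of_real (X' (snd p) (fst p))"

lemma X'_joint_measurable [measurable]: "(\<lambda>p. X' (snd p) (fst p)) \<in> borel_measurable (M \<Otimes>\<^sub>M lborel)"
  using measurable_compose[OF measurable_pair_swap' X'_version(1)[unfolded jointly_measurable_def]]
  by (simp add: case_prod_beta')

lemma Z_measurable [measurable]: "Z \<in> borel_measurable (M \<Otimes>\<^sub>M lborel)"
  unfolding Z_def by measurable

lemma X'_measurable [measurable]: "X' x \<in> borel_measurable M"
  using measurable_compose[OF measurable_Pair1'[of x lborel M] X'_version(1)[unfolded jointly_measurable_def]] by simp

lemma Z_second_moment: "(\<integral>\<^sup>+\<omega>. ennreal ((cmod (Z (\<omega>, x)))\<^sup>2) \<partial>M) = ennreal (v x)"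
proof -
  have "(\<integral>\<^sup>+\<omega>. ennreal ((cmod (Z (\<omega>, x)))\<^sup>2) \<partial>M) = (\<integral>\<^sup>+\<omega>. ennreal ((X x \<omega>)\<^sup>2) \<partial>M)"
    by (rule nn_integral_cong_AE) (use X'_version(2)[of x] in \<open>auto simp: Z_def\<close>)
  then show ?thesis by (simp add: nn_integral_eq_integral X_square_integrable v_def)
qed

text \<open>Fixed once and for all, because the same constant bounds the second moments of the field
  and of the spectral kernel.\<close>

definition K :: real where "K = (SOME K. 0 \<le> K \<and> (\<forall>x. v x \<le> K * (weight H x)\<^sup>2))"

lemma K: "0 \<le> K" "v x \<le> K * (weight H x)\<^sup>2"
  using someI_ex[OF v_bound[unfolded Bex_def]] v_bound unfolding K_def by (metis (mono_tags, lifting) someI_ex)+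

lemma Z_bound: "(\<integral>\<^sup>+\<omega>. ennreal ((cmod (Z (\<omega>, x)))\<^sup>2) \<partial>M) \<le> ennreal (K * (weight H x)\<^sup>2)"
  unfolding Z_second_moment by (rule ennreal_leI) (rule K)

definition I :: "(real^2 \<Rightarrow> real) \<Rightarrow> 'w \<Rightarrow> real" where
  "I \<gamma> \<omega> = (LINT x|lborel. \<gamma> x * X' x \<omega>)"

lemma I_complex: "(LINT x|lborel. complex_of_real (\<gamma> x) * Z (\<omega>, x)) = complex_of_real (I \<gamma> \<omega>)"
  unfolding I_def integral_complex_of_real[symmetric] by (simp add: Z_def)

lemma I_measurable [measurable]:
  assumes [measurable]: "\<gamma> \<in> borel_measurable borel"
  shows "I \<gamma> \<in> borel_measurable M"
  unfolding I_def by (rule lborel.borel_measurable_lebesgue_integral) measurable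

lemma AE_integrable:
  assumes "weighted_integrable H \<gamma>"
  shows "AE \<omega> in M. integrable lborel (\<lambda>x. \<gamma> x * X' x \<omega>)"
  using AE_field_integrable[OF sigma_finite_measure_axioms Z_measurable K(1) Z_bound assms]
proof eventually_elim
  case (elim \<omega>)
  from integrable_Re[OF this] show ?case by (simp add: Z_def)
qed

lemma weighted_integrable_integrable:
  assumes "weighted_integrable H \<gamma>"
  shows "integrable lborel \<gamma>"
proof (rule Bochner_Integration.integrable_bound)
  show "integrable lborel (\<lambda>x. weight H x * \<bar>\<gamma> x\<bar>)" using assms by (simp add: weighted_integrable_def)
  show "\<gamma> \<in> borel_measurable lborel" using assms by (simp add: weighted_integrable_def)
  have "1 \<le> weight H x" for x using H by (simp add: weight_def ge_one_powr_ge_zero)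
  then show "AE x in lborel. norm (\<gamma> x) \<le> norm (weight H x * \<bar>\<gamma> x\<bar>)"
    by (intro AE_I2) (simp add: abs_mult mult_le_cancel_right1 order_trans[OF _ abs_ge_self])
qed

end

context gaussian_field
begin

section \<open>Riemann sums and Gaussianity of the pairing\<close>

text \<open>The test function keeps its exact values; only the field is discretised, and cut off to
  a ball so that finitely many grid points occur.\<close>

definition S :: "(real^2 \<Rightarrow> real) \<Rightarrow> nat \<Rightarrow> 'w \<Rightarrow> real" where
  "S \<gamma> n \<omega> = (LINT x|lborel. \<gamma> x * (indicator (ball 0 (real n)) x * X' (grid n x) \<omega>))"

definition cell :: "nat \<Rightarrow> real^2 \<Rightarrow> (real^2) set" where
  "cell n p = ball 0 (real n) \<inter> grid n -` {p}"

lemma cell_measurable [measurable]: "cell n p \<in> sets borel"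
proof -
  have "grid n -` {p} \<in> sets borel"
    using measurable_sets[OF grid_measurable, of "{p}" n] by simp
  then show ?thesis unfolding cell_def by (rule sets.Int[OF borel_open[OF open_ball]])
qed

lemma S_integrand:
  "\<gamma> x * (indicator (ball 0 (real n)) x * X' (grid n x) \<omega>)
    = (\<Sum>p\<in>grid n ` ball 0 (real n). X' p \<omega> * (indicator (cell n p) x * \<gamma> x))"
proof (cases "x \<in> ball 0 (real n)")
  case True
  have "(\<Sum>p\<in>grid n ` ball 0 (real n). X' p \<omega> * (indicator (cell n p) x * \<gamma> x))
     = (\<Sum>p\<in>grid n ` ball 0 (real n). if p = grid n x then X' p \<omega> * \<gamma> x else 0)"
    by (rule sum.cong) (use True in \<open>auto simp: cell_def indicator_def\<close>)
  also have "\<dots> = X' (grid n x) \<omega> * \<gamma> x"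
    using True finite_grid_ball[of n "real n"] by (subst sum.delta) auto
  finally show ?thesis using True by simp
next
  case False
  then show ?thesis by (simp add: cell_def)
qed

lemma S_integrable:
  assumes "weighted_integrable H \<gamma>"
  shows "integrable lborel (\<lambda>x. \<gamma> x * (indicator (ball 0 (real n)) x * X' (grid n x) \<omega>))"
    and "S \<gamma> n \<omega> = (\<Sum>p\<in>grid n ` ball 0 (real n). (LINT x|lborel. indicator (cell n p) x * \<gamma> x) * X' p \<omega>)"
proof -
  have i: "integrable lborel (\<lambda>x. indicator (cell n p) x * \<gamma> x)" for p
    by (rule integrable_real_mult_indicator[where f=\<gamma>, unfolded mult.commute[of "\<gamma> _"]])
       (use weighted_integrable_integrable[OF assms] in auto)
  show "integrable lborel (\<lambda>x. \<gamma> x * (indicator (ball 0 (real n)) x * X' (grid n x) \<omega>))"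
    unfolding S_integrand using i by simp
  show "S \<gamma> n \<omega> = (\<Sum>p\<in>grid n ` ball 0 (real n). (LINT x|lborel. indicator (cell n p) x * \<gamma> x) * X' p \<omega>)"
    unfolding S_def S_integrand using i by (simp add: mult.commute)
qed

text \<open>The sum is a finite linear combination of field values, and the measurable version
  agrees with the field almost surely at the finitely many grid points involved.\<close>

lemma S_gaussian:
  assumes "weighted_integrable H \<gamma>"
  shows "centered_gaussian M (S \<gamma> n)"
proof -
  let ?G = "grid n ` ball 0 (real n)"
  let ?c = "\<lambda>p. LINT x|lborel. indicator (cell n p) x * \<gamma> x"
  have "centered_gaussian M (\<lambda>\<omega>. \<Sum>p\<in>?G. ?c p * X p \<omega>)"
    by (rule gaussian[unfolded centered_gaussian_field_def, rule_format, OF finite_grid_ball])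
  moreover have "AE \<omega> in M. (\<Sum>p\<in>?G. ?c p * X p \<omega>) = S \<gamma> n \<omega>"
  proof -
    have "AE \<omega> in M. \<forall>p\<in>?G. X' p \<omega> = X p \<omega>"
      using X'_version(2) finite_grid_ball by (subst AE_finite_all) auto
    then show ?thesis
      unfolding S_integrable(2)[OF assms] by eventually_elim (auto intro!: sum.cong)
  qed
  moreover have "S \<gamma> n \<in> borel_measurable M"
    unfolding S_integrable(2)[OF assms] by measurable
  ultimately show ?thesis by (rule centered_gaussian_cong_AE)
qed

text \<open>The discretisation error as a field of its own, so that \<open>second_moment_le\<close>
  bounds the mean square error of the Riemann sums. Outside the ball it is the whole field.\<close>

definition Zn :: "nat \<Rightarrow> 'w \<times> (real^2) \<Rightarrow> complex" where
  "Zn n p = complex_of_real (X' (snd p) (fst p) - indicator (ball 0 (real n)) (snd p) * X' (grid n (snd p)) (fst p))"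

lemma Zn_measurable [measurable]: "Zn n \<in> borel_measurable (M \<Otimes>\<^sub>M lborel)"
proof -
  have "(\<lambda>p. X' (grid n (fst p)) (snd p)) \<in> borel_measurable (lborel \<Otimes>\<^sub>M M)"
    by (rule field_grid_measurable) simp
  from measurable_compose[OF measurable_pair_swap' this]
  have [measurable]: "(\<lambda>p. X' (grid n (snd p)) (fst p)) \<in> borel_measurable (M \<Otimes>\<^sub>M lborel)"
    by (simp add: case_prod_beta')
  have [measurable]: "ball (0::real^2) (real n) \<in> sets borel" by simp
  show ?thesis unfolding Zn_def[abs_def] by measurable
qed

lemma Zn_second_moment:
  "(\<integral>\<^sup>+\<omega>. ennreal ((cmod (Zn n (\<omega>, x)))\<^sup>2) \<partial>M) = ennreal (if x \<in> ball 0 (real n) then v (x - grid n x) else v x)"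
proof (cases "x \<in> ball 0 (real n)")
  case True
  have "(\<integral>\<^sup>+\<omega>. ennreal ((cmod (Zn n (\<omega>, x)))\<^sup>2) \<partial>M) = (\<integral>\<^sup>+\<omega>. ennreal ((X x \<omega> - X (grid n x) \<omega>)\<^sup>2) \<partial>M)"
  proof (rule nn_integral_cong_AE, use X'_version(2)[of x] X'_version(2)[of "grid n x"] in eventually_elim)
    case (elim \<omega>)
    then show ?case using True unfolding Zn_def fst_conv snd_conv norm_of_real power2_abs by simp
  qed
  then show ?thesis using True by (simp add: nn_integral_X_diff)
next
  case False
  then have "Zn n (\<omega>, x) = Z (\<omega>, x)" for \<omega> by (simp add: Zn_def Z_def)
  then show ?thesis using Z_second_moment[of x] False by simp
qed

text \<open>Rounding displaces a point by at most 2, so the weight of the displacement is at most 3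
  and 9 = 3^2 appears. Outside the ball the original bound is weaker than the claim.\<close>

lemma Zn_bound: "(\<integral>\<^sup>+\<omega>. ennreal ((cmod (Zn n (\<omega>, x)))\<^sup>2) \<partial>M) \<le> ennreal (9 * K * (weight H x)\<^sup>2)"
proof -
  have w1: "1 \<le> weight H x" for x using H by (simp add: weight_def ge_one_powr_ge_zero)
  have sq1: "1 \<le> (weight H x)\<^sup>2" using w1[of x] by (simp add: one_le_power)
  have "norm (x - grid n x) \<le> 2"
    by (subst norm_minus_commute, rule order_trans[OF norm_grid_diff_le]) (simp add: divide_le_eq)
  then have "weight H (x - grid n x) \<le> 3 powr 1"
    unfolding weight_def using H by (intro order_trans[OF powr_mono[of H 1]] powr_mono2) auto
  then have "(weight H (x - grid n x))\<^sup>2 \<le> 3\<^sup>2"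
    using weight_pos[of H "x - grid n x"] by (intro power_mono) auto
  then have "K * (weight H (x - grid n x))\<^sup>2 \<le> K * 9" using K(1) by (intro mult_left_mono) auto
  also have "\<dots> \<le> K * 9 * (weight H x)\<^sup>2" using K(1) sq1 by (simp add: mult_le_cancel_left1)
  finally have "v (x - grid n x) \<le> 9 * K * (weight H x)\<^sup>2" using K(2)[of "x - grid n x"] by simp
  moreover have "v x \<le> 9 * K * (weight H x)\<^sup>2"
    using K(2)[of x] mult_nonneg_nonneg[OF K(1) zero_le_power2[of "weight H x"]] by linarith
  ultimately show ?thesis unfolding Zn_second_moment by (intro ennreal_leI) auto
qed

lemma Zn_tendsto: "(\<lambda>n. \<integral>\<^sup>+\<omega>. ennreal ((cmod (Zn n (\<omega>, x)))\<^sup>2) \<partial>M) \<longlonglongrightarrow> 0"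
proof -
  have "(\<lambda>n. x - grid n x) \<longlonglongrightarrow> 0"
  proof (rule Lim_null_comparison)
    show "\<forall>\<^sub>F n in sequentially. norm (x - grid n x) \<le> 2 * (1 / real (Suc n))"
      using norm_grid_diff_le[of _ x] by (simp add: norm_minus_commute)
    show "(\<lambda>n. 2 * (1 / real (Suc n))) \<longlonglongrightarrow> 0"
      using tendsto_mult[OF tendsto_const[of 2] LIMSEQ_Suc[OF lim_1_over_n[where 'a=real]]] by simp
  qed
  moreover have "isCont v 0" using v_continuous by (simp add: continuous_on_eq_continuous_at)
  ultimately have "(\<lambda>n. v (x - grid n x)) \<longlonglongrightarrow> v 0" by (rule isCont_tendsto_compose[rotated])
  then have "(\<lambda>n. ennreal (v (x - grid n x))) \<longlonglongrightarrow> 0"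
    using tendsto_ennrealI[of "\<lambda>n. v (x - grid n x)" "v 0" sequentially] by (simp add: v_0)
  moreover have "\<forall>\<^sub>F n in sequentially. (\<integral>\<^sup>+\<omega>. ennreal ((cmod (Zn n (\<omega>, x)))\<^sup>2) \<partial>M) = ennreal (v (x - grid n x))"
  proof -
    have "\<forall>\<^sub>F n in sequentially. norm x < real n"
      using eventually_gt_at_top[of "nat \<lceil>norm x\<rceil>"] by eventually_elim linarith
    then show ?thesis by eventually_elim (simp add: Zn_second_moment)
  qed
  ultimately show ?thesis by (subst tendsto_cong)
qed

text \<open>The pairing is a mean square limit of Gaussian Riemann sums. The error is bounded by a
  space integral of the second moments of \<open>Zn\<close>, which tend to 0 pointwise and are
  dominated through \<open>Zn_bound\<close> by a multiple of the integrable
  \<open>weight H x * \<bar>\<gamma> x\<bar>\<close>.\<close>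

lemma I_gaussian:
  assumes \<gamma>: "weighted_integrable H \<gamma>"
  shows "centered_gaussian M (I \<gamma>)"
proof (rule centered_gaussian_limit[OF S_gaussian[OF \<gamma>]])
  have m[measurable]: "\<gamma> \<in> borel_measurable borel" using \<gamma> by (simp add: weighted_integrable_def)
  show "I \<gamma> \<in> borel_measurable M" by measurable
  let ?W = "\<integral>\<^sup>+x. ennreal (weight H x * \<bar>\<gamma> x\<bar>) \<partial>lborel"
  have W: "?W < \<infinity>"
    using \<gamma> weight_pos[of H] by (simp add: weighted_integrable_def integrable_iff_bounded abs_mult less_imp_le)
  let ?m = "\<lambda>n x. \<integral>\<^sup>+\<omega>. ennreal ((cmod (Zn n (\<omega>, x)))\<^sup>2) \<partial>M"
  have mm[measurable]: "(\<lambda>x. ?m n x) \<in> borel_measurable lborel" for n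
  proof -
    have [measurable]: "(\<lambda>p. Zn n (snd p, fst p)) \<in> borel_measurable (lborel \<Otimes>\<^sub>M M)"
      using measurable_compose[OF measurable_pair_swap' Zn_measurable[of n]] by (simp add: case_prod_beta')
    have "(\<lambda>x. \<integral>\<^sup>+\<omega>. ennreal ((cmod (Zn n (snd (x, \<omega>), fst (x, \<omega>))))\<^sup>2) \<partial>M) \<in> borel_measurable lborel"
      by (rule borel_measurable_nn_integral) (simp add: case_prod_beta')
    then show ?thesis by simp
  qed
  have lim: "(\<lambda>n. \<integral>\<^sup>+x. ennreal (\<bar>\<gamma> x\<bar> / weight H x) * ?m n x \<partial>lborel) \<longlonglongrightarrow> (\<integral>\<^sup>+(x::real^2). 0 \<partial>lborel)"
  proof (rule nn_integral_dominated_convergence[where w="\<lambda>x. ennreal (9 * K) * ennreal (weight H x * \<bar>\<gamma> x\<bar>)"])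
    show "(\<integral>\<^sup>+x. ennreal (9 * K) * ennreal (weight H x * \<bar>\<gamma> x\<bar>) \<partial>lborel) < \<infinity>"
      using W by (simp add: nn_integral_cmult ennreal_mult_less_top)
    show "AE x in lborel. ennreal (\<bar>\<gamma> x\<bar> / weight H x) * ?m n x \<le> ennreal (9 * K) * ennreal (weight H x * \<bar>\<gamma> x\<bar>)" for n
    proof (intro AE_I2)
      fix x
      have "ennreal (\<bar>\<gamma> x\<bar> / weight H x) * ?m n x \<le> ennreal (\<bar>\<gamma> x\<bar> / weight H x) * ennreal (9 * K * (weight H x)\<^sup>2)"
        by (intro mult_left_mono Zn_bound) simp
      also have "\<dots> = ennreal (9 * K) * ennreal (weight H x * \<bar>\<gamma> x\<bar>)"
        using weight_pos[of H x] K(1) by (simp add: power2_eq_square field_simps flip: ennreal_mult)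
      finally show "ennreal (\<bar>\<gamma> x\<bar> / weight H x) * ?m n x \<le> \<dots>" .
    qed
    show "AE x in lborel. (\<lambda>n. ennreal (\<bar>\<gamma> x\<bar> / weight H x) * ?m n x) \<longlonglongrightarrow> 0"
      by (intro AE_I2 tendsto_0_ennreal_cmult Zn_tendsto) simp
  qed measurable
  show "(\<lambda>n. \<integral>\<^sup>+\<omega>. ennreal ((S \<gamma> n \<omega> - I \<gamma> \<omega>)\<^sup>2) \<partial>M) \<longlonglongrightarrow> 0"
  proof (rule tendsto_0_ennreal_le)
    show "(\<lambda>n. ?W * (\<integral>\<^sup>+x. ennreal (\<bar>\<gamma> x\<bar> / weight H x) * ?m n x \<partial>lborel)) \<longlonglongrightarrow> 0"
      by (rule tendsto_0_ennreal_cmult[OF _ W]) (use lim in simp)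
    fix n
    have "(\<integral>\<^sup>+\<omega>. ennreal ((S \<gamma> n \<omega> - I \<gamma> \<omega>)\<^sup>2) \<partial>M)
      \<le> (\<integral>\<^sup>+\<omega>. (\<integral>\<^sup>+x. ennreal (cmod (complex_of_real (\<gamma> x) * Zn n (\<omega>, x))) \<partial>lborel)\<^sup>2 \<partial>M)"
    proof (rule nn_integral_mono_AE, use AE_integrable[OF \<gamma>] in eventually_elim)
      case (elim \<omega>)
      let ?s = "\<lambda>x. \<gamma> x * (indicator (ball 0 (real n)) x * X' (grid n x) \<omega>)"
      note i = Bochner_Integration.integrable_diff[OF elim S_integrable(1)[OF \<gamma>, of n \<omega>]]
      have "I \<gamma> \<omega> - S \<gamma> n \<omega> = (LINT x|lborel. \<gamma> x * X' x \<omega> - ?s x)"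
        unfolding I_def S_def by (rule Bochner_Integration.integral_diff[symmetric, OF elim S_integrable(1)[OF \<gamma>]])
      then have "ennreal \<bar>I \<gamma> \<omega> - S \<gamma> n \<omega>\<bar> \<le> (\<integral>\<^sup>+x. ennreal (norm (\<gamma> x * X' x \<omega> - ?s x)) \<partial>lborel)"
        using integral_norm_bound_ennreal[OF i] by simp
      also have "\<dots> = (\<integral>\<^sup>+x. ennreal (cmod (complex_of_real (\<gamma> x) * Zn n (\<omega>, x))) \<partial>lborel)"
      proof (intro nn_integral_cong)
        fix x
        have "complex_of_real (\<gamma> x) * Zn n (\<omega>, x) = complex_of_real (\<gamma> x * X' x \<omega> - ?s x)"
          by (simp add: Zn_def right_diff_distrib)
        then show "ennreal (norm (\<gamma> x * X' x \<omega> - ?s x)) = ennreal (cmod (complex_of_real (\<gamma> x) * Zn n (\<omega>, x)))"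
          by (simp only: norm_of_real real_norm_def)
      qed
      finally have "(ennreal \<bar>I \<gamma> \<omega> - S \<gamma> n \<omega>\<bar>)\<^sup>2 \<le> (\<integral>\<^sup>+x. ennreal (cmod (complex_of_real (\<gamma> x) * Zn n (\<omega>, x))) \<partial>lborel)\<^sup>2"
        by (rule power_mono) simp
      then show ?case by (simp add: ennreal_power power2_commute)
    qed
    also have "\<dots> \<le> ?W * (\<integral>\<^sup>+x. ennreal (\<bar>\<gamma> x\<bar> / weight H x) * ?m n x \<partial>lborel)"
      by (rule second_moment_le[OF sigma_finite_measure_axioms]) measurable
    finally show "(\<integral>\<^sup>+\<omega>. ennreal ((S \<gamma> n \<omega> - I \<gamma> \<omega>)\<^sup>2) \<partial>M) \<le> \<dots>" .
  qed
qed

section \<open>The spectral side of the isometry\<close>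

definition spectral_measure :: "(real^2) measure" where
  "spectral_measure = density lborel (\<lambda>\<xi>. ennreal (f \<xi>))"

text \<open>The kernel of the spectral representation, regarded as a deterministic field in which
  the frequency takes the place of chance.\<close>

definition E :: "(real^2) \<times> (real^2) \<Rightarrow> complex" where
  "E p = exp (\<i> * complex_of_real (snd p \<bullet> fst p)) - 1"

lemma f_measurable [measurable]: "f \<in> borel_measurable borel" and f_nonneg: "0 \<le> f \<xi>"
  and f_integrable: "integrable lborel (\<lambda>\<xi>. min 1 ((norm \<xi>)\<^sup>2) * f \<xi>)"
  using spectral by (auto simp: spectral_density_def)

lemma E_measurable: "E \<in> borel_measurable (spectral_measure \<Otimes>\<^sub>M lborel)"
proof -
  have "E \<in> borel_measurable (borel \<Otimes>\<^sub>M borel)" unfolding E_def[abs_def] by measurable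
  then show ?thesis
    by (simp add: spectral_measure_def cong: measurable_cong_sets sets_pair_measure_cong)
qed

lemma spectral_measure_sigma_finite: "sigma_finite_measure spectral_measure"
  unfolding spectral_measure_def
  by (subst sigma_finite_measure.sigma_finite_iff_density_finite[OF sigma_finite_lborel]) auto

lemma E_inner: "(LINT \<xi>|spectral_measure. E (\<xi>, x) * cnj (E (\<xi>, y))) = complex_of_real (expectation (\<lambda>\<omega>. X x \<omega> * X y \<omega>))"
proof -
  have "(LINT \<xi>|spectral_measure. E (\<xi>, x) * cnj (E (\<xi>, y))) = (LINT \<xi>|lborel. f \<xi> *\<^sub>R (E (\<xi>, x) * cnj (E (\<xi>, y))))"
    unfolding spectral_measure_def
    by (rule integral_density) (auto simp: f_nonneg E_def)
  also have "\<dots> = (LINT \<xi>|lborel. (exp (\<i> * complex_of_real (x \<bullet> \<xi>)) - 1) *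
          (exp (- (\<i> * complex_of_real (y \<bullet> \<xi>))) - 1) * complex_of_real (f \<xi>))"
    by (simp add: E_def exp_cnj scaleR_conv_of_real mult.commute)
  also have "\<dots> = complex_of_real (expectation (\<lambda>\<omega>. X x \<omega> * X y \<omega>))"
    using spectral unfolding spectral_density_def by simp
  finally show ?thesis .
qed

text \<open>The value is v x by the spectral representation, but that equation uses the Bochner
  integral, so integrability comes first. The constant 4 + |x|^2 combines |E| \<le> 2 with |E| \<le>
  |x| |xi| to match the factor min 1 (|xi|^2) in the definition of a spectral density.\<close>

lemma E_second_moment: "(\<integral>\<^sup>+\<xi>. ennreal ((cmod (E (\<xi>, x)))\<^sup>2) \<partial>spectral_measure) \<le> ennreal (K * (weight H x)\<^sup>2)"
proof -
  have [measurable]: "(\<lambda>\<xi>. E (\<xi>, x)) \<in> borel_measurable borel" unfolding E_def fst_conv snd_conv by measurable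
  have i: "integrable lborel (\<lambda>\<xi>. f \<xi> * (cmod (E (\<xi>, x)))\<^sup>2)"
  proof (rule Bochner_Integration.integrable_bound)
    show "integrable lborel (\<lambda>\<xi>. (4 + (norm x)\<^sup>2) * (min 1 ((norm \<xi>)\<^sup>2) * f \<xi>))"
      by (intro integrable_mult_right f_integrable)
    show "AE \<xi> in lborel. norm (f \<xi> * (cmod (E (\<xi>, x)))\<^sup>2) \<le> norm ((4 + (norm x)\<^sup>2) * (min 1 ((norm \<xi>)\<^sup>2) * f \<xi>))"
    proof (intro AE_I2)
      fix \<xi> :: "real^2"
      have "cmod (E (\<xi>, x)) \<le> 2"
        using norm_triangle_ineq4[of "exp (\<i> * complex_of_real (x \<bullet> \<xi>))" 1] by (simp add: E_def)
      then have e4: "(cmod (E (\<xi>, x)))\<^sup>2 \<le> 4" using power_mono[of "cmod (E (\<xi>, x))" 2 2] by simp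
      have "cmod (E (\<xi>, x)) \<le> norm x * norm \<xi>"
        using order_trans[OF iexp_minus_1_le Cauchy_Schwarz_ineq2] by (simp add: E_def)
      then have e2: "(cmod (E (\<xi>, x)))\<^sup>2 \<le> (norm x)\<^sup>2 * (norm \<xi>)\<^sup>2"
        using power_mono[of "cmod (E (\<xi>, x))" "norm x * norm \<xi>" 2] by (simp add: power_mult_distrib)
      have "(cmod (E (\<xi>, x)))\<^sup>2 \<le> (4 + (norm x)\<^sup>2) * min 1 ((norm \<xi>)\<^sup>2)"
      proof (cases "1 \<le> (norm \<xi>)\<^sup>2")
        case True
        then show ?thesis using e4 by (simp add: add_increasing2)
      next
        case False
        then have "(cmod (E (\<xi>, x)))\<^sup>2 \<le> 4 * (norm \<xi>)\<^sup>2 + (norm x)\<^sup>2 * (norm \<xi>)\<^sup>2"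
          using e2 zero_le_power2[of "norm \<xi>"] by linarith
        then show ?thesis using False by (simp add: min_def distrib_right)
      qed
      then have "f \<xi> * (cmod (E (\<xi>, x)))\<^sup>2 \<le> f \<xi> * ((4 + (norm x)\<^sup>2) * min 1 ((norm \<xi>)\<^sup>2))"
        by (intro mult_left_mono f_nonneg)
      then show "norm (f \<xi> * (cmod (E (\<xi>, x)))\<^sup>2) \<le> norm ((4 + (norm x)\<^sup>2) * (min 1 ((norm \<xi>)\<^sup>2) * f \<xi>))"
        using f_nonneg[of \<xi>] by (simp add: abs_mult mult_ac)
    qed
  qed measurable
  have "(\<integral>\<^sup>+\<xi>. ennreal ((cmod (E (\<xi>, x)))\<^sup>2) \<partial>spectral_measure) = (\<integral>\<^sup>+\<xi>. ennreal (f \<xi> * (cmod (E (\<xi>, x)))\<^sup>2) \<partial>lborel)"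
    unfolding spectral_measure_def by (subst nn_integral_density) (auto simp: ennreal_mult f_nonneg)
  also have "\<dots> = ennreal (LINT \<xi>|lborel. f \<xi> * (cmod (E (\<xi>, x)))\<^sup>2)"
    by (rule nn_integral_eq_integral[OF i]) (simp add: f_nonneg)
  also have "(LINT \<xi>|lborel. f \<xi> * (cmod (E (\<xi>, x)))\<^sup>2) = v x"
  proof -
    have "complex_of_real (LINT \<xi>|lborel. f \<xi> * (cmod (E (\<xi>, x)))\<^sup>2) = (LINT \<xi>|lborel. f \<xi> *\<^sub>R (E (\<xi>, x) * cnj (E (\<xi>, x))))"
      unfolding integral_complex_of_real[symmetric]
      by (simp only: scaleR_conv_of_real[where 'a=complex] of_real_mult complex_norm_square)
    also have "\<dots> = (LINT \<xi>|spectral_measure. E (\<xi>, x) * cnj (E (\<xi>, x)))"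
      unfolding spectral_measure_def by (rule integral_density[symmetric]) (auto simp: f_nonneg)
    also have "\<dots> = complex_of_real (v x)"
      unfolding E_inner by (simp add: v_def power2_eq_square)
    finally show ?thesis by (simp only: of_real_eq_iff)
  qed
  also have "ennreal (v x) \<le> ennreal (K * (weight H x)\<^sup>2)" by (rule ennreal_leI) (rule K)
  finally show ?thesis .
qed

lemma Z_inner: "(LINT \<omega>|M. Z (\<omega>, x) * cnj (Z (\<omega>, y))) = complex_of_real (expectation (\<lambda>\<omega>. X x \<omega> * X y \<omega>))"
proof -
  have "(LINT \<omega>|M. Z (\<omega>, x) * cnj (Z (\<omega>, y))) = (LINT \<omega>|M. complex_of_real (X x \<omega> * X y \<omega>))"
    by (rule integral_cong_AE) (use X'_version(2)[of x] X'_version(2)[of y] in \<open>auto simp: Z_def\<close>)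
  then show ?thesis by (simp only: integral_complex_of_real)
qed

text \<open>Mean zero removes the constant -1 of the kernel. The exponent has the opposite sign to
  that of \<open>fourier\<close>, and since \<gamma> is real this amounts to a conjugation.\<close>

lemma E_integral:
  assumes "integrable lborel \<gamma>" "(LINT x|lborel. \<gamma> x) = 0"
  shows "(LINT x|lborel. complex_of_real (\<gamma> x) * E (\<xi>, x)) = cnj (fourier (\<lambda>x. complex_of_real (\<gamma> x)) \<xi>)"
proof -
  have "integrable lborel (\<lambda>x. complex_of_real (\<gamma> x) * exp (- (\<i> * complex_of_real (x \<bullet> (- \<xi>)))))"
    by (rule fourier_integrand_integrable) (use assms in simp)
  then have "(LINT x|lborel. complex_of_real (\<gamma> x) * exp (- (\<i> * complex_of_real (x \<bullet> (- \<xi>)))) - complex_of_real (\<gamma> x))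
     = (LINT x|lborel. complex_of_real (\<gamma> x) * exp (- (\<i> * complex_of_real (x \<bullet> (- \<xi>))))) - (LINT x|lborel. complex_of_real (\<gamma> x))"
    by (rule Bochner_Integration.integral_diff) (use assms in simp)
  also have "(LINT x|lborel. complex_of_real (\<gamma> x)) = 0"
    unfolding integral_complex_of_real assms(2) by simp
  also have "(LINT x|lborel. complex_of_real (\<gamma> x) * exp (- (\<i> * complex_of_real (x \<bullet> (- \<xi>))))) = cnj (fourier (\<lambda>x. complex_of_real (\<gamma> x)) \<xi>)"
    unfolding fourier_def Bochner_Integration.integral_cnj[symmetric] by (simp add: exp_cnj)
  finally show ?thesis by (simp add: E_def right_diff_distrib)
qed

text \<open>By \<open>Z_inner\<close> and \<open>E_inner\<close> the field and the spectral kernel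
  have the same mixed second moments, so the two instances of \<open>field_integral_isometry\<close>
  share their right-hand sides.\<close>

lemma I_covariance:
  assumes \<gamma>1: "weighted_integrable H \<gamma>1" "(LINT x|lborel. \<gamma>1 x) = 0"
    and \<gamma>2: "weighted_integrable H \<gamma>2" "(LINT x|lborel. \<gamma>2 x) = 0"
  shows "integrable M (\<lambda>\<omega>. I \<gamma>1 \<omega> * I \<gamma>2 \<omega>)"
    and "complex_of_real (expectation (\<lambda>\<omega>. I \<gamma>1 \<omega> * I \<gamma>2 \<omega>)) = (LINT \<xi>|lborel. f \<xi> *\<^sub>R
      (cnj (fourier (\<lambda>x. complex_of_real (\<gamma>1 x)) \<xi>) * fourier (\<lambda>x. complex_of_real (\<gamma>2 x)) \<xi>))"
proof -
  have [measurable]: "\<gamma>1 \<in> borel_measurable borel" "\<gamma>2 \<in> borel_measurable borel"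
    using \<gamma>1 \<gamma>2 by (auto simp: weighted_integrable_def)
  note A = field_integral_isometry[OF sigma_finite_measure_axioms Z_measurable K(1) Z_bound \<gamma>1(1) \<gamma>2(1), unfolded I_complex Z_inner]
  note B = field_integral_isometry(2)[OF spectral_measure_sigma_finite E_measurable K(1) E_second_moment \<gamma>1(1) \<gamma>2(1), unfolded E_inner]
  have i: "integrable M (\<lambda>\<omega>. complex_of_real (I \<gamma>1 \<omega> * I \<gamma>2 \<omega>))"
    using A(1) by simp
  from integrable_Re[OF i] show "integrable M (\<lambda>\<omega>. I \<gamma>1 \<omega> * I \<gamma>2 \<omega>)" by simp
  have "complex_of_real (expectation (\<lambda>\<omega>. I \<gamma>1 \<omega> * I \<gamma>2 \<omega>)) = (LINT \<omega>|M. complex_of_real (I \<gamma>1 \<omega>) * cnj (complex_of_real (I \<gamma>2 \<omega>)))"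
    unfolding integral_complex_of_real[symmetric] by simp
  also have "\<dots> = (LINT \<xi>|spectral_measure. (LINT x|lborel. complex_of_real (\<gamma>1 x) * E (\<xi>, x)) * cnj (LINT x|lborel. complex_of_real (\<gamma>2 x) * E (\<xi>, x)))"
    unfolding A(2) B ..
  also have "\<dots> = (LINT \<xi>|spectral_measure. cnj (fourier (\<lambda>x. complex_of_real (\<gamma>1 x)) \<xi>) * fourier (\<lambda>x. complex_of_real (\<gamma>2 x)) \<xi>)"
    using weighted_integrable_integrable[OF \<gamma>1(1)] weighted_integrable_integrable[OF \<gamma>2(1)] \<gamma>1(2) \<gamma>2(2)
    by (simp add: E_integral)
  also have "\<dots> = (LINT \<xi>|lborel. f \<xi> *\<^sub>R (cnj (fourier (\<lambda>x. complex_of_real (\<gamma>1 x)) \<xi>) * fourier (\<lambda>x. complex_of_real (\<gamma>2 x)) \<xi>))"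
    unfolding spectral_measure_def by (rule integral_density) (auto simp: f_nonneg)
  finally show "complex_of_real (expectation (\<lambda>\<omega>. I \<gamma>1 \<omega> * I \<gamma>2 \<omega>)) = \<dots>" .
qed

end

section \<open>The structure tensor\<close>

lemma weighted_integrable_lincomb:
  assumes "weighted_integrable H \<gamma>1" "weighted_integrable H \<gamma>2"
  shows "weighted_integrable H (\<lambda>x. a * \<gamma>1 x + b * \<gamma>2 x)"
proof -
  have [measurable]: "\<gamma>1 \<in> borel_measurable borel" "\<gamma>2 \<in> borel_measurable borel"
    using assms by (auto simp: weighted_integrable_def)
  have "integrable lborel (\<lambda>x. weight H x * \<bar>a * \<gamma>1 x + b * \<gamma>2 x\<bar>)"
  proof (rule Bochner_Integration.integrable_bound)
    show "integrable lborel (\<lambda>x. \<bar>a\<bar> * (weight H x * \<bar>\<gamma>1 x\<bar>) + \<bar>b\<bar> * (weight H x * \<bar>\<gamma>2 x\<bar>))"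
      using assms by (intro Bochner_Integration.integrable_add integrable_mult_right) (auto simp: weighted_integrable_def)
    show "AE x in lborel. norm (weight H x * \<bar>a * \<gamma>1 x + b * \<gamma>2 x\<bar>) \<le> norm (\<bar>a\<bar> * (weight H x * \<bar>\<gamma>1 x\<bar>) + \<bar>b\<bar> * (weight H x * \<bar>\<gamma>2 x\<bar>))"
    proof (intro AE_I2)
      fix x
      have "weight H x * \<bar>a * \<gamma>1 x + b * \<gamma>2 x\<bar> \<le> weight H x * (\<bar>a * \<gamma>1 x\<bar> + \<bar>b * \<gamma>2 x\<bar>)"
        by (intro mult_left_mono abs_triangle_ineq less_imp_le weight_pos)
      then show "norm (weight H x * \<bar>a * \<gamma>1 x + b * \<gamma>2 x\<bar>) \<le> norm (\<bar>a\<bar> * (weight H x * \<bar>\<gamma>1 x\<bar>) + \<bar>b\<bar> * (weight H x * \<bar>\<gamma>2 x\<bar>))"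
        using weight_pos[of H x] by (simp add: abs_mult distrib_left mult_ac)
    qed
  qed measurable
  then show ?thesis by (simp add: weighted_integrable_def)
qed

text \<open>Taking entries out of a matrix valued Bochner integral needs integrability of the whole,
  which is assembled from the entries through the unit matrices.\<close>

lemma integral_matrix_component:
  fixes Y :: "'w \<Rightarrow> complex^2^2"
  assumes "\<And>i j. integrable M (\<lambda>\<omega>. Y \<omega> $ i $ j)"
  shows "(LINT \<omega>|M. Y \<omega>) $ i $ j = (LINT \<omega>|M. Y \<omega> $ i $ j)"
proof -
  have bl: "bounded_linear (\<lambda>z::complex. axis i (axis j z) :: complex^2^2)" for i j
    unfolding linear_conv_bounded_linear[symmetric]
    by (rule linearI) (auto simp: axis_def vec_eq_iff)
  have eq: "Y \<omega> = (\<Sum>i\<in>UNIV. \<Sum>j\<in>UNIV. axis i (axis j (Y \<omega> $ i $ j)))" for \<omega>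
    by (simp add: vec_eq_iff forall_2 sum_2 axis_def)
  have Y: "integrable M Y"
    by (subst eq[abs_def]) (intro Bochner_Integration.integrable_sum integrable_bounded_linear[OF bl] assms)
  have "(LINT \<omega>|M. Y \<omega>) $ i $ j = (LINT \<omega>|M. Y \<omega> $ i) $ j"
    by (subst integral_bounded_linear[OF bounded_linear_vec_nth Y, symmetric]) simp
  also have "\<dots> = (LINT \<omega>|M. Y \<omega> $ i $ j)"
    by (rule integral_bounded_linear[OF bounded_linear_vec_nth integrable_bounded_linear[OF bounded_linear_vec_nth Y], symmetric])
  finally show ?thesis .
qed

lemma wavelet_structure_tensor_nth:
  "wavelet_structure_tensor M X \<psi> \<omega> $ i $ j = riesz_vector M X \<psi> \<omega> $ i * cnj (riesz_vector M X \<psi> \<omega> $ j)"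
proof -
  have "\<forall>i j. wavelet_structure_tensor M X \<psi> \<omega> $ i $ j = riesz_vector M X \<psi> \<omega> $ i * cnj (riesz_vector M X \<psi> \<omega> $ j)"
    unfolding forall_2 wavelet_structure_tensor_def Let_def vector_2 complex_norm_square by simp
  then show ?thesis by blast
qed

text \<open>At 0 the bound r^4 for the square beats the divisor, as 4 > 2 H + 1; at infinity
  boundedness is enough because 2 H + 1 > 1. The factor \<open>2 powr ?q\<close> comes from 1 + r
  \<le> 2 r for r > 1.\<close>

lemma radial_profile_integrable:
  fixes \<phi> :: "real \<Rightarrow> complex"
  assumes [measurable]: "\<phi> \<in> borel_measurable borel" and H: "0 < H" "H < 1"
    and small: "\<And>r. 0 < r \<Longrightarrow> cmod (\<phi> r) \<le> C * r\<^sup>2" and large: "\<And>r. cmod (\<phi> r) \<le> B"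
  shows "integrable lborel (\<lambda>r. indicator {0<..} r * ((cmod (\<phi> r))\<^sup>2 / r powr (2 * H + 1)))"
proof (rule Bochner_Integration.integrable_bound)
  let ?q = "2 * H + 1"
  show "integrable lborel (\<lambda>r::real. C\<^sup>2 * indicator {0<..1} r + B\<^sup>2 * 2 powr ?q * (1 + \<bar>r\<bar>) powr (- ?q))"
    using H by (intro Bochner_Integration.integrable_add integrable_mult_right integrable_inverse_power_real integrable_real_indicator) auto
  show "AE r in lborel. norm (indicator {0<..} r * ((cmod (\<phi> r))\<^sup>2 / r powr ?q))
     \<le> norm (C\<^sup>2 * indicator {0<..1} r + B\<^sup>2 * 2 powr ?q * (1 + \<bar>r\<bar>) powr (- ?q))"
  proof (intro AE_I2)
    fix r :: real
    have nn: "0 \<le> B\<^sup>2 * 2 powr ?q * (1 + \<bar>r\<bar>) powr (- ?q)" by simp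
    consider "r \<le> 0" | "0 < r" "r \<le> 1" | "1 < r" by linarith
    then show "norm (indicator {0<..} r * ((cmod (\<phi> r))\<^sup>2 / r powr ?q))
     \<le> norm (C\<^sup>2 * indicator {0<..1} r + B\<^sup>2 * 2 powr ?q * (1 + \<bar>r\<bar>) powr (- ?q))"
    proof cases
      case 1
      then show ?thesis by simp
    next
      case 2
      have "(cmod (\<phi> r))\<^sup>2 \<le> (C * r\<^sup>2)\<^sup>2" using small[OF 2(1)] by (intro power_mono) auto
      also have "\<dots> = C\<^sup>2 * r powr 4" using 2 by (simp add: power_mult_distrib powr_numeral flip: power_mult)
      also have "\<dots> \<le> C\<^sup>2 * r powr ?q" using 2 H by (intro mult_left_mono powr_mono') auto
      finally have "(cmod (\<phi> r))\<^sup>2 / r powr ?q \<le> C\<^sup>2" using 2 by (simp add: divide_le_eq)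
      from add_mono[OF this nn] show ?thesis using 2 by simp
    next
      case 3
      have "(1 + r) powr ?q \<le> (2 * r) powr ?q" using 3 H by (intro powr_mono2) auto
      also have "\<dots> = 2 powr ?q * r powr ?q" using 3 by (simp add: powr_mult)
      finally have le: "(1 + r) powr ?q \<le> 2 powr ?q * r powr ?q" .
      have "1 / b \<le> c * (1 / a)" if "a \<le> c * b" "0 < a" "0 < b" for a b c :: real
        using that by (simp add: field_simps)
      from this[OF le] have "1 / r powr ?q \<le> 2 powr ?q * (1 + r) powr (- ?q)"
        unfolding powr_minus_divide using 3 by simp
      moreover have "(cmod (\<phi> r))\<^sup>2 \<le> B\<^sup>2" using large[of r] by (intro power_mono) auto
      ultimately have "(cmod (\<phi> r))\<^sup>2 * (1 / r powr ?q) \<le> B\<^sup>2 * (2 powr ?q * (1 + r) powr (- ?q))"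
        by (intro mult_mono) auto
      then show ?thesis using 3 by (simp add: mult.assoc)
    qed
  qed
qed measurable

text \<open>\<open>arc_length\<close> lives on the circle, so values of the anisotropy function
  elsewhere never enter; this expresses that the tensor depends on that function alone.\<close>

lemma structure_tensor_cong:
  assumes "\<And>\<Theta>. \<Theta> \<in> sphere 0 1 \<Longrightarrow> C' \<Theta> = C \<Theta>"
  shows "structure_tensor C' = structure_tensor C"
  unfolding structure_tensor_def
  by (intro arg_cong[where f=vec_lambda] ext Bochner_Integration.integral_cong) (auto simp: space_arc_length assms)

text \<open>The quadratic form of the tensor at v is the integral of (v . \<Theta>)^2 C(\<Theta>)
  over the circle. The upper bound on \<open>C\<close> makes the entries integrable, so that the
  four terms may be gathered under one integral.\<close>

lemma nonneg_definite_structure_tensor: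
  assumes [measurable]: "C \<in> borel_measurable borel" and C0: "\<And>\<Theta>. \<Theta> \<in> sphere 0 1 \<Longrightarrow> 0 \<le> C \<Theta>"
    and CB: "\<And>\<Theta>. \<Theta> \<in> sphere 0 1 \<Longrightarrow> C \<Theta> \<le> B"
  shows "nonneg_definite (structure_tensor C)"
proof -
  define e where "e t = plane (cos t, sin t)" for t
  have em: "e \<in> borel_measurable borel" unfolding e_def by (rule plane_cos_sin_measurable)
  have [measurable]: "(\<lambda>t. e t $ i) \<in> borel_measurable borel" for i
    by (rule measurable_compose[OF em]) measurable
  have [measurable]: "(\<lambda>t. C (e t)) \<in> borel_measurable borel"
    by (rule measurable_compose[OF em assms(1)])
  have e1: "norm (e t) = 1" for t by (simp add: e_def)
  define g where "g i j t = indicator {0<..<2 * pi} t * (e t $ i * e t $ j * C (e t))" for i j and t :: real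
  have T: "structure_tensor C $ i $ j = (LINT t|lborel. g i j t)" for i j
    unfolding structure_tensor_def g_def e_def
    by (simp, rule integral_arc_length, rule measurable_restrict_space1) measurable
  have ig: "integrable lborel (g i j)" for i j
  proof (rule Bochner_Integration.integrable_bound)
    show "integrable lborel (\<lambda>t. indicator {0<..<2 * pi} t * B)" by simp
    show "g i j \<in> borel_measurable lborel" unfolding g_def by measurable
    show "AE t in lborel. norm (g i j t) \<le> norm (indicator {0<..<2 * pi} t * B)"
    proof (intro AE_I2)
      fix t
      have c: "\<bar>e t $ i\<bar> \<le> 1" for i using component_le_norm_cart[of "e t" i] e1[of t] by simp
      have "\<bar>e t $ i * e t $ j\<bar> * \<bar>C (e t)\<bar> \<le> (1 * 1) * B"
        unfolding abs_mult using C0[of "e t"] CB[of "e t"] e1[of t] by (intro mult_mono c) auto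
      then show "norm (g i j t) \<le> norm (indicator {0<..<2 * pi} t * B)"
        by (auto simp: g_def indicator_def abs_mult)
    qed
  qed
  have "0 \<le> v \<bullet> (structure_tensor C *v v)" for v
  proof -
    have "v \<bullet> (structure_tensor C *v v) = (LINT t|lborel. v $ 1 * v $ 1 * g 1 1 t + v $ 1 * v $ 2 * g 1 2 t + v $ 2 * v $ 1 * g 2 1 t + v $ 2 * v $ 2 * g 2 2 t)"
      using ig by (simp add: inner_vec_def matrix_vector_mult_def sum_2 T algebra_simps)
    also have "\<dots> = (LINT t|lborel. indicator {0<..<2 * pi} t * ((v $ 1 * e t $ 1 + v $ 2 * e t $ 2)\<^sup>2 * C (e t)))"
      by (intro Bochner_Integration.integral_cong refl) (simp add: g_def power2_eq_square algebra_simps)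
    also have "\<dots> \<ge> 0"
      using C0 e1 by (intro integral_nonneg_AE AE_I2) auto
    finally show ?thesis .
  qed
  moreover have "structure_tensor C $ i $ j = structure_tensor C $ j $ i" for i j
    unfolding T g_def by (simp add: mult.commute mult.left_commute)
  then have "transpose (structure_tensor C) = structure_tensor C"
    by (simp add: transpose_def vec_eq_iff)
  ultimately show ?thesis by (simp add: nonneg_definite_def)
qed

section \<open>Covariance of the pairings with the Riesz transforms\<close>

theorem theorem1:
  fixes M :: "'w measure"
    and X :: "real^2 \<Rightarrow> 'w \<Rightarrow> real"
    and H :: real
    and f C :: "real^2 \<Rightarrow> real"
    and \<psi> :: "real^2 \<Rightarrow> real"
    and \<phi> :: "real \<Rightarrow> complex"
  assumes "prob_space M"
    and "0 < H" "H < 1"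
    and "centered_gaussian_field M X"
    and "stochastically_continuous M X"
    and "stationary_increments M X"
    and "self_similar M H X"
    and "spectral_density M X f"
    and "anisotropy_function H f C"
    and "bounded (C ` sphere 0 1)"
    and "\<psi> \<in> borel_measurable borel"
    and "fast_decay \<psi>"
    and "zero_moments 2 \<psi>"
    and "\<And>\<xi>. fourier (\<lambda>x. complex_of_real (\<psi> x)) \<xi> = \<phi> (norm \<xi>)"
  shows "(\<forall>l. pairing_converges M X (riesz l (\<lambda>x. complex_of_real (\<psi> x)))) \<and>
    (AE \<omega> in M. \<forall>l. Im (riesz_vector M X \<psi> \<omega> $ l) = 0) \<and>
    centered_gaussian_vector M (\<lambda>\<omega>. \<chi> l. Re (riesz_vector M X \<psi> \<omega> $ l)) \<and>
    covariance_matrix M (riesz_vector M X \<psi>) = (LINT \<omega>|M. wavelet_structure_tensor M X \<psi> \<omega>) \<and>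
    set_integrable lborel {0<..} (\<lambda>r. (cmod (\<phi> r))\<^sup>2 / r powr (2 * H + 1)) \<and>
    (LINT \<omega>|M. wavelet_structure_tensor M X \<psi> \<omega>) =
      map_matrix complex_of_real
        ((LBINT r:{0<..}. (cmod (\<phi> r))\<^sup>2 / r powr (2 * H + 1)) *\<^sub>R structure_tensor C) \<and>
    nonneg_definite (structure_tensor C) \<and>
    (\<forall>C'. (\<forall>\<Theta>\<in>sphere 0 1. C' \<Theta> = C \<Theta>) \<longrightarrow> structure_tensor C' = structure_tensor C)"
proof -
  interpret gaussian_field M X H f
    using assms(1-8) by (simp add: gaussian_field_def gaussian_field_axioms_def)
  note \<psi> = assms(11-13)
  note [measurable] = \<psi>(1)
  define P where "P = fourier (\<lambda>x. complex_of_real (\<psi> x))"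
  have [measurable]: "P \<in> borel_measurable borel" unfolding P_def by measurable
  define g where "g l = riesz l (\<lambda>x. complex_of_real (\<psi> x))" for l
  \<comment> \<open>The chosen representatives are complex valued and real only almost everywhere;
    their real parts are real test functions with the same integrals.\<close>
  define \<gamma> where "\<gamma> l x = Re (g l x)" for l x
  have [measurable]: "g l \<in> borel_measurable borel" for l
    unfolding g_def by (rule riesz_measurable[OF \<psi>])
  have [measurable]: "\<gamma> l \<in> borel_measurable borel" for l unfolding \<gamma>_def[abs_def] by measurable
  have g\<gamma>: "AE x in lborel. g l x = complex_of_real (\<gamma> l x)" for l
    using riesz_real[OF \<psi>, of l] unfolding g_def[symmetric] \<gamma>_def by eventually_elim (simp add: complex_eq_iff)
  have wi: "weighted_integrable H (\<gamma> l)" for l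
  proof -
    have "integrable lborel (\<lambda>x. weight H x * \<bar>\<gamma> l x\<bar>)"
    proof (rule Bochner_Integration.integrable_bound)
      show "integrable lborel (\<lambda>x. (1 + norm x) powr H * cmod (g l x))"
        unfolding g_def by (rule riesz_weighted_integrable[OF \<psi> assms(3)])
      show "AE x in lborel. norm (weight H x * \<bar>\<gamma> l x\<bar>) \<le> norm ((1 + norm x) powr H * cmod (g l x))"
        by (auto simp: weight_def \<gamma>_def abs_mult intro!: mult_left_mono abs_Re_le_cmod)
    qed measurable
    then show ?thesis by (simp add: weighted_integrable_def)
  qed
  have g_int: "integrable lborel (g l)" for l unfolding g_def by (rule riesz_integrable[OF \<psi>])
  have \<gamma>0: "(LINT x|lborel. \<gamma> l x) = 0" for l
  proof -
    have "(LINT x|lborel. \<gamma> l x) = Re (LINT x|lborel. g l x)"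
      unfolding \<gamma>_def by (rule integral_Re[OF g_int])
    then show ?thesis using integral_riesz[OF \<psi>, of l] by (simp add: g_def)
  qed
  have F\<gamma>: "AE \<xi> in lborel. fourier (\<lambda>x. complex_of_real (\<gamma> l x)) \<xi> = riesz_symbol l \<psi> \<xi>" for l
  proof -
    have "fourier (\<lambda>x. complex_of_real (\<gamma> l x)) \<xi> = fourier (g l) \<xi>" for \<xi>
      unfolding fourier_def by (rule integral_cong_AE) (use g\<gamma>[of l] in auto)
    then show ?thesis using fourier_riesz[OF \<psi>, of l] by (simp add: g_def)
  qed
  have sec[measurable]: "(\<lambda>x. X' x \<omega>) \<in> borel_measurable borel" if "\<omega> \<in> space M" for \<omega>
    using measurable_compose[OF measurable_Pair1'[OF that] X'_joint_measurable] by simp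
  \<comment> \<open>The exceptional null set lies in the space variable, so the identity holds at
    every outcome and not merely almost surely.\<close>
  have rv: "riesz_vector M X \<psi> \<omega> $ l = complex_of_real (I (\<gamma> l) \<omega>)" if "\<omega> \<in> space M" for \<omega> l
  proof -
    have "riesz_vector M X \<psi> \<omega> $ l = (LINT x|lborel. complex_of_real (X' x \<omega>) * g l x)"
      by (simp add: riesz_vector_def pairing_def X'_def g_def)
    also have "\<dots> = (LINT x|lborel. complex_of_real (\<gamma> l x * X' x \<omega>))"
      by (rule integral_cong_AE) (use g\<gamma>[of l] sec[OF that] in auto)
    finally show ?thesis by (simp only: I_def integral_complex_of_real)
  qed
  have conv: "pairing_converges M X (g l)" for l
  proof -
    have "AE \<omega> in M. integrable lborel (\<lambda>x. complex_of_real (X' x \<omega>) * g l x)"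
      using AE_integrable[OF wi[of l]] AE_space
    proof eventually_elim
      case (elim \<omega>)
      show ?case
        by (rule integrable_cong_AE_imp[OF integrable_of_real[OF elim(1)]])
           (use g\<gamma>[of l] sec[OF elim(2)] in auto)
    qed
    then show ?thesis
      using X'_version unfolding pairing_converges_def X'_def by auto
  qed
  have gauss: "centered_gaussian_vector M (\<lambda>\<omega>. \<chi> l. Re (riesz_vector M X \<psi> \<omega> $ l))"
    unfolding centered_gaussian_vector_def
  proof
    fix a :: "real^2"
    \<comment> \<open>A scalar product with the random vector is almost surely the pairing with one
      combined test function, so joint Gaussianity reduces to \<open>I_gaussian\<close>.\<close>
    let ?\<gamma> = "\<lambda>x. a $ 1 * \<gamma> 1 x + a $ 2 * \<gamma> 2 x"
    have eq: "a \<bullet> (\<chi> l. Re (riesz_vector M X \<psi> \<omega> $ l)) = a $ 1 * I (\<gamma> 1) \<omega> + a $ 2 * I (\<gamma> 2) \<omega>" if "\<omega> \<in> space M" for \<omega>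
      by (simp add: inner_vec_def sum_2 rv[OF that])
    show "centered_gaussian M (\<lambda>\<omega>. a \<bullet> (\<chi> l. Re (riesz_vector M X \<psi> \<omega> $ l)))"
    proof (rule centered_gaussian_cong_AE[OF I_gaussian[OF weighted_integrable_lincomb[OF wi wi]]])
      show "AE \<omega> in M. I ?\<gamma> \<omega> = a \<bullet> (\<chi> l. Re (riesz_vector M X \<psi> \<omega> $ l))"
        using AE_integrable[OF wi[of 1]] AE_integrable[OF wi[of 2]] AE_space
      proof eventually_elim
        case (elim \<omega>)
        have "I ?\<gamma> \<omega> = (LINT x|lborel. a $ 1 * (\<gamma> 1 x * X' x \<omega>) + a $ 2 * (\<gamma> 2 x * X' x \<omega>))"
          unfolding I_def by (simp add: distrib_right mult.assoc)
        also have "\<dots> = a $ 1 * I (\<gamma> 1) \<omega> + a $ 2 * I (\<gamma> 2) \<omega>"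
          unfolding I_def using elim by simp
        finally show ?case using eq[OF elim(3)] by simp
      qed
      show "(\<lambda>\<omega>. a \<bullet> (\<chi> l. Re (riesz_vector M X \<psi> \<omega> $ l))) \<in> borel_measurable M"
        by (subst measurable_cong[OF eq]) measurable
    qed
  qed
  have mean: "(LINT \<omega>|M. riesz_vector M X \<psi> \<omega> $ l) = 0" for l
  proof -
    have "(LINT \<omega>|M. riesz_vector M X \<psi> \<omega> $ l) = (LINT \<omega>|M. complex_of_real (I (\<gamma> l) \<omega>))"
      by (rule Bochner_Integration.integral_cong) (simp_all add: rv)
    then show ?thesis
      unfolding integral_complex_of_real using centered_gaussian_facts(3)[OF I_gaussian[OF wi]] by simp
  qed
  have tensor: "integrable M (\<lambda>\<omega>. wavelet_structure_tensor M X \<psi> \<omega> $ i $ j)"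
      "(LINT \<omega>|M. wavelet_structure_tensor M X \<psi> \<omega> $ i $ j) = complex_of_real (expectation (\<lambda>\<omega>. I (\<gamma> i) \<omega> * I (\<gamma> j) \<omega>))" for i j
  proof -
    have eq: "wavelet_structure_tensor M X \<psi> \<omega> $ i $ j = complex_of_real (I (\<gamma> i) \<omega> * I (\<gamma> j) \<omega>)" if "\<omega> \<in> space M" for \<omega>
      by (simp add: wavelet_structure_tensor_nth rv[OF that])
    show "integrable M (\<lambda>\<omega>. wavelet_structure_tensor M X \<psi> \<omega> $ i $ j)"
      by (subst Bochner_Integration.integrable_cong[OF refl eq], assumption, rule integrable_of_real)
        (rule I_covariance(1)[OF wi \<gamma>0 wi \<gamma>0])
    show "(LINT \<omega>|M. wavelet_structure_tensor M X \<psi> \<omega> $ i $ j) = complex_of_real (expectation (\<lambda>\<omega>. I (\<gamma> i) \<omega> * I (\<gamma> j) \<omega>))"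
      by (subst Bochner_Integration.integral_cong[OF refl eq]) (auto simp only: integral_complex_of_real)
  qed
  have cov: "covariance_matrix M (riesz_vector M X \<psi>) = (LINT \<omega>|M. wavelet_structure_tensor M X \<psi> \<omega>)"
    unfolding covariance_matrix_def mean
    by (simp add: vec_eq_iff integral_matrix_component tensor(1)) (simp add: wavelet_structure_tensor_nth)
  \<comment> \<open>\<open>C\<close> is measurable only as a function on the circle; its extension
    by 0 is Borel on the plane and has the same structure tensor.\<close>
  define C' where "C' x = indicator (sphere 0 1) x * C x" for x
  have C'm[measurable]: "C' \<in> borel_measurable borel"
    using assms(9) unfolding anisotropy_function_def C'_def
    by (subst (asm) borel_measurable_restrict_space_iff) auto
  obtain B where B: "\<And>\<Theta>. \<Theta> \<in> sphere 0 1 \<Longrightarrow> \<bar>C \<Theta>\<bar> \<le> B"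
    using assms(10) unfolding bounded_real by blast
  have C': "C' \<Theta> = C \<Theta>" "0 \<le> C' \<Theta>" "C' \<Theta> \<le> B" if "\<Theta> \<in> sphere 0 1" for \<Theta>
    using that B[OF that] assms(9) by (auto simp: C'_def anisotropy_function_def)
  have CC: "structure_tensor C' = structure_tensor C"
    by (rule structure_tensor_cong) (rule C')
  have nnd: "nonneg_definite (structure_tensor C)"
    unfolding CC[symmetric] by (rule nonneg_definite_structure_tensor[OF C'm, of B]) (use C' in auto)
  \<comment> \<open>\<open>\<phi>\<close> carries no measurability of its own. The transform along
    one axis is a measurable function that agrees with it on nonnegative reals.\<close>
  define \<phi>' where "\<phi>' r = P (r *\<^sub>R axis 1 1)" for r
  have [measurable]: "\<phi>' \<in> borel_measurable borel" unfolding \<phi>'_def by measurable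
  have \<phi>': "\<phi>' r = \<phi> \<bar>r\<bar>" "\<phi>' (norm \<xi>) = P \<xi>" for r \<xi>
    using assms(14) by (simp_all add: \<phi>'_def P_def)
  obtain A where A: "0 \<le> A" "\<And>\<xi>. cmod (P \<xi>) \<le> A * (norm \<xi>)\<^sup>2"
    using fourier_zero_moments_lipschitz[OF \<psi>] unfolding P_def by metis
  have rad: "integrable lborel (\<lambda>r. indicator {0<..} r * ((cmod (\<phi>' r))\<^sup>2 / r powr (2 * H + 1)))"
  proof (rule radial_profile_integrable[OF _ assms(2,3)])
    show "cmod (\<phi>' r) \<le> A * r\<^sup>2" for r using A(2)[of "r *\<^sub>R axis 1 1"] by (simp add: \<phi>'_def)
    show "cmod (\<phi>' r) \<le> (LINT x|lborel. cmod (complex_of_real (\<psi> x)))" for r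
      unfolding \<phi>'_def P_def by (rule fourier_bound[OF wavelet_integrable[OF \<psi>]])
  qed simp
  have rad_eq: "indicator {0<..} r * ((cmod (\<phi>' r))\<^sup>2 / r powr (2 * H + 1)) = indicator {0<..} r *\<^sub>R ((cmod (\<phi> r))\<^sup>2 / r powr (2 * H + 1))" for r
    by (simp add: \<phi>'(1) indicator_def)
  have si: "set_integrable lborel {0<..} (\<lambda>r. (cmod (\<phi> r))\<^sup>2 / r powr (2 * H + 1))"
    using rad unfolding set_integrable_def rad_eq .
  \<comment> \<open>The radial part of the spectral integrand. Together with the Jacobian r its
    exponent becomes -2 H - 2 + 1 = -(2 H + 1), which explains the power in the radial
    integral.\<close>
  define \<rho> where "\<rho> r = r powr (- 2 * H - 2) * (cmod (\<phi>' r))\<^sup>2" for r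
  have [measurable]: "\<rho> \<in> borel_measurable borel" unfolding \<rho>_def by measurable
  have \<rho>: "indicator {0<..} r * (r * \<rho> r) = indicator {0<..} r * ((cmod (\<phi>' r))\<^sup>2 / r powr (2 * H + 1))" for r
  proof (cases "0 < r")
    case True
    have "r * r powr (- 2 * H - 2) = r powr (1 + (- 2 * H - 2))"
      using True by (subst powr_add) simp
    also have "1 + (- 2 * H - 2) = - (2 * H + 1)" by simp
    also have "r powr (- (2 * H + 1)) = 1 / r powr (2 * H + 1)" by (rule powr_minus_divide)
    finally show ?thesis by (simp add: \<rho>_def mult.assoc[symmetric])
  qed simp
  have cv: "complex_of_real (expectation (\<lambda>\<omega>. I (\<gamma> i) \<omega> * I (\<gamma> j) \<omega>))
     = complex_of_real ((LBINT r:{0<..}. (cmod (\<phi> r))\<^sup>2 / r powr (2 * H + 1)) * structure_tensor C $ i $ j)" for i j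
  proof -
    define \<kappa> where "\<kappa> \<Theta> = \<Theta> $ i * \<Theta> $ j * C' \<Theta>" for \<Theta>
    have [measurable]: "\<kappa> \<in> borel_measurable borel" unfolding \<kappa>_def by measurable
    have "(LINT \<xi>|lborel. f \<xi> *\<^sub>R (cnj (fourier (\<lambda>x. complex_of_real (\<gamma> i x)) \<xi>) * fourier (\<lambda>x. complex_of_real (\<gamma> j x)) \<xi>))
      = (LINT \<xi>|lborel. complex_of_real (\<rho> (norm \<xi>) * \<kappa> (\<xi> /\<^sub>R norm \<xi>)))"
    proof (rule integral_cong_AE)
      have "AE \<xi> in lborel. f \<xi> = norm \<xi> powr (- 2 * H - 2) * C (\<xi> /\<^sub>R norm \<xi>)"
        using assms(9) unfolding anisotropy_function_def by blast
      then show "AE \<xi> in lborel. f \<xi> *\<^sub>R (cnj (fourier (\<lambda>x. complex_of_real (\<gamma> i x)) \<xi>) * fourier (\<lambda>x. complex_of_real (\<gamma> j x)) \<xi>)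
         = complex_of_real (\<rho> (norm \<xi>) * \<kappa> (\<xi> /\<^sub>R norm \<xi>))"
        \<comment> \<open>The origin is set aside because there \<xi> / |\<xi>| is not on the
          circle, and off the circle \<open>C'\<close> need not agree with \<open>C\<close>.\<close>
        using F\<gamma>[of i] F\<gamma>[of j] AE_lborel_singleton[of 0]
      proof eventually_elim
        case (elim \<xi>)
        \<comment> \<open>Conjugation makes the two factors -i cancel, and both symbols contain the
          same transform \<open>P\<close>; what is left is real and splits into direction and
          modulus.\<close>
        have "cnj (riesz_symbol i \<psi> \<xi>) * riesz_symbol j \<psi> \<xi> = complex_of_real (direction i \<xi> * direction j \<xi>) * (P \<xi> * cnj (P \<xi>))"
          by (simp add: riesz_symbol_def P_def mult_ac)
        also have "\<dots> = complex_of_real (direction i \<xi> * direction j \<xi> * (cmod (P \<xi>))\<^sup>2)"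
          by (simp only: of_real_mult complex_norm_square)
        finally have s: "cnj (riesz_symbol i \<psi> \<xi>) * riesz_symbol j \<psi> \<xi> = \<dots>" .
        have "C' (\<xi> /\<^sub>R norm \<xi>) = C (\<xi> /\<^sub>R norm \<xi>)" using elim(4) by (intro C') simp
        then have "f \<xi> * (direction i \<xi> * direction j \<xi> * (cmod (P \<xi>))\<^sup>2) = \<rho> (norm \<xi>) * \<kappa> (\<xi> /\<^sub>R norm \<xi>)"
          by (simp add: elim(1) \<rho>_def \<kappa>_def \<phi>'(2) direction_def divide_inverse)
        then show ?case
          unfolding elim(2,3) s by (simp only: scaleR_conv_of_real[where 'a=complex] of_real_mult[symmetric])
      qed
    qed measurable
    also have "\<dots> = complex_of_real (LINT \<xi>|lborel. \<rho> (norm \<xi>) * \<kappa> (\<xi> /\<^sub>R norm \<xi>))"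
      by (rule integral_complex_of_real)
    also have "(LINT \<xi>|lborel. \<rho> (norm \<xi>) * \<kappa> (\<xi> /\<^sub>R norm \<xi>))
       = (LINT r|lborel. indicator {0<..} r * (r * \<rho> r)) * (LINT \<Theta>|arc_length. \<kappa> \<Theta>)"
    proof (rule integral_polar_product)
      show "integrable lborel (\<lambda>r. indicator {0<..} r * (r * \<rho> r))" unfolding \<rho> by (rule rad)
      fix x :: "real^2" assume x: "norm x = 1"
      have c: "\<bar>x $ i\<bar> \<le> 1" for i using component_le_norm_cart[of x i] x by simp
      have "\<bar>x $ i * x $ j\<bar> * \<bar>C' x\<bar> \<le> (1 * 1) * B"
        unfolding abs_mult using C'[of x] x by (intro mult_mono c) auto
      then show "\<bar>\<kappa> x\<bar> \<le> B" by (simp add: \<kappa>_def abs_mult)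
    qed measurable
    also have "(LINT r|lborel. indicator {0<..} r * (r * \<rho> r)) = (LBINT r:{0<..}. (cmod (\<phi> r))\<^sup>2 / r powr (2 * H + 1))"
      unfolding \<rho> rad_eq set_lebesgue_integral_def ..
    also have "(LINT \<Theta>|arc_length. \<kappa> \<Theta>) = structure_tensor C $ i $ j"
      unfolding CC[symmetric] by (simp add: structure_tensor_def \<kappa>_def)
    finally show ?thesis
      using I_covariance(2)[OF wi \<gamma>0 wi \<gamma>0, of i j] by simp
  qed
  have "(LINT \<omega>|M. wavelet_structure_tensor M X \<psi> \<omega>) =
      map_matrix complex_of_real ((LBINT r:{0<..}. (cmod (\<phi> r))\<^sup>2 / r powr (2 * H + 1)) *\<^sub>R structure_tensor C)"
    by (simp add: vec_eq_iff integral_matrix_component tensor cv map_matrix_def)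
  moreover have "AE \<omega> in M. \<forall>l. Im (riesz_vector M X \<psi> \<omega> $ l) = 0"
    by (intro AE_I2) (simp add: rv)
  ultimately show ?thesis
    using conv[unfolded g_def] gauss cov si nnd structure_tensor_cong[of _ C] by blast
qed

end
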